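(* Let $\mathcal{G}=(\mathcal{V},\mathcal{E})$ be an undirected graph on $n$ vertices with public edge lengths such that every pair of vertices $u,v$ has a unique shortest path $P(u,v)$, and let $w:\mathcal{E}\to\mathbb{R}^{\ge 0}$ be a private attribute function. For every $\varepsilon>0$ there exists an efficient (polynomial-time) $\varepsilon$-differentially private algorithm which, given $\mathcal{G}$ and $w$, outputs estimates $\widehat f(u,v)$ for all pairs $u,v\in\mathcal{V}$ such that $$\Pr\left(\max_{u,v\in\mathcal{V}}\left|\widehat f(u,v)-f(u,v)\right| = O\!\left(\frac{n^{1/3}\log^{5/6} n}{\varepsilon}\right)\right)\ge 1-\frac{1}{n},$$ where $f(u,v)=\sum_{e\in P(u,v)} w(e)$ is the counting query along the shortest path.
   Context: The shortest paths (determined by the public edge lengths, i.e. the range system whose ranges are the edge sets of the shortest paths $P(u,v)$) are public; the attributes $w(e)$ are separate from the edge lengths and do not affect the shortest paths. Two attribute functions $w,w':\mathcal{E}\to\mathbb{R}^{\ge0}$ are neighboring if $\sum_{e\in\mathcal{E}}|w(e)-w'(e)|\le 1$. A randomized algorithm $\mathcal{A}$ taking $(\mathcal{G},w)$ as input is $(\varepsilon,\delta)$-differentially private if for all neighboring $w,w'$ and all sets $C$ of possible outputs, $\Pr[\mathcal{A}(\mathcal{G},w)\in C]\le e^{\varepsilon}\Pr[\mathcal{A}(\mathcal{G},w')\in C]+\delta$; it is $\varepsilon$-differentially private if this holds with $\delta=0$. *)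

theory Defs
  imports "HOL-Probability.Probability" "HOL-Computational_Algebra.Polynomial"
begin

section \<open>Graphs with public edge lengths\<close>

text \<open>The vertices are \<open>0, \<dots>, nverts G - 1\<close>. An edge is a two-element set of vertices;
  \<open>elen\<close> gives the public edge lengths and is only meaningful on \<open>edges G\<close>.\<close>

record lgraph =
  nverts :: nat
  edges :: "nat set set"
  elen :: "nat set \<Rightarrow> real"

definition verts :: "lgraph \<Rightarrow> nat set" where
  "verts G = {..<nverts G}"

definition wf_lgraph :: "lgraph \<Rightarrow> bool" where
  "wf_lgraph G \<longleftrightarrow> nverts G \<ge> 1 \<and>
     edges G \<subseteq> {{u, v} | u v. u \<in> verts G \<and> v \<in> verts G \<and> u \<noteq> v} \<and>
     (\<forall>e\<in>edges G. 0 \<le> elen G e)"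

definition path_edges :: "nat list \<Rightarrow> nat set list" where
  "path_edges xs = map2 (\<lambda>u v. {u, v}) xs (tl xs)"

definition is_path :: "lgraph \<Rightarrow> nat \<Rightarrow> nat \<Rightarrow> nat list \<Rightarrow> bool" where
  "is_path G u v xs \<longleftrightarrow> xs \<noteq> [] \<and> hd xs = u \<and> last xs = v \<and> distinct xs \<and>
     set xs \<subseteq> verts G \<and> set (path_edges xs) \<subseteq> edges G"

definition path_length :: "lgraph \<Rightarrow> nat list \<Rightarrow> real" where
  "path_length G xs = sum_list (map (elen G) (path_edges xs))"

definition is_shortest_path :: "lgraph \<Rightarrow> nat \<Rightarrow> nat \<Rightarrow> nat list \<Rightarrow> bool" where
  "is_shortest_path G u v xs \<longleftrightarrow> is_path G u v xs \<and>
     (\<forall>ys. is_path G u v ys \<longrightarrow> path_length G xs \<le> path_length G ys)"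

definition unique_shortest_paths :: "lgraph \<Rightarrow> bool" where
  "unique_shortest_paths G \<longleftrightarrow> (\<forall>u\<in>verts G. \<forall>v\<in>verts G. \<exists>!xs. is_shortest_path G u v xs)"

definition shortest_path :: "lgraph \<Rightarrow> nat \<Rightarrow> nat \<Rightarrow> nat list" where
  "shortest_path G u v = (THE xs. is_shortest_path G u v xs)"

definition public_graph :: "lgraph \<Rightarrow> bool" where
  "public_graph G \<longleftrightarrow> wf_lgraph G \<and> unique_shortest_paths G"


section \<open>Attributes and counting queries\<close>

type_synonym attributes = "nat set \<Rightarrow> real"

definition is_attribute :: "lgraph \<Rightarrow> attributes \<Rightarrow> bool" where
  "is_attribute G w \<longleftrightarrow> (\<forall>e\<in>edges G. 0 \<le> w e)"

definition counting_query :: "lgraph \<Rightarrow> attributes \<Rightarrow> nat \<Rightarrow> nat \<Rightarrow> real" where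
  "counting_query G w u v = (\<Sum>e\<in>set (path_edges (shortest_path G u v)). w e)"

definition neighboring :: "lgraph \<Rightarrow> attributes \<Rightarrow> attributes \<Rightarrow> bool" where
  "neighboring G w w' \<longleftrightarrow> (\<Sum>e\<in>edges G. \<bar>w e - w' e\<bar>) \<le> 1"


section \<open>Randomized algorithms and differential privacy\<close>

text \<open>A possible output assigns an estimate to every ordered pair of vertices. A randomized
  algorithm is represented by the distribution of its output on each input.\<close>

type_synonym estimates = "nat \<times> nat \<Rightarrow> real"

type_synonym algorithm = "lgraph \<Rightarrow> attributes \<Rightarrow> estimates measure"

definition output_space :: "lgraph \<Rightarrow> estimates measure" where
  "output_space G = Pi\<^sub>M (verts G \<times> verts G) (\<lambda>_. borel)"

definition differentially_private :: "real \<Rightarrow> real \<Rightarrow> algorithm \<Rightarrow> bool" where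
  "differentially_private \<epsilon> \<delta> A \<longleftrightarrow>
     (\<forall>G w w'. public_graph G \<and> is_attribute G w \<and> is_attribute G w' \<and> neighboring G w w' \<longrightarrow>
        (\<forall>C\<in>sets (output_space G).
           measure (A G w) C \<le> exp \<epsilon> * measure (A G w') C + \<delta>))"

abbreviation pure_differentially_private :: "real \<Rightarrow> algorithm \<Rightarrow> bool" where
  "pure_differentially_private \<epsilon> A \<equiv> differentially_private \<epsilon> 0 A"

definition max_error :: "lgraph \<Rightarrow> attributes \<Rightarrow> estimates \<Rightarrow> real" where
  "max_error G w f =
     Max ((\<lambda>(u, v). \<bar>f (u, v) - counting_query G w u v\<bar>) ` (verts G \<times> verts G))"


section \<open>Polynomial time\<close>

text \<open>The model of computation is a randomized real RAM, presented as a while language. Memory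
  consists of arrays of natural numbers and arrays of real numbers; an array is named by a fixed
  number and its cells are addressed by two computed indices (scalars live in cell (0, 0)).
  Natural numbers only have addition and truncated subtraction: with unit-cost multiplication, they
  could grow to exponentially many bits in polynomially many steps. Real numbers have the field
  operations, comparison and the logarithm, but no rounding and no conversion back to natural
  numbers. The only constants in a program are natural numbers. The source of randomness is a
  sequence of independent uniform samples from [0, 1]; Laplace noise is obtained from it with the
  help of the logarithm.\<close>

datatype nexp =
    NConst nat
  | NGet nat nexp nexp
  | NPlus nexp nexp
  | NMinus nexp nexp

datatype rexp =
    OfNat nexp
  | RGet nat nexp nexp
  | RPlus rexp rexp
  | RMinus rexp rexp
  | RTimes rexp rexp
  | RDivide rexp rexp
  | RLn rexp

datatype bexp =
    NLess nexp nexp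
  | RLess rexp rexp
  | BNot bexp
  | BAnd bexp bexp

datatype com =
    Skip
  | NPut nat nexp nexp nexp
  | RPut nat nexp nexp rexp
  | Sample nat nexp nexp
  | Seq com com
  | Cond bexp com com
  | While bexp com

text \<open>\<open>used\<close> counts the random samples drawn so far.\<close>

record state =
  nmem :: "nat \<Rightarrow> nat \<times> nat \<Rightarrow> nat"
  rmem :: "nat \<Rightarrow> nat \<times> nat \<Rightarrow> real"
  used :: nat

primrec nval :: "state \<Rightarrow> nexp \<Rightarrow> nat" where
  "nval s (NConst k) = k"
| "nval s (NGet a i j) = nmem s a (nval s i, nval s j)"
| "nval s (NPlus x y) = nval s x + nval s y"
| "nval s (NMinus x y) = nval s x - nval s y"

primrec rval :: "state \<Rightarrow> rexp \<Rightarrow> real" where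
  "rval s (OfNat x) = real (nval s x)"
| "rval s (RGet a i j) = rmem s a (nval s i, nval s j)"
| "rval s (RPlus x y) = rval s x + rval s y"
| "rval s (RMinus x y) = rval s x - rval s y"
| "rval s (RTimes x y) = rval s x * rval s y"
| "rval s (RDivide x y) = rval s x / rval s y"
| "rval s (RLn x) = ln (rval s x)"

primrec bval :: "state \<Rightarrow> bexp \<Rightarrow> bool" where
  "bval s (NLess x y) \<longleftrightarrow> nval s x < nval s y"
| "bval s (RLess x y) \<longleftrightarrow> rval s x < rval s y"
| "bval s (BNot b) \<longleftrightarrow> \<not> bval s b"
| "bval s (BAnd b c) \<longleftrightarrow> bval s b \<and> bval s c"

definition nput :: "nat \<Rightarrow> nat \<times> nat \<Rightarrow> nat \<Rightarrow> state \<Rightarrow> state" where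
  "nput a p x s = s\<lparr>nmem := (nmem s)(a := (nmem s a)(p := x))\<rparr>"

definition rput :: "nat \<Rightarrow> nat \<times> nat \<Rightarrow> real \<Rightarrow> state \<Rightarrow> state" where
  "rput a p x s = s\<lparr>rmem := (rmem s)(a := (rmem s a)(p := x))\<rparr>"

text \<open>\<open>exec \<omega> c s t s'\<close>: with the random samples \<open>\<omega>\<close>, command \<open>c\<close> takes state \<open>s\<close> to \<open>s'\<close> in
  \<open>t\<close> steps. Assignments and tests cost one step; as the expressions of a fixed program have
  bounded size, this counts elementary operations up to a constant factor.\<close>

inductive exec :: "(nat \<Rightarrow> real) \<Rightarrow> com \<Rightarrow> state \<Rightarrow> nat \<Rightarrow> state \<Rightarrow> bool" for \<omega> where
  Skip: "exec \<omega> Skip s 1 s"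
| NPut: "exec \<omega> (NPut a i j x) s 1 (nput a (nval s i, nval s j) (nval s x) s)"
| RPut: "exec \<omega> (RPut a i j x) s 1 (rput a (nval s i, nval s j) (rval s x) s)"
| Sample: "exec \<omega> (Sample a i j) s 1
    ((rput a (nval s i, nval s j) (\<omega> (used s)) s)\<lparr>used := used s + 1\<rparr>)"
| Seq: "exec \<omega> c\<^sub>1 s\<^sub>1 t\<^sub>1 s\<^sub>2 \<Longrightarrow> exec \<omega> c\<^sub>2 s\<^sub>2 t\<^sub>2 s\<^sub>3 \<Longrightarrow> exec \<omega> (Seq c\<^sub>1 c\<^sub>2) s\<^sub>1 (t\<^sub>1 + t\<^sub>2) s\<^sub>3"
| CondTrue: "bval s b \<Longrightarrow> exec \<omega> c\<^sub>1 s t s' \<Longrightarrow> exec \<omega> (Cond b c\<^sub>1 c\<^sub>2) s (t + 1) s'"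
| CondFalse: "\<not> bval s b \<Longrightarrow> exec \<omega> c\<^sub>2 s t s' \<Longrightarrow> exec \<omega> (Cond b c\<^sub>1 c\<^sub>2) s (t + 1) s'"
| WhileFalse: "\<not> bval s b \<Longrightarrow> exec \<omega> (While b c) s 1 s"
| WhileTrue: "bval s\<^sub>1 b \<Longrightarrow> exec \<omega> c s\<^sub>1 t\<^sub>1 s\<^sub>2 \<Longrightarrow> exec \<omega> (While b c) s\<^sub>2 t\<^sub>2 s\<^sub>3 \<Longrightarrow>
    exec \<omega> (While b c) s\<^sub>1 (t\<^sub>1 + t\<^sub>2 + 1) s\<^sub>3"

inductive_cases SkipE: "exec \<omega> Skip s t s'"
inductive_cases NPutE: "exec \<omega> (NPut a i j x) s t s'"
inductive_cases RPutE: "exec \<omega> (RPut a i j x) s t s'"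
inductive_cases SampleE: "exec \<omega> (Sample a i j) s t s'"
inductive_cases SeqE: "exec \<omega> (Seq c\<^sub>1 c\<^sub>2) s t s'"
inductive_cases CondE: "exec \<omega> (Cond b c\<^sub>1 c\<^sub>2) s t s'"
inductive_cases WhileE: "exec \<omega> (While b c) s t s'"

lemma exec_deterministic:
  "exec \<omega> c s t s' \<Longrightarrow> exec \<omega> c s u s'' \<Longrightarrow> u = t \<and> s'' = s'"
proof (induction arbitrary: u s'' rule: exec.induct)
  case (Seq c\<^sub>1 s\<^sub>1 t\<^sub>1 s\<^sub>2 c\<^sub>2 t\<^sub>2 s\<^sub>3)
  from Seq.prems obtain v\<^sub>1 v\<^sub>2 r where
    "u = v\<^sub>1 + v\<^sub>2" "exec \<omega> c\<^sub>1 s\<^sub>1 v\<^sub>1 r" "exec \<omega> c\<^sub>2 r v\<^sub>2 s''"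
    by (rule SeqE)
  then show ?case using Seq.IH(1)[of v\<^sub>1 r] Seq.IH(2)[of v\<^sub>2 s''] by simp
next
  case (CondTrue s b c\<^sub>1 t s' c\<^sub>2)
  from CondTrue.prems CondTrue.hyps(1) obtain v where "u = v + 1" "exec \<omega> c\<^sub>1 s v s''"
    by (auto elim: CondE)
  then show ?case using CondTrue.IH[of v s''] by simp
next
  case (CondFalse s b c\<^sub>2 t s' c\<^sub>1)
  from CondFalse.prems CondFalse.hyps(1) obtain v where "u = v + 1" "exec \<omega> c\<^sub>2 s v s''"
    by (auto elim: CondE)
  then show ?case using CondFalse.IH[of v s''] by simp
next
  case (WhileFalse s b c)
  from WhileFalse.prems show ?case by (rule WhileE) (use WhileFalse.hyps in simp_all)
next
  case (WhileTrue s\<^sub>1 b c t\<^sub>1 s\<^sub>2 t\<^sub>2 s\<^sub>3)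
  from WhileTrue.prems obtain v\<^sub>1 v\<^sub>2 r where
    "u = v\<^sub>1 + v\<^sub>2 + 1" "exec \<omega> c s\<^sub>1 v\<^sub>1 r" "exec \<omega> (While b c) r v\<^sub>2 s''"
    by (rule WhileE) (use WhileTrue.hyps(1) in auto)
  then show ?case using WhileTrue.IH(1)[of v\<^sub>1 r] WhileTrue.IH(2)[of v\<^sub>2 s''] by simp
next
  case (Skip s)
  then show ?case by (rule SkipE) simp
next
  case (NPut a i j x s)
  then show ?case by (rule NPutE) simp
next
  case (RPut a i j x s)
  then show ?case by (rule RPutE) simp
next
  case (Sample a i j s)
  then show ?case by (rule SampleE) simp
qed

text \<open>The input consists of the graph (number of vertices, adjacency matrix, matrix of edge
  lengths), the matrix of attributes, and the privacy parameter. All other cells are 0.\<close>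

definition input_state :: "real \<Rightarrow> lgraph \<Rightarrow> attributes \<Rightarrow> state" where
  "input_state \<epsilon> G w =
    \<lparr>nmem = (\<lambda>a (u, v).
        if a = 0 \<and> u = 0 \<and> v = 0 then nverts G
        else if a = 1 \<and> {u, v} \<in> edges G then 1
        else 0),
     rmem = (\<lambda>a (u, v).
        if a = 0 \<and> u = 0 \<and> v = 0 then \<epsilon>
        else if a = 1 \<and> {u, v} \<in> edges G then elen G {u, v}
        else if a = 2 \<and> {u, v} \<in> edges G then w {u, v}
        else 0),
     used = 0\<rparr>"

definition output_of :: "lgraph \<Rightarrow> state \<Rightarrow> estimates" where
  "output_of G s = restrict (rmem s 3) (verts G \<times> verts G)"

definition random_tape :: "(nat \<Rightarrow> real) measure" where
  "random_tape = Pi\<^sub>M UNIV (\<lambda>_. restrict_space lborel {0..1})"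

text \<open>The running time is bounded in the worst case, also over the random samples.\<close>

definition polynomial_time :: "real \<Rightarrow> algorithm \<Rightarrow> bool" where
  "polynomial_time \<epsilon> A \<longleftrightarrow>
     (\<exists>(c :: com) (p :: nat poly). \<forall>G w. public_graph G \<and> is_attribute G w \<longrightarrow>
        (\<exists>F \<in> random_tape \<rightarrow>\<^sub>M output_space G.
           A G w = distr random_tape (output_space G) F \<and>
           (\<forall>\<omega>\<in>space random_tape. \<exists>t s.
              exec \<omega> c (input_state \<epsilon> G w) t s \<and> t \<le> poly p (nverts G) \<and>
              output_of G s = F \<omega>)))"

end

theory Submission
  imports Defs
begin

text \<open>Every edge weight is released with Laplace noise of scale \<open>O(1/\<epsilon>)\<close>, which suffices for
  shortest paths with fewer than \<open>q\<^sup>2\<close> vertices, where \<open>q\<^sup>3\<close> is about \<open>n log n\<close>. For longer paths, a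
  deterministic greedy choice yields \<open>8 q\<close> roots (with repetitions) such that every path with
  \<open>h \<ge> q\<^sup>2\<close> vertices contains at least \<open>2 q h / n\<close> of them. The shortest-path tree of each root is
  decomposed into heavy paths, and these are cut into segments of about \<open>n / q\<close> edges. The
  segments of a tree are disjoint, so noise of scale \<open>O(q/\<epsilon>)\<close> on their weights preserves privacy. The
  distance from the root to a vertex is the sum of the noisy segments on the way and of \<open>O(q\<^sup>2)\<close>
  noisy edges left over at the \<open>O(log n)\<close> light edges. Finally, the estimate for a long path is the
  average over all roots on it: longer paths contain more segments, but also more roots, and
  averaging makes both effects cancel. Thus all errors are \<open>O(q (log n)\<^sup>1\<^sup>/\<^sup>2 / \<epsilon>)\<close>, which is
  \<open>O(n\<^sup>1\<^sup>/\<^sup>3 (log n)\<^sup>5\<^sup>/\<^sup>6 / \<epsilon>)\<close>.\<close>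

section \<open>Unique shortest paths\<close>

text \<open>Roots, trees and segments depend on the public graph alone. So the released values are
  noisy sums of private weights over fixed edge sets, privacy is a question of their L1 sensitivity,
  and all estimates are post-processing. Choosing the roots deterministically leaves the whole
  failure probability to the Laplace noise. The cancellation for long paths rests on independence: a
  path with h vertices and k roots meets at most q h / n segments in each tree, hence at most k q h
  / n <= k^2 / 2 independent samples of scale O(q / epsilon); their sum divided by k has deviation
  O(q / epsilon) for every h. The left-over edges use the same samples in all trees, so averaging
  does not help them. They must be few in each single tree: O(log n) runs of fewer than n / q edges
  amount to O(q^2) edges exactly because q^3 >= n log n. Edges of length 0 are allowed, so distances
  alone do not reveal which vertices lie on a shortest path. The lexicographic pair of length and
  number of vertices does, and both proof and program work with it.\<close>

lemma path_edges_simps [simp]: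
  "path_edges [] = []" "path_edges [x] = []"
  "path_edges (x # y # zs) = {x, y} # path_edges (y # zs)"
  by (simp_all add: path_edges_def)

lemma path_edges_append:
  "path_edges (xs @ y # ys) = path_edges (xs @ [y]) @ path_edges (y # ys)"
  by (induction xs rule: induct_list012) simp_all

lemma path_edges_snoc:
  "xs \<noteq> [] \<Longrightarrow> path_edges (xs @ [y]) = path_edges xs @ [{last xs, y}]"
  by (induction xs rule: induct_list012) simp_all

lemma path_edges_rev: "path_edges (rev xs) = rev (path_edges xs)"
proof (induction xs rule: induct_list012)
  case (3 x y zs)
  have "path_edges (rev (x # y # zs)) = path_edges ((rev zs @ [y]) @ [x])" by simp
  also have "\<dots> = path_edges (rev (y # zs)) @ [{y, x}]"
    by (subst path_edges_snoc) simp_all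
  finally show ?case using 3 by (simp add: insert_commute)
qed simp_all

lemma path_edges_subset: "e \<in> set (path_edges xs) \<Longrightarrow> e \<subseteq> set xs"
  by (induction xs rule: induct_list012) auto

lemma distinct_path_edges: "distinct xs \<Longrightarrow> distinct (path_edges xs)"
proof (induction xs rule: induct_list012)
  case (3 x y zs)
  then show ?case using path_edges_subset[of "{x, y}" "y # zs"] by auto
qed simp_all

section \<open>Walks, distances and vertex counts in a public graph\<close>

locale pgraph =
  fixes G :: lgraph
  assumes public: "public_graph G"
begin

abbreviation n :: nat where "n \<equiv> nverts G"

abbreviation sp :: "nat \<Rightarrow> nat \<Rightarrow> nat list" where "sp \<equiv> shortest_path G"

definition dist :: "nat \<Rightarrow> nat \<Rightarrow> real" where "dist u v = path_length G (sp u v)"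

text \<open>Vertices are counted rather than edges, so that \<open>hops u u = 1\<close> and the
  value 0 is free to mean "no path known yet" in the program.\<close>

definition hops :: "nat \<Rightarrow> nat \<Rightarrow> nat" where "hops u v = length (sp u v)"

text \<open>Paths without distinctness: concatenating two shortest paths need not give a simple
  path.\<close>

definition walk :: "nat \<Rightarrow> nat \<Rightarrow> nat list \<Rightarrow> bool" where
  "walk u v xs \<longleftrightarrow> xs \<noteq> [] \<and> hd xs = u \<and> last xs = v \<and> set xs \<subseteq> {..<n} \<and>
     set (path_edges xs) \<subseteq> edges G"

lemma n_pos: "n \<ge> 1" and elen_nonneg: "e \<in> edges G \<Longrightarrow> 0 \<le> elen G e"
  and edge_bounds: "{u, v} \<in> edges G \<Longrightarrow> u < n \<and> v < n \<and> u \<noteq> v"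
  using public unfolding public_graph_def wf_lgraph_def verts_def
  by (auto simp: doubleton_eq_iff)

lemma finite_edges: "finite (edges G)"
proof (rule finite_subset)
  show "edges G \<subseteq> Pow {..<n}"
    using public unfolding public_graph_def wf_lgraph_def verts_def by auto
qed simp

lemma is_path_iff: "is_path G u v xs \<longleftrightarrow> walk u v xs \<and> distinct xs"
  by (auto simp: is_path_def walk_def verts_def)

lemma sp_shortest: "u < n \<Longrightarrow> v < n \<Longrightarrow> is_shortest_path G u v (sp u v)"
  unfolding shortest_path_def by (rule theI')
    (use public in \<open>auto simp: public_graph_def unique_shortest_paths_def verts_def\<close>)

lemma sp_unique: "u < n \<Longrightarrow> v < n \<Longrightarrow> is_shortest_path G u v xs \<Longrightarrow> sp u v = xs"
  using public sp_shortest unfolding public_graph_def unique_shortest_paths_def verts_def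
  by blast

lemma sp_walk: "u < n \<Longrightarrow> v < n \<Longrightarrow> walk u v (sp u v)"
  and sp_distinct: "u < n \<Longrightarrow> v < n \<Longrightarrow> distinct (sp u v)"
  using sp_shortest by (auto simp: is_shortest_path_def is_path_iff)

lemma sp_nonempty: "u < n \<Longrightarrow> v < n \<Longrightarrow> sp u v \<noteq> []"
  and sp_hd: "u < n \<Longrightarrow> v < n \<Longrightarrow> hd (sp u v) = u"
  and sp_last: "u < n \<Longrightarrow> v < n \<Longrightarrow> last (sp u v) = v"
  and sp_subset: "u < n \<Longrightarrow> v < n \<Longrightarrow> set (sp u v) \<subseteq> {..<n}"
  and sp_edges: "u < n \<Longrightarrow> v < n \<Longrightarrow> set (path_edges (sp u v)) \<subseteq> edges G"
  using sp_walk by (auto simp: walk_def)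

lemma path_length_append:
  "path_length G (xs @ y # ys) = path_length G (xs @ [y]) + path_length G (y # ys)"
  unfolding path_length_def by (subst path_edges_append) simp

lemma path_length_nonneg: "set (path_edges xs) \<subseteq> edges G \<Longrightarrow> 0 \<le> path_length G xs"
  unfolding path_length_def by (intro sum_list_nonneg) (auto intro: elen_nonneg)

lemma walk_append_iff:
  "walk u v (xs @ y # ys) \<longleftrightarrow> walk u y (xs @ [y]) \<and> walk y v (y # ys)"
  unfolding walk_def by (subst path_edges_append) (cases xs; auto)

text \<open>Cutting out a cycle removes vertices and, lengths being nonnegative, does not increase
  the length. The length may stay the same because of edges of length 0; the last conjunct decides
  such ties.\<close>

lemma walk_shorten:
  assumes "walk u v xs"
  shows "\<exists>ys. is_path G u v ys \<and> path_length G ys \<le> path_length G xs \<and>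
    length ys \<le> length xs \<and> (length ys = length xs \<longrightarrow> ys = xs)"
  using assms
proof (induction "length xs" arbitrary: xs rule: less_induct)
  case less
  show ?case
  proof (cases "distinct xs")
    case True
    then show ?thesis using less.prems by (auto simp: is_path_iff)
  next
    case False
    then obtain as y bs cs where xs: "xs = as @ [y] @ bs @ [y] @ cs"
      using not_distinct_decomp by blast
    let ?ys = "as @ y # cs"
    have w1: "walk u y (as @ [y])" and w2: "walk y v (y # bs @ y # cs)"
      using less.prems walk_append_iff[of u v as y "bs @ y # cs"] by (auto simp: xs)
    have w3: "walk y y (y # bs @ [y])" and w4: "walk y v (y # cs)"
      using w2 walk_append_iff[of y v "y # bs" y cs] by auto
    have "walk u v ?ys" using w1 w4 walk_append_iff[of u v as y cs] by simp
    then obtain zs where zs: "is_path G u v zs" "path_length G zs \<le> path_length G ?ys"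
      "length zs \<le> length ?ys"
      using less.hyps[of ?ys] xs by auto
    have "path_length G xs = path_length G ?ys + path_length G (y # bs @ [y])"
      using path_length_append[of as y "bs @ y # cs"] path_length_append[of "y # bs" y cs]
        path_length_append[of as y cs] by (simp add: xs)
    moreover have "0 \<le> path_length G (y # bs @ [y])"
      using w3 by (intro path_length_nonneg) (simp add: walk_def)
    moreover have "length ?ys < length xs" by (simp add: xs)
    ultimately show ?thesis using zs by (intro exI[of _ zs]) auto
  qed
qed

lemma walk_ends: "walk u v xs \<Longrightarrow> u < n \<and> v < n"
  unfolding walk_def by (metis hd_in_set last_in_set lessThan_iff subsetD)

text \<open>Uniqueness is assumed for simple paths only. It carries over to walks because a walk of
  minimal length shortens to a simple path of minimal length, which must be \<open>sp u v\<close>.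
  Thus \<open>sp u v\<close> is the unique minimum among all walks in the lexicographic order of
  length and number of vertices.\<close>

lemma dist_le_walk: "walk u v xs \<Longrightarrow> dist u v \<le> path_length G xs"
  and hops_le_walk: "walk u v xs \<Longrightarrow> path_length G xs = dist u v \<Longrightarrow> hops u v \<le> length xs"
  and walk_eq_sp: "walk u v xs \<Longrightarrow> path_length G xs = dist u v \<Longrightarrow> length xs \<le> hops u v \<Longrightarrow>
    xs = sp u v"
proof -
  assume w: "walk u v xs"
  then have uv: "u < n" "v < n" using walk_ends by auto
  obtain ys where ys: "is_path G u v ys" "path_length G ys \<le> path_length G xs"
    "length ys \<le> length xs" "length ys = length xs \<Longrightarrow> ys = xs"
    using walk_shorten[OF w] by blast
  have min: "\<And>zs. is_path G u v zs \<Longrightarrow> dist u v \<le> path_length G zs"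
    using sp_shortest[OF uv] by (simp add: is_shortest_path_def dist_def)
  show le: "dist u v \<le> path_length G xs" using min[OF ys(1)] ys(2) by simp
  assume eq: "path_length G xs = dist u v"
  have "sp u v = ys"
    by (rule sp_unique[OF uv]) (use ys min eq in \<open>fastforce simp: is_shortest_path_def\<close>)
  then show "hops u v \<le> length xs" and "length xs \<le> hops u v \<Longrightarrow> xs = sp u v"
    using ys by (auto simp: hops_def)
qed

text \<open>Exchange argument: a better piece could be spliced into the whole path. The result of
  splicing is only a walk, hence the need for minimality over walks.\<close>

lemma sp_split:
  assumes "u < n" "v < n" "sp u v = xs @ y # ys"
  shows "sp u y = xs @ [y]" "sp y v = y # ys"
proof -
  have w: "walk u y (xs @ [y])" "walk y v (y # ys)"
    using sp_walk[OF assms(1,2)] walk_append_iff[of u v xs y ys] by (simp_all add: assms(3))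
  have d: "distinct (xs @ y # ys)" using sp_distinct[OF assms(1,2)] assms(3) by simp
  have len: "dist u v = path_length G (xs @ [y]) + path_length G (y # ys)"
    using path_length_append[of xs y ys] by (simp add: dist_def assms(3))
  have y: "y < n" using w walk_ends by blast
  show "sp u y = xs @ [y]"
  proof (rule sp_unique[OF assms(1) y])
    have "path_length G (xs @ [y]) \<le> path_length G zs" if path: "is_path G u y zs" for zs
    proof -
      obtain zs' where zs': "zs = zs' @ [y]"
        using path by (cases zs rule: rev_cases) (simp_all add: is_path_def)
      have "walk u v (zs' @ y # ys)"
        using path w(2) walk_append_iff[of u v zs' y ys] by (simp add: zs' is_path_iff)
      from dist_le_walk[OF this] show ?thesis
        using path_length_append[of zs' y ys] by (simp add: len zs')
    qed
    then show "is_shortest_path G u y (xs @ [y])"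
      using w d by (auto simp: is_shortest_path_def is_path_iff)
  qed
  show "sp y v = y # ys"
  proof (rule sp_unique[OF y assms(2)])
    have "path_length G (y # ys) \<le> path_length G zs" if path: "is_path G y v zs" for zs
    proof -
      obtain zs' where zs': "zs = y # zs'"
        using path by (cases zs) (auto simp: is_path_def)
      have "walk u v (xs @ y # zs')"
        using path w(1) walk_append_iff[of u v xs y zs'] by (simp add: zs' is_path_iff)
      from dist_le_walk[OF this] show ?thesis
        using path_length_append[of xs y zs'] by (simp add: len zs')
    qed
    then show "is_shortest_path G y v (y # ys)"
      using w d by (auto simp: is_shortest_path_def is_path_iff)
  qed
qed

lemma sp_rev: assumes "u < n" "v < n" shows "sp v u = rev (sp u v)"
proof -
  have R: "is_path G b a (rev xs)" if "is_path G a b xs" for a b xs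
    using that by (auto simp: is_path_def path_edges_rev hd_rev last_rev)
  have L: "path_length G (rev xs) = path_length G xs" for xs
    by (simp add: path_length_def path_edges_rev sum_list_rev flip: rev_map)
  show ?thesis
  proof (rule sp_unique[OF assms(2,1)])
    have "path_length G (rev (sp u v)) \<le> path_length G ys" if "is_path G v u ys" for ys
      using sp_shortest[OF assms] R[OF that] L unfolding is_shortest_path_def by metis
    then show "is_shortest_path G v u (rev (sp u v))"
      using sp_shortest[OF assms] R by (auto simp: is_shortest_path_def)
  qed
qed

lemma hops_commute: "u < n \<Longrightarrow> v < n \<Longrightarrow> hops v u = hops u v"
  using sp_rev[of u v] by (simp add: hops_def)

text \<open>This turns membership in a path into the test \<open>on_path\<close> on two tables of
  numbers. The vertex \<open>y\<close> belongs to both halves, hence the \<open>+ 1\<close>.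
  Distances alone would not do: a vertex attached to the path by an edge of length 0 satisfies the
  second equation as well.\<close>

lemma on_sp_iff:
  assumes "u < n" "v < n" "y < n"
  shows "y \<in> set (sp u v) \<longleftrightarrow>
    hops u y + hops y v = hops u v + 1 \<and> dist u y + dist y v = dist u v"
proof
  assume "y \<in> set (sp u v)"
  then obtain xs ys where "sp u v = xs @ y # ys" by (meson split_list)
  with sp_split[OF assms(1,2) this]
  show "hops u y + hops y v = hops u v + 1 \<and> dist u y + dist y v = dist u v"
    using path_length_append[of xs y ys] by (simp add: hops_def dist_def)
next
  assume *: "hops u y + hops y v = hops u v + 1 \<and> dist u y + dist y v = dist u v"
  obtain xs where xs: "sp u y = xs @ [y]"
    using sp_nonempty sp_last assms by (metis append_butlast_last_id)
  obtain ys where ys: "sp y v = y # ys"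
    using sp_nonempty[of y v] sp_hd[of y v] assms by (cases "sp y v") auto
  have "walk u v (xs @ y # ys)"
    using sp_walk[of u y] sp_walk[of y v] assms walk_append_iff[of u v xs y ys]
    by (simp add: xs ys)
  from walk_eq_sp[OF this] * have "xs @ y # ys = sp u v"
    using path_length_append[of xs y ys] by (simp add: dist_def hops_def xs ys)
  then show "y \<in> set (sp u v)" by (metis in_set_conv_decomp)
qed

lemma sp_self [simp]: "u < n \<Longrightarrow> sp u u = [u]"
  by (rule walk_eq_sp[symmetric])
    (use path_length_nonneg[OF sp_edges[of u u]] dist_le_walk[of u u "[u]"] sp_nonempty[of u u]
      in \<open>auto simp: walk_def dist_def path_length_def hops_def Suc_le_eq\<close>)

lemma hops_ge_1: "u < n \<Longrightarrow> v < n \<Longrightarrow> hops u v \<ge> 1"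
  using sp_nonempty by (simp add: hops_def Suc_le_eq)

lemma hops_le_n: assumes "u < n" "v < n" shows "hops u v \<le> n"
  using card_mono[OF _ sp_subset[OF assms]] distinct_card[OF sp_distinct[OF assms]]
  by (simp add: hops_def)

lemma hops_self [simp]: "u < n \<Longrightarrow> hops u u = 1"
  and dist_self [simp]: "u < n \<Longrightarrow> dist u u = 0"
  by (simp_all add: hops_def dist_def path_length_def)

lemma hops_eq_1_iff: assumes "u < n" "v < n" shows "hops u v = 1 \<longleftrightarrow> u = v"
proof
  assume "hops u v = 1"
  then obtain a where "sp u v = [a]" by (auto simp: hops_def length_Suc_conv)
  then show "u = v" using sp_hd[OF assms] sp_last[OF assms] by simp
qed (use assms in auto)

lemma sp_in_last: "u < n \<Longrightarrow> v < n \<Longrightarrow> v \<in> set (sp u v)"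
  using sp_nonempty sp_last by (metis last_in_set)

subsection \<open>Shortest-path trees\<close>

definition parent :: "nat \<Rightarrow> nat \<Rightarrow> nat" where
  "parent x z = last (butlast (sp x z))"

lemma parent:
  assumes "x < n" "z < n" "x \<noteq> z"
  shows "sp x z = sp x (parent x z) @ [z]" "parent x z < n" "{parent x z, z} \<in> edges G"
    "hops x z = Suc (hops x (parent x z))"
    "dist x z = dist x (parent x z) + elen G {parent x z, z}"
    "hops (parent x z) z = 2"
proof -
  let ?p = "parent x z"
  let ?ys = "butlast (sp x z)"
  have 1: "sp x z = ?ys @ [z]"
    using sp_nonempty sp_last assms by (metis append_butlast_last_id)
  have ne: "?ys \<noteq> []" using 1 sp_hd[OF assms(1,2)] assms(3) by (cases ?ys) auto
  have 2: "?ys = butlast ?ys @ [?p]" unfolding parent_def using ne by simp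
  have 3: "sp x z = butlast ?ys @ ?p # [z]" by (subst 1, subst 2) simp
  have s: "sp x ?p = ?ys" "sp ?p z = [?p, z]" using sp_split[OF assms(1,2) 3] 2 by auto
  show sz: "sp x z = sp x ?p @ [z]" using 1 s by simp
  have pe: "path_edges (sp x z) = path_edges (sp x ?p) @ [{?p, z}]"
    using path_edges_snoc[OF ne, of z] 1 s by (metis parent_def)
  then show e: "{?p, z} \<in> edges G" using sp_edges[OF assms(1,2)] by simp
  then show "?p < n" using edge_bounds by blast
  show "hops x z = Suc (hops x ?p)" using sz by (simp add: hops_def)
  show "dist x z = dist x ?p + elen G {?p, z}" using pe by (simp add: dist_def path_length_def)
  show "hops ?p z = 2" by (simp add: hops_def s)
qed

text \<open>The form in which the program recognises tree edges: parents are found from the tables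
  of distances and vertex counts, without storing predecessors.\<close>

lemma parent_iff:
  assumes "x < n" "z < n" "p < n"
  shows "p \<in> set (sp x z) \<and> hops p z = 2 \<longleftrightarrow> x \<noteq> z \<and> p = parent x z"
proof
  assume *: "p \<in> set (sp x z) \<and> hops p z = 2"
  then obtain xs ys where sz: "sp x z = xs @ p # ys" by (meson split_list)
  then have s: "sp x p = xs @ [p]" "sp p z = p # ys" using sp_split assms by blast+
  then obtain a where "ys = [a]" using * by (auto simp: hops_def length_Suc_conv numeral_2_eq_2)
  then have sz': "sp x z = xs @ [p, z]" using sz sp_last[of x z] assms by simp
  then have "x \<noteq> z" using assms by auto
  then show "x \<noteq> z \<and> p = parent x z" using sz' by (simp add: parent_def butlast_append)
next
  assume *: "x \<noteq> z \<and> p = parent x z"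
  then show "p \<in> set (sp x z) \<and> hops p z = 2"
    using parent[of x z] sp_in_last[of x p] assms by auto
qed

lemma sp_tree_induct [consumes 2, case_names root child]:
  assumes "x < n" "z < n" "P x"
    "\<And>z. z < n \<Longrightarrow> z \<noteq> x \<Longrightarrow> P (parent x z) \<Longrightarrow> P z"
  shows "P z"
  using assms(2)
proof (induction "hops x z" arbitrary: z rule: less_induct)
  case less
  show ?case
  proof (cases "x = z")
    case False
    note p = parent[OF assms(1) less.prems False]
    have "P (parent x z)" using less.hyps[of "parent x z"] p(2,4) by simp
    then show ?thesis using assms(4)[of z] less.prems False by simp
  qed (use assms in simp)
qed

section \<open>Additivity of counting queries along shortest paths\<close>

lemma counting_query_sum_list:
  assumes "u < n" "v < n"
  shows "counting_query G w u v = sum_list (map w (path_edges (sp u v)))"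
  unfolding counting_query_def
  by (simp add: sum_list_distinct_conv_sum_set distinct_path_edges sp_distinct assms)

lemma counting_query_self: "u < n \<Longrightarrow> counting_query G w u u = 0"
  by (simp add: counting_query_sum_list)

lemma counting_query_parent:
  assumes "x < n" "z < n" "x \<noteq> z"
  shows "counting_query G w x z = counting_query G w x (parent x z) + w {parent x z, z}"
proof -
  note p = parent[OF assms]
  have "path_edges (sp x z) = path_edges (sp x (parent x z)) @ [{parent x z, z}]"
    using p sp_nonempty sp_last assms by (metis path_edges_snoc)
  then show ?thesis using assms p by (simp add: counting_query_sum_list)
qed

lemma counting_query_split:
  assumes "u < n" "v < n" "x \<in> set (sp u v)"
  shows "counting_query G w u v = counting_query G w x u + counting_query G w x v"
proof -
  obtain xs ys where sz: "sp u v = xs @ x # ys" using assms(3) by (meson split_list)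
  have x: "x < n" using assms sp_subset by blast
  note s = sp_split[OF assms(1,2) sz]
  have "path_edges (sp x u) = rev (path_edges (sp u x))"
    using sp_rev[OF assms(1) x] by (simp add: path_edges_rev)
  then show ?thesis using assms x
    using path_edges_append[of xs x ys]
    by (simp add: counting_query_sum_list sz s sum_list_rev flip: rev_map)
qed

end

section \<open>Laplace noise\<close>

abbreviation unif :: "real measure" where "unif \<equiv> restrict_space lborel {0..1}"

text \<open>The quantile function of the standard Laplace distribution. The form
  \<open>0 - ln ...\<close> matches the program, whose expressions have no unary minus. Since
  \<open>ln 0 = 0\<close>, both end points 0 and 1 are mapped to 0.\<close>

definition lapl :: "real \<Rightarrow> real" where
  "lapl u = (if u < 1/2 then ln (2 * u) else 0 - ln (2 * (1 - u)))"

definition lapl_density :: "real \<Rightarrow> real" where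
  "lapl_density x = exp (- \<bar>x\<bar>) / 2"

lemma prob_space_unif: "prob_space unif"
  by (intro prob_spaceI) (simp add: emeasure_restrict_space space_restrict_space)

lemma lapl_measurable [measurable]: "lapl \<in> borel_measurable borel"
  unfolding lapl_def by measurable

lemma lapl_density_measurable [measurable]: "lapl_density \<in> borel_measurable borel"
  unfolding lapl_density_def by measurable

lemma measurable_unif: "f \<in> borel_measurable borel \<Longrightarrow> f \<in> borel_measurable unif"
  by (rule measurable_restrict_space1) simp

section \<open>Integrals and distribution function of the Laplace density\<close>

lemma nn_integral_exp_atLeast:
  assumes "c > 0"
  shows "(\<integral>\<^sup>+x. ennreal (exp (- (c * x)) / 2) * indicator {a..} x \<partial>lborel) =
    ennreal (exp (- (c * a)) / (2 * c))"
proof -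
  have "((\<lambda>x. - exp (- (c * x)) / (2 * c)) \<longlongrightarrow> - 0 / (2 * c)) at_top"
    by (intro tendsto_intros filterlim_compose[OF exp_at_bot] filterlim_uminus_at_bot_at_top[THEN filterlim_compose]
        filterlim_tendsto_pos_mult_at_top[OF tendsto_const assms] filterlim_ident) (use assms in auto)
  then have "(\<integral>\<^sup>+x. ennreal (exp (- (c * x)) / 2) * indicator {a..} x \<partial>lborel) =
      ennreal (0 - (- exp (- (c * a)) / (2 * c)))"
    using assms
    by (intro nn_integral_FTC_atLeast) (auto intro!: derivative_eq_intros)
  then show ?thesis by simp
qed

lemma nn_integral_reflect:
  fixes f :: "real \<Rightarrow> ennreal"
  assumes "f \<in> borel_measurable borel"
  shows "(\<integral>\<^sup>+x. f x \<partial>lborel) = (\<integral>\<^sup>+x. f (- x) \<partial>lborel)"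
  using nn_integral_real_affine[OF assms, of "- 1" 0] by simp

lemma nn_integral_exp_lessThan:
  assumes "c > 0"
  shows "(\<integral>\<^sup>+x. ennreal (exp (c * x) / 2) * indicator {..a} x \<partial>lborel) =
    ennreal (exp (c * a) / (2 * c))"
proof -
  have "(\<integral>\<^sup>+x. ennreal (exp (c * x) / 2) * indicator {..a} x \<partial>lborel) =
      (\<integral>\<^sup>+x. ennreal (exp (- (c * x)) / 2) * indicator {- a..} x \<partial>lborel)"
    by (subst nn_integral_reflect) (auto intro!: nn_integral_cong split: split_indicator)
  then show ?thesis using nn_integral_exp_atLeast[OF assms, of "- a"] by simp
qed

lemma nn_integral_split_0:
  fixes f :: "real \<Rightarrow> ennreal"
  assumes [measurable]: "f \<in> borel_measurable borel"
  shows "(\<integral>\<^sup>+x. f x \<partial>lborel) =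
    (\<integral>\<^sup>+x. f x * indicator {..0} x \<partial>lborel) + (\<integral>\<^sup>+x. f x * indicator {0..} x \<partial>lborel)"
proof -
  have "AE x in lborel. x \<noteq> (0::real)" by (rule AE_lborel_singleton)
  then have "(\<integral>\<^sup>+x. f x \<partial>lborel) =
      (\<integral>\<^sup>+x. f x * indicator {..0} x + f x * indicator {0..} x \<partial>lborel)"
    by (intro nn_integral_cong_AE) (auto split: split_indicator)
  then show ?thesis by (simp add: nn_integral_add)
qed

definition lapl_cdf :: "real \<Rightarrow> real" where
  "lapl_cdf a = (if a < 0 then exp a / 2 else 1 - exp (- a) / 2)"

lemma nn_integral_lapl_density_atMost:
  "(\<integral>\<^sup>+x. ennreal (lapl_density x) * indicator {..a} x \<partial>lborel) = ennreal (lapl_cdf a)"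
proof (cases "a < 0")
  case True
  have "(\<integral>\<^sup>+x. ennreal (lapl_density x) * indicator {..a} x \<partial>lborel) =
      (\<integral>\<^sup>+x. ennreal (exp (1 * x) / 2) * indicator {..a} x \<partial>lborel)"
    using True by (intro nn_integral_cong) (auto simp: lapl_density_def split: split_indicator)
  then show ?thesis using True nn_integral_exp_lessThan[of 1 a] by (simp add: lapl_cdf_def)
next
  case False
  have "(\<integral>\<^sup>+x. ennreal (lapl_density x) * indicator {..a} x \<partial>lborel) =
      (\<integral>\<^sup>+x. ennreal (exp (1 * x) / 2) * indicator {..0} x \<partial>lborel) +
      (\<integral>\<^sup>+x. ennreal (exp (- x) / 2) * indicator {0..a} x \<partial>lborel)"
    using False by (subst nn_integral_split_0)
      (auto simp: lapl_density_def split: split_indicator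
        intro!: arg_cong2[where f = plus] nn_integral_cong)
  also have "(\<integral>\<^sup>+x. ennreal (exp (- x) / 2) * indicator {0..a} x \<partial>lborel) =
      ennreal (- exp (- a) / 2 - (- exp (- 0) / 2))"
    using False by (intro nn_integral_FTC_Icc) (auto intro!: derivative_eq_intros)
  also have "(\<integral>\<^sup>+x. ennreal (exp (1 * x) / 2) * indicator {..0} x \<partial>lborel) = ennreal (1 / 2)"
    using nn_integral_exp_lessThan[of 1 0] by simp
  also have "ennreal (1 / 2) + ennreal (- exp (- a) / 2 - (- exp (- 0) / 2)) =
      ennreal (1 / 2 + (- exp (- a) / 2 - (- exp (- 0) / 2)))"
    using False by (intro ennreal_plus[symmetric]) auto
  finally show ?thesis using False by (simp add: lapl_cdf_def)
qed

text \<open>The end point \<open>u = 0\<close> is mapped to 0 and not to minus infinity, which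
  accounts for the condition \<open>0 < u\<close>; in the next lemma \<open>u = 1\<close> is
  exceptional for the same reason.\<close>

lemma lapl_le_iff_neg:
  assumes "a < 0" "0 \<le> u" "u \<le> 1"
  shows "lapl u \<le> a \<longleftrightarrow> 0 < u \<and> u \<le> exp a / 2"
proof -
  have e: "exp a < 1" using assms by simp
  consider "u = 0" | "0 < u" "u < 1/2" | "1/2 \<le> u" using assms by linarith
  then show ?thesis
  proof cases
    case 2
    have "ln (2 * u) \<le> a \<longleftrightarrow> 2 * u \<le> exp a" using 2 by (metis exp_le_cancel_iff exp_ln mult_pos_pos zero_less_numeral)
    then show ?thesis using 2 by (simp add: lapl_def field_simps)
  next
    case 3
    have "ln (2 * (1 - u)) \<le> 0" using 3 assms by (cases "u = 1") auto
    then have "\<not> lapl u \<le> a" using 3 assms by (simp add: lapl_def)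
    moreover have "\<not> u \<le> exp a / 2" using 3 e by linarith
    ultimately show ?thesis by simp
  qed (use assms in \<open>simp add: lapl_def\<close>)
qed

lemma lapl_le_iff_nonneg:
  assumes "0 \<le> a" "0 \<le> u" "u \<le> 1"
  shows "lapl u \<le> a \<longleftrightarrow> u \<le> 1 - exp (- a) / 2 \<or> u = 1"
proof -
  have e: "exp (- a) \<le> 1" using assms by simp
  consider "u = 1" | "u < 1/2" | "1/2 \<le> u" "u < 1" using assms by linarith
  then show ?thesis
  proof cases
    case 2
    have "ln (2 * u) \<le> 0" using 2 assms by (cases "u = 0") auto
    moreover have "u \<le> 1 - exp (- a) / 2" using 2 e by linarith
    ultimately show ?thesis using 2 assms by (simp add: lapl_def)
  next
    case 3
    have "- a \<le> ln (2 * (1 - u)) \<longleftrightarrow> exp (- a) \<le> 2 * (1 - u)"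
      using 3 by (metis diff_gt_0_iff_gt exp_le_cancel_iff exp_ln mult_pos_pos zero_less_numeral)
    then show ?thesis using 3 by (auto simp: lapl_def field_simps)
  qed (use assms in \<open>simp add: lapl_def\<close>)
qed

lemma distr_lapl: "distr unif borel lapl = density lborel lapl_density"
proof -
  interpret prob_space unif by (rule prob_space_unif)
  have "distributed unif lborel lapl (\<lambda>x. ennreal (lapl_density x))"
  proof (rule distributedI_borel_atMost[where g = lapl_cdf])
    show "random_variable borel lapl" by (rule measurable_unif) simp
    show "AE x in lborel. 0 \<le> lapl_density x" by (simp add: lapl_density_def)
    show "(\<integral>\<^sup>+x. ennreal (lapl_density x * indicator {..a} x) \<partial>lborel) = ennreal (lapl_cdf a)" for a
      using nn_integral_lapl_density_atMost[of a] by (simp add: ennreal_mult'' ennreal_indicator)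
    show "emeasure unif {u \<in> space unif. lapl u \<le> a} = ennreal (lapl_cdf a)" for a
    proof (cases "a < 0")
      case True
      have e: "exp a < 1" using True by simp
      have "{u \<in> space unif. lapl u \<le> a} = {0<..exp a / 2}"
      proof (rule set_eqI)
        fix u show "u \<in> {u \<in> space unif. lapl u \<le> a} \<longleftrightarrow> u \<in> {0<..exp a / 2}"
          using lapl_le_iff_neg[OF True, of u] order_trans[OF _ less_imp_le[OF e], of "2 * u"]
          by (auto simp: space_restrict_space)
      qed
      moreover have "exp a \<le> 2" using e by linarith
      then have "{0<..exp a / 2} \<subseteq> {0..1}" by auto
      ultimately show ?thesis
        using True by (simp add: emeasure_restrict_space lapl_cdf_def)
    next
      case False
      have e: "exp (- a) \<le> 1" "exp (- a) > 0" using False by auto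
      \<comment> \<open>The stray point 1, caused by \<open>lapl 1 = 0\<close>, is a null
        set.\<close>
      have "{u \<in> space unif. lapl u \<le> a} = {0..1 - exp (- a) / 2} \<union> {1}"
      proof (rule set_eqI)
        fix u
        have "u \<le> 1 - exp (- a) / 2 \<Longrightarrow> u \<le> 1" using e by linarith
        then show "u \<in> {u \<in> space unif. lapl u \<le> a} \<longleftrightarrow> u \<in> {0..1 - exp (- a) / 2} \<union> {1}"
        proof (cases "0 \<le> u \<and> u \<le> 1")
          case True
          then show ?thesis using lapl_le_iff_nonneg[of a u] False by (auto simp: space_restrict_space)
        qed (auto simp: space_restrict_space)
      qed
      moreover have "emeasure lborel ({0..1 - exp (- a) / 2} \<union> {1}) = emeasure lborel {0..1 - exp (- a) / 2}"
        by (rule emeasure_Un_null_set) auto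
      moreover have "{0..1 - exp (- a) / 2} \<union> {1} \<subseteq> {0..1}" by auto
      moreover have "0 \<le> 1 - exp (- a) / 2" using e by linarith
      ultimately show ?thesis
        using False by (simp add: emeasure_restrict_space lapl_cdf_def del: Un_insert_right)
    qed
  qed simp
  then show ?thesis by (simp add: distributed_def cong: distr_cong)
qed

section \<open>Laplace noise with centre q and scale b: shifts and exponential moments\<close>

definition laplace :: "real \<Rightarrow> real \<Rightarrow> real measure" where
  "laplace q b = distr unif borel (\<lambda>u. q + b * lapl u)"

lemma prob_space_laplace: "prob_space (laplace q b)"
  unfolding laplace_def
  by (intro prob_space.prob_space_distr prob_space_unif measurable_unif) simp

lemma sets_laplace [measurable_cong, simp]: "sets (laplace q b) = sets borel"
  and space_laplace [simp]: "space (laplace q b) = UNIV"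
  by (simp_all add: laplace_def)

lemma nn_integral_laplace:
  assumes [measurable]: "f \<in> borel_measurable borel"
  shows "(\<integral>\<^sup>+x. f x \<partial>laplace q b) = (\<integral>\<^sup>+x. ennreal (lapl_density x) * f (q + b * x) \<partial>lborel)"
proof -
  have "(\<integral>\<^sup>+x. f x \<partial>laplace q b) = (\<integral>\<^sup>+u. f (q + b * lapl u) \<partial>unif)"
    unfolding laplace_def by (intro nn_integral_distr measurable_unif) simp_all
  also have "\<dots> = (\<integral>\<^sup>+x. f (q + b * x) \<partial>distr unif borel lapl)"
    by (intro nn_integral_distr[symmetric] measurable_unif) simp_all
  finally show ?thesis by (simp add: distr_lapl nn_integral_density)
qed

text \<open>By the triangle inequality, a shift changes the density by at most the factor
  \<open>exp (\<bar>q - q'\<bar> / b)\<close>. Arbitrary nonnegative integrands instead of events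
  allow applying this to one coordinate of a product at a time.\<close>

lemma nn_integral_laplace_shift:
  assumes [measurable]: "f \<in> borel_measurable borel" and b: "b > 0"
  shows "(\<integral>\<^sup>+x. f x \<partial>laplace q b) \<le> ennreal (exp (\<bar>q - q'\<bar> / b)) * (\<integral>\<^sup>+x. f x \<partial>laplace q' b)"
proof -
  let ?t = "(q' - q) / b"
  \<comment> \<open>Translating by \<open>?t\<close> turns the argument \<open>q + b * x\<close> of
    \<open>f\<close> into \<open>q' + b * x\<close>, so that only the densities differ.\<close>
  have "(\<integral>\<^sup>+x. f x \<partial>laplace q b) = (\<integral>\<^sup>+x. ennreal (lapl_density (?t + x)) * f (q + b * (?t + x)) \<partial>lborel)"
    unfolding nn_integral_laplace[OF assms(1)]
    using nn_integral_real_affine[of "\<lambda>x. ennreal (lapl_density x) * f (q + b * x)" 1 ?t] by simp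
  also have "\<dots> \<le> (\<integral>\<^sup>+x. ennreal (exp (\<bar>q - q'\<bar> / b)) * (ennreal (lapl_density x) * f (q' + b * x)) \<partial>lborel)"
  proof (rule nn_integral_mono)
    fix x
    have "\<bar>q - q'\<bar> / b = \<bar>?t\<bar>" using b by (simp add: abs_minus_commute)
    moreover have "- \<bar>?t + x\<bar> \<le> \<bar>?t\<bar> - \<bar>x\<bar>" using abs_triangle_ineq[of "?t + x" "- ?t"] by simp
    ultimately have "lapl_density (?t + x) \<le> exp (\<bar>q - q'\<bar> / b) * lapl_density x"
      by (simp only: lapl_density_def times_divide_eq_right flip: exp_add) simp
    then have "ennreal (lapl_density (?t + x)) \<le> ennreal (exp (\<bar>q - q'\<bar> / b)) * ennreal (lapl_density x)"
      by (simp add: ennreal_leI flip: ennreal_mult')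
    moreover have "q + b * (?t + x) = q' + b * x" using b by (simp add: field_simps)
    ultimately show "ennreal (lapl_density (?t + x)) * f (q + b * (?t + x)) \<le>
        ennreal (exp (\<bar>q - q'\<bar> / b)) * (ennreal (lapl_density x) * f (q' + b * x))"
      by (metis mult.assoc mult_right_mono zero_le)
  qed
  also have "\<dots> = ennreal (exp (\<bar>q - q'\<bar> / b)) * (\<integral>\<^sup>+x. f x \<partial>laplace q' b)"
    unfolding nn_integral_laplace[OF assms(1)] by (intro nn_integral_cmult) simp
  finally show ?thesis .
qed

text \<open>The exact value is 1 / (1 - s^2). The sub-Gaussian bound follows from (1 - s^2) (1 + 2
  s^2) >= 1, which amounts to s^2 <= 1/2.\<close>

lemma laplace_mgf:
  assumes "\<bar>s\<bar> \<le> 1/2"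
  shows "(\<integral>\<^sup>+x. ennreal (exp (s * x)) \<partial>laplace 0 1) \<le> ennreal (exp (2 * s\<^sup>2))"
proof -
  have "(\<integral>\<^sup>+x. ennreal (exp (s * x)) \<partial>laplace 0 1) =
      (\<integral>\<^sup>+x. ennreal (lapl_density x * exp (s * x)) \<partial>lborel)"
    by (subst nn_integral_laplace) (simp_all add: ennreal_mult'')
  also have "\<dots> = (\<integral>\<^sup>+x. ennreal (exp ((1 + s) * x) / 2) * indicator {..0} x \<partial>lborel) +
      (\<integral>\<^sup>+x. ennreal (exp (- ((1 - s) * x)) / 2) * indicator {0..} x \<partial>lborel)"
    by (subst nn_integral_split_0)
      (auto simp: lapl_density_def algebra_simps split: split_indicator simp flip: exp_add
        intro!: arg_cong2[where f = plus] nn_integral_cong)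
  also have "\<dots> = ennreal (1 / (2 * (1 + s)) + 1 / (2 * (1 - s)))"
    using nn_integral_exp_lessThan[of "1 + s" 0] nn_integral_exp_atLeast[of "1 - s" 0] assms
    by (subst ennreal_plus) auto
  also have "1 / (2 * (1 + s)) + 1 / (2 * (1 - s)) = 1 / (1 - s\<^sup>2)"
  proof -
    have "1 - s\<^sup>2 = (1 + s) * (1 - s)" "1 + s \<noteq> 0" "1 - s \<noteq> 0"
      using assms by (auto simp: algebra_simps power2_eq_square)
    moreover have "1 / (2 * x) + 1 / (2 * (2 - x)) = 1 / (x * (2 - x))"
      if "x \<noteq> 0" "2 - x \<noteq> 0" for x :: real
      using that by (simp add: divide_simps)
    from this[of "1 + s"] have "1 + s \<noteq> 0 \<Longrightarrow> 1 - s \<noteq> 0 \<Longrightarrow>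
        1 / (2 * (1 + s)) + 1 / (2 * (1 - s)) = 1 / ((1 + s) * (1 - s))" by simp
    ultimately show ?thesis by metis
  qed
  also have "1 / (1 - s\<^sup>2) \<le> exp (2 * s\<^sup>2)"
  proof -
    have s: "s\<^sup>2 \<le> 1/2" using abs_le_square_iff[of s "1/2"] assms by (simp add: power2_eq_square)
    have "s\<^sup>2 * s\<^sup>2 \<le> s\<^sup>2 * (1/2)" using s by (intro mult_left_mono) auto
    then have "1 \<le> (1 - s\<^sup>2) * (1 + 2 * s\<^sup>2)" by (simp add: algebra_simps)
    then have "1 / (1 - s\<^sup>2) \<le> 1 + 2 * s\<^sup>2" using s by (simp add: divide_simps mult.commute)
    also have "\<dots> \<le> exp (2 * s\<^sup>2)" by (rule exp_ge_add_one_self)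
    finally show ?thesis .
  qed
  finally show ?thesis by (simp add: ennreal_leI)
qed

subsection \<open>Products of Laplace distributions\<close>

lemma product_sigma_finite_laplace: "product_sigma_finite (\<lambda>i. laplace (q i) (b i))"
  by (intro product_prob_space.axioms(1) product_prob_spaceI prob_space_laplace)

text \<open>Composition of Laplace mechanisms: the changes of the queries, each measured in units of
  its own scale, add up in the exponent.\<close>

lemma nn_integral_PiM_laplace_shift:
  fixes q q' b :: "'i \<Rightarrow> real"
  assumes "finite I" "\<And>i. i \<in> I \<Longrightarrow> b i > 0"
    "f \<in> borel_measurable (Pi\<^sub>M I (\<lambda>_. borel))"
  shows "(\<integral>\<^sup>+x. f x \<partial>Pi\<^sub>M I (\<lambda>i. laplace (q i) (b i))) \<le>
    ennreal (exp (\<Sum>i\<in>I. \<bar>q i - q' i\<bar> / b i)) * (\<integral>\<^sup>+x. f x \<partial>Pi\<^sub>M I (\<lambda>i. laplace (q' i) (b i)))"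
  using assms
proof (induction I arbitrary: f rule: finite_induct)
  case empty
  then show ?case by (simp add: PiM_empty)
next
  case (insert i I)
  interpret M: product_sigma_finite "\<lambda>i. laplace (q i) (b i)"
    by (rule product_sigma_finite_laplace)
  interpret N: product_sigma_finite "\<lambda>i. laplace (q' i) (b i)"
    by (rule product_sigma_finite_laplace)
  have sets: "sets (Pi\<^sub>M J (\<lambda>i. laplace (p i) (b i))) = sets (Pi\<^sub>M J (\<lambda>_. borel))" for J p
    by (intro sets_PiM_cong) simp_all
  note f [measurable] = insert.prems(2)
  let ?S = "\<Sum>i\<in>I. \<bar>q i - q' i\<bar> / b i" and ?c = "\<bar>q i - q' i\<bar> / b i"
  have meas_i: "(\<lambda>y. f (x(i := y))) \<in> borel_measurable borel" if "x \<in> space (Pi\<^sub>M I (\<lambda>_. borel))" for x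
    using that by measurable
  have meas_I: "(\<lambda>x. \<integral>\<^sup>+y. f (x(i := y)) \<partial>laplace (p i) (b i)) \<in> borel_measurable (Pi\<^sub>M I (\<lambda>_. borel))" for p
  proof -
    interpret prob_space "laplace (p i) (b i)" by (rule prob_space_laplace)
    show ?thesis by measurable
  qed
  have fM: "f \<in> borel_measurable (Pi\<^sub>M (insert i I) (\<lambda>i. laplace (p i) (b i)))" for p
    using f by (simp add: measurable_cong_sets[OF sets refl])
  have "(\<integral>\<^sup>+x. f x \<partial>Pi\<^sub>M (insert i I) (\<lambda>i. laplace (q i) (b i))) =
      (\<integral>\<^sup>+x. (\<integral>\<^sup>+y. f (x(i := y)) \<partial>laplace (q i) (b i)) \<partial>Pi\<^sub>M I (\<lambda>i. laplace (q i) (b i)))"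
    by (rule M.product_nn_integral_insert) (use insert.hyps fM in auto)
  also have "\<dots> \<le> ennreal (exp ?S) *
      (\<integral>\<^sup>+x. (\<integral>\<^sup>+y. f (x(i := y)) \<partial>laplace (q i) (b i)) \<partial>Pi\<^sub>M I (\<lambda>i. laplace (q' i) (b i)))"
    by (rule insert.IH[OF _ meas_I]) (use insert.prems(1) in auto)
  also have "\<dots> \<le> ennreal (exp ?S) *
      (\<integral>\<^sup>+x. ennreal (exp ?c) * (\<integral>\<^sup>+y. f (x(i := y)) \<partial>laplace (q' i) (b i)) \<partial>Pi\<^sub>M I (\<lambda>i. laplace (q' i) (b i)))"
    by (intro mult_left_mono nn_integral_mono nn_integral_laplace_shift meas_i)
      (use insert.prems(1) in \<open>auto simp: space_PiM\<close>)
  also have "\<dots> = ennreal (exp ?S) * (ennreal (exp ?c) *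
      (\<integral>\<^sup>+x. (\<integral>\<^sup>+y. f (x(i := y)) \<partial>laplace (q' i) (b i)) \<partial>Pi\<^sub>M I (\<lambda>i. laplace (q' i) (b i))))"
    using meas_I[of q'] by (subst nn_integral_cmult) (auto simp: measurable_cong_sets[OF sets refl])
  also have "(\<integral>\<^sup>+x. (\<integral>\<^sup>+y. f (x(i := y)) \<partial>laplace (q' i) (b i)) \<partial>Pi\<^sub>M I (\<lambda>i. laplace (q' i) (b i))) =
      (\<integral>\<^sup>+x. f x \<partial>Pi\<^sub>M (insert i I) (\<lambda>i. laplace (q' i) (b i)))"
    by (rule N.product_nn_integral_insert[symmetric]) (use insert.hyps fM in auto)
  finally show ?case
    using insert.hyps by (simp add: exp_add ennreal_mult mult_ac)
qed

lemma lapl_tape_measurable [measurable]: "(\<lambda>\<omega>. lapl (\<omega> j)) \<in> borel_measurable random_tape"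
proof -
  have "(\<lambda>\<omega>. \<omega> j) \<in> random_tape \<rightarrow>\<^sub>M unif"
    unfolding random_tape_def by (rule measurable_component_singleton) simp
  then show ?thesis by (rule measurable_compose[OF _ measurable_unif]) simp
qed

lemma distr_random_tape:
  fixes q b :: "nat \<Rightarrow> real"
  assumes J: "finite J"
  shows "distr random_tape (Pi\<^sub>M J (\<lambda>_. borel)) (\<lambda>\<omega>. \<lambda>j\<in>J. q j + b j * lapl (\<omega> j)) =
    Pi\<^sub>M J (\<lambda>j. laplace (q j) (b j))"
proof -
  interpret U: product_prob_space "\<lambda>_::nat. unif" UNIV
    by (intro product_prob_spaceI prob_space_unif)
  have m: "(\<lambda>u. q j + b j * lapl u) \<in> borel_measurable unif" for j
    by (rule measurable_unif) simp
  have m': "(\<lambda>\<omega>. \<lambda>j\<in>J. q j + b j * lapl (\<omega> j)) \<in> random_tape \<rightarrow>\<^sub>M Pi\<^sub>M J (\<lambda>_. borel)"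
    by (intro measurable_restrict) simp
  interpret L: product_sigma_finite "\<lambda>j. laplace (q j) (b j)"
    by (rule product_sigma_finite_laplace)
  show ?thesis
  proof (rule L.PiM_eqI[OF J])
    show "sets (distr random_tape (Pi\<^sub>M J (\<lambda>_. borel)) (\<lambda>\<omega>. \<lambda>j\<in>J. q j + b j * lapl (\<omega> j))) =
        sets (Pi\<^sub>M J (\<lambda>j. laplace (q j) (b j)))"
      by (simp cong: sets_PiM_cong)
    fix A assume A: "\<And>j. j \<in> J \<Longrightarrow> A j \<in> sets (laplace (q j) (b j))"
    let ?B = "\<lambda>j. (\<lambda>u. q j + b j * lapl u) -` A j \<inter> space unif"
    have "emeasure (distr random_tape (Pi\<^sub>M J (\<lambda>_. borel)) (\<lambda>\<omega>. \<lambda>j\<in>J. q j + b j * lapl (\<omega> j))) (Pi\<^sub>E J A) =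
        emeasure random_tape {\<omega> \<in> space random_tape. \<forall>j\<in>J. \<omega> j \<in> ?B j}"
    proof (subst emeasure_distr[OF m'])
      show "Pi\<^sub>E J A \<in> sets (Pi\<^sub>M J (\<lambda>_. borel))"
        using A J by (intro sets_PiM_I_finite) auto
      have "(\<lambda>\<omega>. \<lambda>j\<in>J. q j + b j * lapl (\<omega> j)) -` Pi\<^sub>E J A \<inter> space random_tape =
          {\<omega> \<in> space random_tape. \<forall>j\<in>J. \<omega> j \<in> ?B j}"
        by (auto simp: random_tape_def space_PiM PiE_iff)
      then show "emeasure random_tape ((\<lambda>\<omega>. \<lambda>j\<in>J. q j + b j * lapl (\<omega> j)) -` Pi\<^sub>E J A \<inter> space random_tape) =
          emeasure random_tape {\<omega> \<in> space random_tape. \<forall>j\<in>J. \<omega> j \<in> ?B j}" by simp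
    qed
    also have "\<dots> = (\<Prod>j\<in>J. emeasure unif (?B j))"
      unfolding random_tape_def
    proof (rule U.emeasure_PiM_Collect[OF subset_UNIV J])
      fix j assume "j \<in> J"
      then show "?B j \<in> sets unif" using A[of j] by (intro measurable_sets[OF m]) simp
    qed
    also have "\<dots> = (\<Prod>j\<in>J. emeasure (laplace (q j) (b j)) (A j))"
      using A by (intro prod.cong refl) (simp add: laplace_def emeasure_distr[OF m])
    finally show "emeasure (distr random_tape (Pi\<^sub>M J (\<lambda>_. borel)) (\<lambda>\<omega>. \<lambda>j\<in>J. q j + b j * lapl (\<omega> j))) (Pi\<^sub>E J A) =
        (\<Prod>j\<in>J. emeasure (laplace (q j) (b j)) (A j))" .
  qed
qed

lemma prob_space_random_tape: "prob_space random_tape"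
  unfolding random_tape_def by (intro prob_space_PiM prob_space_unif)

section \<open>Tail bounds for sums of Laplace samples\<close>

lemma nn_integral_exp_sum_lapl:
  assumes J: "finite J" and s: "\<bar>s\<bar> \<le> 1/2"
  shows "(\<integral>\<^sup>+\<omega>. ennreal (exp (s * (\<Sum>j\<in>J. lapl (\<omega> j)))) \<partial>random_tape) \<le>
    ennreal (exp (2 * s\<^sup>2 * real (card J)))"
proof -
  interpret L: product_sigma_finite "\<lambda>j::nat. laplace 0 1"
    by (rule product_sigma_finite_laplace)
  have m: "(\<lambda>\<omega>. \<lambda>j\<in>J. 0 + 1 * lapl (\<omega> j)) \<in> random_tape \<rightarrow>\<^sub>M Pi\<^sub>M J (\<lambda>_. borel)"
    by (intro measurable_restrict) simp
  have "(\<integral>\<^sup>+\<omega>. ennreal (exp (s * (\<Sum>j\<in>J. lapl (\<omega> j)))) \<partial>random_tape) =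
      (\<integral>\<^sup>+\<omega>. (\<Prod>j\<in>J. ennreal (exp (s * (\<lambda>j\<in>J. 0 + 1 * lapl (\<omega> j)) j))) \<partial>random_tape)"
    by (intro nn_integral_cong)
      (simp add: J exp_sum sum_distrib_left prod_ennreal)
  also have "\<dots> = (\<integral>\<^sup>+x. (\<Prod>j\<in>J. ennreal (exp (s * x j)))
      \<partial>distr random_tape (Pi\<^sub>M J (\<lambda>_. borel)) (\<lambda>\<omega>. \<lambda>j\<in>J. 0 + 1 * lapl (\<omega> j)))"
    by (rule nn_integral_distr[OF m, symmetric]) measurable
  also have "\<dots> = (\<integral>\<^sup>+x. (\<Prod>j\<in>J. ennreal (exp (s * x j))) \<partial>Pi\<^sub>M J (\<lambda>j. laplace 0 1))"
    by (subst distr_random_tape[OF J]) simp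
  also have "\<dots> = (\<Prod>j\<in>J. (\<integral>\<^sup>+x. ennreal (exp (s * x)) \<partial>laplace 0 1))"
    by (rule L.product_nn_integral_prod[OF J]) measurable
  also have "\<dots> \<le> (\<Prod>j\<in>J. ennreal (exp (2 * s\<^sup>2)))"
    using laplace_mgf[OF s] by (intro prod_mono_ennreal) auto
  also have "\<dots> = ennreal (exp (2 * s\<^sup>2 * real (card J)))"
    by (simp add: ennreal_power mult.commute flip: exp_of_nat_mult)
  finally show ?thesis .
qed

text \<open>Chernoff's bound with the parameter \<open>s\<close> left open;
  \<open>noise_tail\<close> chooses it. The sign \<open>r\<close> in the proof treats both tails at
  once.\<close>

lemma lapl_sum_tail:
  assumes J: "finite J" and s: "0 < s" "s * c \<le> 1/2" and c: "0 < c"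
  shows "measure random_tape {\<omega> \<in> space random_tape. t < \<bar>c * (\<Sum>j\<in>J. lapl (\<omega> j))\<bar>} \<le>
    2 * exp (2 * (s * c)\<^sup>2 * real (card J) - s * t)"
proof -
  interpret prob_space random_tape by (rule prob_space_random_tape)
  let ?Z = "\<lambda>\<omega>. \<Sum>j\<in>J. lapl (\<omega> j)"
  let ?B = "exp (2 * (s * c)\<^sup>2 * real (card J) - s * t)"
  have one: "prob {\<omega> \<in> space random_tape. t \<le> r * (c * ?Z \<omega>)} \<le> ?B" if "\<bar>r\<bar> = 1" for r :: real
  proof -
    let ?f = "\<lambda>\<omega>. ennreal (exp (s * c * r * ?Z \<omega>))"
    have sc: "\<bar>s * c * r\<bar> \<le> 1/2" "(s * c * r)\<^sup>2 = (s * c)\<^sup>2"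
      using s c that by (auto simp: abs_mult power_mult_distrib abs_square_eq_1)
    have "emeasure random_tape {\<omega> \<in> space random_tape. t \<le> r * (c * ?Z \<omega>)} \<le>
        emeasure random_tape {\<omega> \<in> space random_tape. 1 \<le> ennreal (exp (- (s * t))) * ?f \<omega>}"
    proof (intro emeasure_mono subsetI CollectI conjI)
      fix \<omega> assume *: "\<omega> \<in> {\<omega> \<in> space random_tape. t \<le> r * (c * ?Z \<omega>)}"
      then have "s * t \<le> s * (r * (c * ?Z \<omega>))" using s by (intro mult_left_mono) auto
      then have "1 \<le> exp (- (s * t)) * exp (s * c * r * ?Z \<omega>)" by (simp add: mult_ac flip: exp_add)
      then show "1 \<le> ennreal (exp (- (s * t))) * ?f \<omega>"
        by (metis ennreal_1 ennreal_leI ennreal_mult' exp_ge_zero)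
    qed (auto, measurable)
    also have "\<dots> \<le> ennreal (exp (- (s * t))) * (\<integral>\<^sup>+\<omega>. ?f \<omega> * indicator (space random_tape) \<omega> \<partial>random_tape)"
      by (rule nn_integral_Markov_inequality) measurable
    also have "(\<integral>\<^sup>+\<omega>. ?f \<omega> * indicator (space random_tape) \<omega> \<partial>random_tape) = (\<integral>\<^sup>+\<omega>. ?f \<omega> \<partial>random_tape)"
      by (intro nn_integral_cong) simp
    also have "ennreal (exp (- (s * t))) * \<dots> \<le> ennreal (exp (- (s * t))) * ennreal (exp (2 * (s * c)\<^sup>2 * real (card J)))"
      using nn_integral_exp_sum_lapl[OF J sc(1)] sc(2) by (intro mult_left_mono) auto
    also have "\<dots> = ennreal ?B" by (simp flip: ennreal_mult' exp_add)
    finally show ?thesis by (simp add: emeasure_eq_measure)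
  qed
  have "prob {\<omega> \<in> space random_tape. t < \<bar>c * ?Z \<omega>\<bar>} \<le>
      prob ({\<omega> \<in> space random_tape. t \<le> 1 * (c * ?Z \<omega>)} \<union> {\<omega> \<in> space random_tape. t \<le> (- 1) * (c * ?Z \<omega>)})"
    by (intro finite_measure_mono) (auto simp: abs_if split: if_splits)
  also have "\<dots> \<le> prob {\<omega> \<in> space random_tape. t \<le> 1 * (c * ?Z \<omega>)} + prob {\<omega> \<in> space random_tape. t \<le> (- 1) * (c * ?Z \<omega>)}"
    by (intro measure_Un_le) measurable
  also have "\<dots> \<le> ?B + ?B" using one[of 1] one[of "- 1"] by (intro add_mono) auto
  finally show ?thesis by simp
qed

section \<open>Cutting a shortest-path tree into segments\<close>

context pgraph
begin

section \<open>Ancestors, descendants and heavy edges\<close>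

lemma parent_in_sp:
  assumes "x < n" "v < n" "z \<in> set (sp x v)" "x \<noteq> z"
  shows "parent x z \<in> set (sp x v)"
proof -
  obtain xs ys where s: "sp x v = xs @ z # ys" using assms(3) by (meson split_list)
  have z: "z < n" using assms sp_subset by blast
  note sz = sp_split(1)[OF assms(1,2) s]
  have "sp x (parent x z) = xs" using parent(1)[OF assms(1) z assms(4)] sz by simp
  then have "parent x z \<in> set xs" using sp_in_last[OF assms(1)] parent(2)[OF assms(1) z assms(4)] by metis
  then show ?thesis using s by simp
qed

lemma hops_le_of_mem:
  assumes "x < n" "v < n" "z \<in> set (sp x v)"
  shows "hops x z \<le> hops x v" and "hops x z = hops x v \<Longrightarrow> z = v"
proof -
  have z: "z < n" using assms sp_subset by blast
  have 1: "hops x z + hops z v = hops x v + 1" using on_sp_iff[OF assms(1,2) z] assms(3) by simp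
  then show "hops x z \<le> hops x v" using hops_ge_1[OF z assms(2)] by linarith
  assume "hops x z = hops x v"
  then have "hops z v = 1" using 1 by simp
  then show "z = v" using hops_eq_1_iff z assms by blast
qed

lemma sp_same_level:
  assumes "x < n" "v < n" "z \<in> set (sp x v)" "z' \<in> set (sp x v)" "hops x z = hops x z'"
  shows "z = z'"
proof -
  obtain xs ys where s: "sp x v = xs @ z # ys" using assms(3) by (meson split_list)
  obtain xs' ys' where s': "sp x v = xs' @ z' # ys'" using assms(4) by (meson split_list)
  have "length xs = length xs'"
    using sp_split(1)[OF assms(1,2) s] sp_split(1)[OF assms(1,2) s'] assms(5) by (simp add: hops_def)
  then show ?thesis using s s' by simp
qed

definition desc :: "nat \<Rightarrow> nat \<Rightarrow> nat set" where
  "desc x z = {v. v < n \<and> z \<in> set (sp x v)}"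

text \<open>Instead of selecting a child with the most descendants, each child is compared with half
  of its parent's descendants. This is a local test that needs addition only. A vertex may have no
  heavy child, but never two.\<close>

definition heavy :: "nat \<Rightarrow> nat \<Rightarrow> bool" where
  "heavy x z \<longleftrightarrow> card (desc x (parent x z)) \<le> 2 * card (desc x z)"

lemma finite_desc [simp]: "finite (desc x z)"
  by (simp add: desc_def)

lemma desc_parent: "x < n \<Longrightarrow> x \<noteq> z \<Longrightarrow> desc x z \<subseteq> desc x (parent x z)"
  using parent_in_sp by (auto simp: desc_def)

lemma card_desc_le: "card (desc x z) \<le> n"
  using card_mono[of "{..<n}" "desc x z"] by (auto simp: desc_def)

text \<open>Two heavy siblings would have disjoint sets of descendants, each with at least half of
  the parent's, leaving no room for the parent itself.\<close>

lemma heavy_unique: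
  assumes x: "x < n" and z: "z < n" "x \<noteq> z" "heavy x z" and z': "z' < n" "x \<noteq> z'" "heavy x z'"
    and eq: "parent x z = parent x z'"
  shows "z = z'"
proof (rule ccontr)
  assume ne: "z \<noteq> z'"
  let ?p = "parent x z"
  note pz = parent[OF x z(1,2)] and pz' = parent[OF x z'(1,2)]
  have "desc x z \<inter> desc x z' = {}"
    using sp_same_level[OF x] ne pz(4) pz'(4) eq by (fastforce simp: desc_def)
  moreover have "?p \<notin> desc x z \<union> desc x z'"
    using hops_le_of_mem(1)[OF x pz(2), of z] hops_le_of_mem(1)[OF x pz(2), of z'] pz(4) pz'(4) eq
    by (auto simp: desc_def)
  moreover have "insert ?p (desc x z \<union> desc x z') \<subseteq> desc x ?p"
    using desc_parent[OF x z(2)] desc_parent[OF x z'(2)] eq sp_in_last[OF x pz(2)] pz(2)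
    by (auto simp: desc_def)
  then have "card (insert ?p (desc x z \<union> desc x z')) \<le> card (desc x ?p)"
    by (intro card_mono) simp_all
  ultimately have "card (desc x z) + card (desc x z') < card (desc x ?p)"
    by (simp add: card_Un_disjoint)
  then show False using z(3) z'(3) eq by (simp add: heavy_def)
qed

text \<open>An edge of the shortest-path tree of \<open>x\<close> is represented by its lower end. On the path from
  \<open>x\<close> to \<open>z\<close>, the third component of \<open>cut x \<mu> z\<close> consists of the lower ends of the completed
  segments, the second one of the edges of the heavy path of \<open>z\<close> since the last segment, and the
  first one of the remaining edges. A segment is completed when its number of edges times \<open>\<mu>\<close>
  reaches \<open>n\<close>; in particular, \<open>\<mu> = 0\<close> yields no segments at all.\<close>

function cut :: "nat \<Rightarrow> nat \<Rightarrow> nat \<Rightarrow> nat set \<times> nat set \<times> nat set" where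
  "cut x \<mu> z =
    (if x < n \<and> z < n \<and> x \<noteq> z then
      (case cut x \<mu> (parent x z) of (R, B, C) \<Rightarrow>
        if \<not> heavy x z then (insert z (R \<union> B), {}, C)
        else if (card B + 1) * \<mu> < n then (R, insert z B, C)
        else (R, {}, insert z C))
    else ({}, {}, {}))"
  by auto
termination
  by (relation "Wellfounded.measure (\<lambda>(x, \<mu>, z). hops x z)") (use parent(4) in auto)

declare cut.simps [simp del]

definition raw where "raw x \<mu> z = fst (cut x \<mu> z)"
definition run where "run x \<mu> z = fst (snd (cut x \<mu> z))"
definition ends where "ends x \<mu> z = snd (snd (cut x \<mu> z))"

definition is_end :: "nat \<Rightarrow> nat \<Rightarrow> nat \<Rightarrow> bool" where
  "is_end x \<mu> z \<longleftrightarrow> x \<noteq> z \<and> heavy x z \<and> n \<le> (card (run x \<mu> (parent x z)) + 1) * \<mu>"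

text \<open>On completion \<open>cut\<close> empties the run, so the segment has to be recovered
  from the run of the parent.\<close>

definition segment :: "nat \<Rightarrow> nat \<Rightarrow> nat \<Rightarrow> nat set" where
  "segment x \<mu> z = insert z (run x \<mu> (parent x z))"

lemma cut_root [simp]: "raw x \<mu> x = {}" "run x \<mu> x = {}" "ends x \<mu> x = {}"
  by (simp_all add: raw_def run_def ends_def cut.simps)

lemma cut_light:
  assumes "x < n" "z < n" "x \<noteq> z" "\<not> heavy x z"
  shows "raw x \<mu> z = insert z (raw x \<mu> (parent x z) \<union> run x \<mu> (parent x z))"
    "run x \<mu> z = {}" "ends x \<mu> z = ends x \<mu> (parent x z)"
  using assms by (simp_all add: raw_def run_def ends_def cut.simps[of x \<mu> z] split: prod.split)

lemma cut_heavy: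
  assumes "x < n" "z < n" "x \<noteq> z" "heavy x z" "\<not> is_end x \<mu> z"
  shows "raw x \<mu> z = raw x \<mu> (parent x z)" "run x \<mu> z = insert z (run x \<mu> (parent x z))"
    "ends x \<mu> z = ends x \<mu> (parent x z)"
  using assms by (auto simp: is_end_def raw_def run_def ends_def cut.simps[of x \<mu> z] split: prod.split)

lemma cut_end:
  assumes "x < n" "z < n" "is_end x \<mu> z"
  shows "raw x \<mu> z = raw x \<mu> (parent x z)" "run x \<mu> z = {}"
    "ends x \<mu> z = insert z (ends x \<mu> (parent x z))"
  using assms by (auto simp: is_end_def raw_def run_def ends_def cut.simps[of x \<mu> z] split: prod.split)

lemma cut_induct [consumes 2, case_names root light heavy fin]:
  assumes "x < n" "z < n" "P x"
    and "\<And>z. z < n \<Longrightarrow> x \<noteq> z \<Longrightarrow> \<not> heavy x z \<Longrightarrow> \<not> is_end x \<mu> z \<Longrightarrow> P (parent x z) \<Longrightarrow> P z"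
    and "\<And>z. z < n \<Longrightarrow> x \<noteq> z \<Longrightarrow> heavy x z \<Longrightarrow> \<not> is_end x \<mu> z \<Longrightarrow> P (parent x z) \<Longrightarrow> P z"
    and "\<And>z. z < n \<Longrightarrow> x \<noteq> z \<Longrightarrow> heavy x z \<Longrightarrow> is_end x \<mu> z \<Longrightarrow> P (parent x z) \<Longrightarrow> P z"
  shows "P z"
  using assms(1,2)
proof (induction rule: sp_tree_induct)
  case (child z)
  then show ?case using assms(4-6)[of z] is_end_def by metis
qed (use assms in simp)

lemma cut_subset:
  assumes "x < n" "z < n"
  shows "raw x \<mu> z \<union> run x \<mu> z \<union> ends x \<mu> z \<subseteq> set (sp x z) - {x}"
  using assms
proof (induction rule: cut_induct[where \<mu> = \<mu>])
  case (light z)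
  then show ?case using parent(1)[of x z] assms by (auto simp: cut_light)
next
  case (heavy z)
  then show ?case using parent(1)[of x z] assms by (auto simp: cut_heavy)
next
  case (fin z)
  then show ?case using parent(1)[of x z] assms by (auto simp: cut_end)
qed simp

lemma not_in_sp_parent: "x < n \<Longrightarrow> z < n \<Longrightarrow> x \<noteq> z \<Longrightarrow> z \<notin> set (sp x (parent x z))"
  using parent(1)[of x z] sp_distinct[of x z] by auto

lemma cut_notin_parent:
  assumes "x < n" "z < n" "x \<noteq> z"
  shows "z \<notin> raw x \<mu> (parent x z)" "z \<notin> run x \<mu> (parent x z)" "z \<notin> ends x \<mu> (parent x z)"
  using cut_subset[OF assms(1) parent(2)[OF assms], of \<mu>] not_in_sp_parent[OF assms] by auto

lemma cut_finite [simp]: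
  assumes "x < n" "z < n"
  shows "finite (raw x \<mu> z)" "finite (run x \<mu> z)" "finite (ends x \<mu> z)"
  using cut_subset[OF assms, of \<mu>] by (auto intro: finite_subset)

lemma raw_run_disjoint:
  assumes "x < n" "z < n"
  shows "raw x \<mu> z \<inter> run x \<mu> z = {}"
  using assms
proof (induction rule: cut_induct[where \<mu> = \<mu>])
  case (heavy z)
  then show ?case using cut_notin_parent[of x z] assms by (auto simp: cut_heavy)
qed (use assms in \<open>auto simp: cut_light cut_end\<close>)

lemma run_bound:
  assumes "x < n" "z < n"
  shows "card (run x \<mu> z) * \<mu> < n"
  using assms
proof (induction rule: cut_induct[where \<mu> = \<mu>])
  case (heavy z)
  then have "(card (run x \<mu> (parent x z)) + 1) * \<mu> < n" by (auto simp: is_end_def)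
  moreover have "card (run x \<mu> z) \<le> card (run x \<mu> (parent x z)) + 1"
    using heavy assms by (simp add: cut_heavy card_insert_if parent(2))
  ultimately show ?case by (meson le_less_trans mult_le_mono1)
qed (use assms n_pos in \<open>auto simp: cut_light cut_end\<close>)

text \<open>A completed segment uses up a number of edges whose product with \<open>\<mu>\<close> is
  at least \<open>n\<close>. The term for the open run carries the edges that are not yet charged to
  a segment through the induction.\<close>

lemma ends_bound:
  assumes "x < n" "z < n"
  shows "card (ends x \<mu> z) * n + card (run x \<mu> z) * \<mu> \<le> (hops x z - 1) * \<mu>"
  using assms
proof (induction rule: cut_induct[where \<mu> = \<mu>])
  case (light z)
  have "(hops x (parent x z) - 1) * \<mu> \<le> (hops x z - 1) * \<mu>"
    using parent(4)[of x z] light assms by (intro mult_le_mono1) simp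
  then have "card (ends x \<mu> (parent x z)) * n + card (run x \<mu> (parent x z)) * \<mu> \<le> (hops x z - 1) * \<mu>"
    using light by (meson order_trans)
  then show ?case using light assms by (simp add: cut_light)
next
  case (heavy z)
  let ?p = "parent x z"
  have p: "?p < n" "hops x z - 1 = (hops x ?p - 1) + 1"
    using parent[of x z] hops_ge_1[of x ?p] heavy assms by auto
  have "card (run x \<mu> z) = card (run x \<mu> ?p) + 1"
    using heavy assms p cut_notin_parent[of x z \<mu>] by (simp add: cut_heavy)
  then show ?case using heavy assms p by (simp add: cut_heavy algebra_simps)
next
  case (fin z)
  let ?p = "parent x z"
  have p: "?p < n" "hops x z - 1 = (hops x ?p - 1) + 1"
    using parent[of x z] hops_ge_1[of x ?p] fin assms by auto
  have "card (ends x \<mu> z) = card (ends x \<mu> ?p) + 1"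
    using fin assms p cut_notin_parent[of x z \<mu>] by (simp add: cut_end)
  moreover have "n \<le> (card (run x \<mu> ?p) + 1) * \<mu>" using fin by (simp add: is_end_def)
  ultimately show ?case using fin assms p by (simp add: cut_end algebra_simps)
qed simp

text \<open>Going down a light edge halves the number of descendants.\<close>

lemma raw_bound:
  assumes "x < n" "z < n"
  shows "\<exists>l. 2 ^ l \<le> n \<and> card (raw x \<mu> z \<union> run x \<mu> z) * \<mu> \<le> l * (n + \<mu>) + n"
proof -
  \<comment> \<open>Here \<open>l\<close> counts the light edges on the way to \<open>z\<close>.
    Each moves itself and an open run of fewer than n / \<open>\<mu>\<close> edges into
    \<open>raw\<close>. Everything is multiplied by \<open>\<mu>\<close>, which avoids a division
    and covers \<open>\<mu> = 0\<close>.\<close>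
  have "\<exists>l. 2 ^ l * card (desc x z) \<le> n \<and> card (raw x \<mu> z) * \<mu> \<le> l * (n + \<mu>)"
    using assms
  proof (induction rule: cut_induct[where \<mu> = \<mu>])
    case root
    then show ?case using card_desc_le[of x x] by (intro exI[of _ 0]) simp
  next
    case (light z)
    let ?p = "parent x z"
    from light obtain l where l: "2 ^ l * card (desc x ?p) \<le> n" "card (raw x \<mu> ?p) * \<mu> \<le> l * (n + \<mu>)"
      by blast
    have p: "?p < n" using parent[of x z] light assms by auto
    have "2 * card (desc x z) \<le> card (desc x ?p)" using light by (simp add: heavy_def)
    then have "2 ^ l * (2 * card (desc x z)) \<le> 2 ^ l * card (desc x ?p)" by (rule mult_le_mono2)
    then have 1: "2 ^ Suc l * card (desc x z) \<le> n"
      using l(1) by (simp only: power_Suc mult_ac)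
    have "card (raw x \<mu> z) \<le> card (raw x \<mu> ?p \<union> run x \<mu> ?p) + 1"
      using light assms p by (simp add: cut_light card_insert_if)
    also have "\<dots> \<le> card (raw x \<mu> ?p) + card (run x \<mu> ?p) + 1" using card_Un_le by simp
    finally have "card (raw x \<mu> z) * \<mu> \<le> (card (raw x \<mu> ?p) + card (run x \<mu> ?p) + 1) * \<mu>"
      by (rule mult_le_mono1)
    also have "\<dots> \<le> Suc l * (n + \<mu>)"
      using l(2) run_bound[OF assms(1) p, of \<mu>] by (simp add: algebra_simps)
    finally show ?case using 1 by blast
  next
    case (heavy z)
    let ?p = "parent x z"
    have "card (desc x z) \<le> card (desc x ?p)" using desc_parent heavy assms by (intro card_mono) auto
    moreover obtain l where "2 ^ l * card (desc x ?p) \<le> n" "card (raw x \<mu> ?p) * \<mu> \<le> l * (n + \<mu>)"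
      using heavy by blast
    ultimately have "2 ^ l * card (desc x z) \<le> n" "card (raw x \<mu> z) * \<mu> \<le> l * (n + \<mu>)"
      using mult_le_mono2 order_trans heavy assms by (blast, simp add: cut_heavy)
    then show ?case by blast
  next
    case (fin z)
    let ?p = "parent x z"
    have "card (desc x z) \<le> card (desc x ?p)" using desc_parent fin assms by (intro card_mono) auto
    moreover obtain l where "2 ^ l * card (desc x ?p) \<le> n" "card (raw x \<mu> ?p) * \<mu> \<le> l * (n + \<mu>)"
      using fin by blast
    ultimately have "2 ^ l * card (desc x z) \<le> n" "card (raw x \<mu> z) * \<mu> \<le> l * (n + \<mu>)"
      using mult_le_mono2 order_trans fin assms by (blast, simp add: cut_end)
    then show ?case by blast
  qed
  then obtain l where l: "2 ^ l * card (desc x z) \<le> n" "card (raw x \<mu> z) * \<mu> \<le> l * (n + \<mu>)" by blast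
  have "z \<in> desc x z" using sp_in_last assms by (simp add: desc_def)
  then have "card (desc x z) \<ge> 1" by (metis card_0_eq empty_iff finite_desc less_one not_less)
  then have "2 ^ l \<le> n" using l(1) by (metis le_trans mult.right_neutral mult_le_mono2)
  moreover have "card (raw x \<mu> z \<union> run x \<mu> z) * \<mu> \<le> (card (raw x \<mu> z) + card (run x \<mu> z)) * \<mu>"
    by (intro mult_le_mono1 card_Un_le)
  then have "card (raw x \<mu> z \<union> run x \<mu> z) * \<mu> \<le> l * (n + \<mu>) + n"
    using l(2) run_bound[OF assms, of \<mu>] by (simp add: algebra_simps)
  ultimately show ?thesis by blast
qed

text \<open>The reason for the disjointness of segments. For fixed \<open>y\<close>, the vertices
  that hold \<open>y\<close> in their open run or in a segment completed there form a descending
  chain along one heavy path, and all but the lowest still have \<open>y\<close> in the open run.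
  Completion empties the run, so at most one segment contains \<open>y\<close>.\<close>

lemma run_level:
  assumes "x < n" "z < n" "z' < n"
    and "y \<in> run x \<mu> z \<or> is_end x \<mu> z \<and> y \<in> segment x \<mu> z"
    and "y \<in> run x \<mu> z' \<or> is_end x \<mu> z' \<and> y \<in> segment x \<mu> z'"
    and "hops x z \<le> hops x z'"
  shows "z = z' \<or> y \<in> run x \<mu> z \<and> hops x z < hops x z'"
  using assms(1,3) assms(2,4,5,6)
proof (induction z' arbitrary: z rule: sp_tree_induct)
  case (root z)
  then show ?case by (simp add: is_end_def)
next
  case (child z')
  \<comment> \<open>One step up the tree: either \<open>y\<close> enters at \<open>v\<close> itself,
    or \<open>v\<close> is heavy and inherits \<open>y\<close> from the run of its parent.\<close>
  have dec: "v \<noteq> x \<and> y \<in> set (sp x v) \<and> (y = v \<or> heavy x v \<and> y \<in> run x \<mu> (parent x v))"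
    if "v < n" "y \<in> run x \<mu> v \<or> is_end x \<mu> v \<and> y \<in> segment x \<mu> v" for v
  proof -
    have ne: "x \<noteq> v" using that by (auto simp: is_end_def)
    note p = parent[OF assms(1) that(1) ne]
    have "y = v \<or> heavy x v \<and> y \<in> run x \<mu> (parent x v)"
    proof (cases "is_end x \<mu> v")
      case True
      then show ?thesis using that assms(1) by (auto simp: cut_end segment_def is_end_def)
    next
      case False
      then have "y \<in> run x \<mu> v" using that(2) by blast
      then show ?thesis
        using that(1) ne assms(1) False by (cases "heavy x v") (auto simp: cut_light cut_heavy)
    qed
    moreover from this have "y \<in> set (sp x v)"
      using cut_subset[OF assms(1) p(2), of \<mu>] p(1) by auto
    ultimately show ?thesis using ne by blast
  qed
  note dz = dec[OF child.prems(1,2)] and dz' = dec[OF child.hyps(1) child.prems(3)]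
  let ?p = "parent x z'"
  have ne: "x \<noteq> z'" using dz' by blast
  note p = parent[OF assms(1) child.hyps(1) ne]
  have hy: "hops x y \<le> hops x z"
    using hops_le_of_mem(1)[OF assms(1) child.prems(1)] dz by blast
  show ?case
  proof (cases "y = z'")
    case True
    then show ?thesis
      using hops_le_of_mem(2)[OF assms(1) child.prems(1)] dz hy child.prems(4) by fastforce
  next
    case False
    then have h: "heavy x z'" "y \<in> run x \<mu> ?p" using dz' by auto
    have yp: "y \<in> set (sp x ?p)" using cut_subset[OF assms(1) p(2)] h(2) by auto
    show ?thesis
    proof (cases "hops x z \<le> hops x ?p")
      case True
      then show ?thesis using child.IH[OF child.prems(1,2) disjI1[OF h(2)]] h(2) p(4) by auto
    next
      case False
      then have eq: "hops x z = hops x z'" using child.prems(4) p(4) by simp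
      have "y \<noteq> z" using hops_le_of_mem(1)[OF assms(1) p(2) yp] eq p(4) by auto
      then have hz: "heavy x z" "y \<in> run x \<mu> (parent x z)" and nez: "x \<noteq> z" using dz by auto
      note pz = parent[OF assms(1) child.prems(1) nez]
      \<comment> \<open>On equal levels both vertices inherit \<open>y\<close>. By induction their
        parents coincide, and a vertex has at most one heavy child.\<close>
      have "parent x z = ?p"
        using child.IH[OF pz(2) disjI1[OF hz(2)] disjI1[OF h(2)]] pz(4) p(4) eq by auto
      then show ?thesis
        using heavy_unique[OF assms(1) child.prems(1) nez hz(1) child.hyps(1) ne h(1)] by blast
    qed
  qed
qed

lemma segments_disjoint:
  assumes "x < n" "z < n" "z' < n" "is_end x \<mu> z" "is_end x \<mu> z'" "z \<noteq> z'"
  shows "segment x \<mu> z \<inter> segment x \<mu> z' = {}"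
proof (rule ccontr)
  assume "segment x \<mu> z \<inter> segment x \<mu> z' \<noteq> {}"
  then obtain y where "y \<in> segment x \<mu> z" "y \<in> segment x \<mu> z'" by blast
  then show False
    using run_level[of x z z' y \<mu>] run_level[of x z' z y \<mu>] assms
    by (cases "hops x z \<le> hops x z'") (auto simp: cut_end)
qed

lemma segment_subset:
  assumes "x < n" "z < n" "is_end x \<mu> z"
  shows "segment x \<mu> z \<subseteq> {..<n} - {x}"
proof -
  have ne: "x \<noteq> z" using assms(3) by (simp add: is_end_def)
  note p = parent[OF assms(1,2) ne]
  show ?thesis
    using cut_subset[OF assms(1) p(2), of \<mu>] sp_subset[OF assms(1) p(2)] assms ne
    by (auto simp: segment_def)
qed

lemma ends_is_end:
  assumes "x < n" "z < n" "c \<in> ends x \<mu> z"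
  shows "is_end x \<mu> c" "c < n"
proof -
  have "\<forall>c\<in>ends x \<mu> z. is_end x \<mu> c \<and> c < n"
    using assms(1,2)
  proof (induction rule: cut_induct[where \<mu> = \<mu>])
    case (light z)
    then show ?case using cut_light(3)[of x z \<mu>] assms(1) by metis
  next
    case (heavy z)
    then show ?case using cut_heavy(3)[of x z \<mu>] assms(1) by metis
  next
    case (fin z)
    then show ?case using cut_end(3)[of x z \<mu>] assms(1) by (metis insertE)
  qed simp
  then show "is_end x \<mu> c" "c < n" using assms(3) by auto
qed

lemma ends_mult_0: "x < n \<Longrightarrow> z < n \<Longrightarrow> ends x 0 z = {}"
  using ends_is_end(1)[of x z _ 0] n_pos by (auto simp: is_end_def)

section \<open>Exact decomposition of a query from the root\<close>

definition edge_sum :: "attributes \<Rightarrow> nat \<Rightarrow> nat set \<Rightarrow> real" where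
  "edge_sum w x B = (\<Sum>y\<in>B. w {parent x y, y})"

text \<open>When a segment is completed, its edges pass from the first sum to the second, so no edge
  is lost or counted twice. Hence the error of an estimate consists of noise only.\<close>

lemma counting_query_cut:
  assumes "x < n" "z < n"
  shows "counting_query G w x z =
    edge_sum w x (raw x \<mu> z \<union> run x \<mu> z) + (\<Sum>c\<in>ends x \<mu> z. edge_sum w x (segment x \<mu> c))"
  using assms
proof (induction rule: cut_induct[where \<mu> = \<mu>])
  case root
  then show ?case using assms by (simp add: counting_query_self edge_sum_def)
next
  case (light z)
  then show ?case
    using assms parent(2)[of x z] cut_notin_parent[of x z \<mu>]
    by (simp add: counting_query_parent cut_light edge_sum_def)
next
  case (heavy z)
  then show ?case
    using assms parent(2)[of x z] cut_notin_parent[of x z \<mu>]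
    by (simp add: counting_query_parent cut_heavy edge_sum_def)
next
  case (fin z)
  let ?p = "parent x z"
  have p: "?p < n" using assms parent(2)[of x z] fin by simp
  have "edge_sum w x (raw x \<mu> ?p \<union> run x \<mu> ?p) = edge_sum w x (raw x \<mu> ?p) + edge_sum w x (run x \<mu> ?p)"
    unfolding edge_sum_def using assms p by (intro sum.union_disjoint raw_run_disjoint) auto
  moreover have "edge_sum w x (segment x \<mu> z) = w {?p, z} + edge_sum w x (run x \<mu> ?p)"
    using assms p fin cut_notin_parent[of x z \<mu>] by (simp add: segment_def edge_sum_def)
  ultimately show ?case
    using assms p fin cut_notin_parent[of x z \<mu>] by (simp add: counting_query_parent cut_end)
qed

end

section \<open>The mechanism\<close>

subsection \<open>Parameters\<close>

definition lg :: "nat \<Rightarrow> nat" where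
  "lg n = (LEAST k. n \<le> 2 ^ k)"

text \<open>Roughly the cube root of n log n. The condition \<open>1 \<le> k\<close> keeps it
  positive for n = 1, where \<open>lg n = 0\<close>. As a least number it can be found by counting
  up, without roots or rounding.\<close>

definition rate :: "nat \<Rightarrow> nat" where
  "rate n = (LEAST k. 1 \<le> k \<and> n * lg n \<le> k ^ 3)"

lemma le_two_power_lg: "n \<le> 2 ^ lg n"
  unfolding lg_def by (rule LeastI[of _ n]) (simp add: less_imp_le)

lemma two_power_less_iff_lg: "2 ^ k < n \<longleftrightarrow> k < lg n"
proof
  show "2 ^ k < n" if "k < lg n" using that not_less_Least unfolding lg_def by (metis not_less)
  show "k < lg n" if "2 ^ k < n"
  proof (rule ccontr)
    assume "\<not> k < lg n"
    then have "(2::nat) ^ lg n \<le> 2 ^ k" by (intro power_increasing) auto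
    then show False using that le_two_power_lg[of n] by linarith
  qed
qed

lemma lg_le: "lg n \<le> n"
  unfolding lg_def by (rule Least_le) (simp add: less_imp_le)

lemma lg_ge_1: "n \<ge> 2 \<Longrightarrow> lg n \<ge> 1"
  using two_power_less_iff_lg[of 0 n] by simp

lemma lg_ge_ln: "n \<ge> 1 \<Longrightarrow> ln (real n) \<le> real (lg n)"
proof -
  assume n: "n \<ge> 1"
  have "real n \<le> real (2 ^ lg n)" using le_two_power_lg of_nat_le_iff by blast
  then have "ln (real n) \<le> ln (real (2 ^ lg n))" using n by (subst ln_le_cancel_iff) auto
  also have "\<dots> = real (lg n) * ln 2" by (simp add: ln_realpow)
  also have "\<dots> \<le> real (lg n) * 1" using ln_2_less_1 by (intro mult_left_mono) auto
  finally show ?thesis by simp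
qed

lemma rate_exists: "n \<ge> 1 \<Longrightarrow> 1 \<le> n \<and> n * lg n \<le> n ^ 3"
  using lg_le[of n] mult_le_mono[of n n "lg n" "n * n"] mult_le_mono[of "lg n" n 1 n]
  by (simp add: power3_eq_cube mult.assoc)

lemma rate_ge_1: "n \<ge> 1 \<Longrightarrow> rate n \<ge> 1"
  and rate_cube: "n \<ge> 1 \<Longrightarrow> n * lg n \<le> rate n ^ 3"
  using LeastI[of "\<lambda>k. 1 \<le> k \<and> n * lg n \<le> k ^ 3", OF rate_exists] unfolding rate_def by auto

lemma rate_le: "n \<ge> 1 \<Longrightarrow> rate n \<le> n"
  unfolding rate_def by (rule Least_le, rule rate_exists)

lemma less_rate_iff: "n \<ge> 1 \<Longrightarrow> 1 \<le> k \<Longrightarrow> k ^ 3 < n * lg n \<longleftrightarrow> k < rate n"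
proof
  assume *: "n \<ge> 1" "1 \<le> k"
  show "k ^ 3 < n * lg n" if "k < rate n"
    using that * not_less_Least[of k "\<lambda>k. 1 \<le> k \<and> n * lg n \<le> k ^ 3"] unfolding rate_def by auto
  show "k < rate n" if "k ^ 3 < n * lg n"
  proof (rule ccontr)
    assume "\<not> k < rate n"
    then have "rate n ^ 3 \<le> k ^ 3" by (intro power_mono) auto
    then show False using that rate_cube[OF *(1)] by linarith
  qed
qed

subsection \<open>Greedy choice of the roots\<close>

primrec argmin :: "(nat \<Rightarrow> real) \<Rightarrow> nat \<Rightarrow> nat" where
  "argmin f 0 = 0"
| "argmin f (Suc k) = (if f k < f (argmin f k) then k else argmin f k)"

lemma argmin_less: "k \<ge> 1 \<Longrightarrow> argmin f k < k"
proof (induction k)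
  case (Suc k)
  then show ?case by (cases "k = 0") auto
qed simp

lemma argmin_le: "i < k \<Longrightarrow> f (argmin f k) \<le> f i"
  by (induction k) (auto simp: less_Suc_eq intro: order_trans)

context pgraph
begin

abbreviation q :: nat where "q \<equiv> rate n"

text \<open>The weight of a pair is halved when \<open>y\<close> hits its path; the quotient divides
  by 1 - h / (2 n), the mean of this effect over all \<open>y\<close>, where h is the number of
  vertices on the path.\<close>

definition factor :: "nat \<Rightarrow> nat \<Rightarrow> nat \<Rightarrow> real" where
  "factor y u v = (if y \<in> set (sp u v) then 1 / 2 else 1) * (2 * real n / (2 * real n - real (hops u v)))"

definition score :: "(nat \<times> nat \<Rightarrow> real) \<Rightarrow> nat \<Rightarrow> real" where
  "score W y = (\<Sum>u<n. \<Sum>v<n. factor y u v * W (u, v))"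

primrec weight :: "nat \<Rightarrow> nat \<times> nat \<Rightarrow> real" where
  "weight 0 = (\<lambda>_. 1)"
| "weight (Suc t) = (\<lambda>(u, v). factor (argmin (score (weight t)) n) u v * weight t (u, v))"

definition root :: "nat \<Rightarrow> nat" where
  "root t = argmin (score (weight t)) n"

lemma root_less: "root t < n"
  unfolding root_def by (rule argmin_less[OF n_pos])

text \<open>The factors average to 1 over all vertices, so the greedy choice does not increase the
  total weight (the method of conditional expectations).\<close>

lemma sum_factor:
  assumes "u < n" "v < n"
  shows "(\<Sum>y<n. factor y u v) = real n"
proof -
  let ?c = "2 * real n / (2 * real n - real (hops u v))"
  have ne: "2 * real n - real (hops u v) > 0" using hops_le_n[OF assms] n_pos by simp
  have "(\<Sum>y<n. if y \<in> set (sp u v) then 1 / 2 else 1 :: real) =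
      (\<Sum>y<n. 1 - (if y \<in> set (sp u v) then 1 / 2 else 0))"
    by (intro sum.cong) auto
  also have "\<dots> = real n - (\<Sum>y<n. if y \<in> set (sp u v) then 1 / 2 else 0)"
    by (simp add: sum_subtractf)
  also have "(\<Sum>y<n. if y \<in> set (sp u v) then 1 / 2 else 0 :: real) = (\<Sum>y\<in>set (sp u v). 1 / 2)"
    using sp_subset[OF assms] by (simp add: sum.If_cases Int_absorb1 Int_def[symmetric])
  also have "\<dots> = real (hops u v) / 2"
    using sp_distinct[OF assms] by (simp add: hops_def distinct_card)
  finally have "(\<Sum>y<n. factor y u v) = (real n - real (hops u v) / 2) * ?c"
    unfolding factor_def sum_distrib_right[symmetric] by simp
  also have "\<dots> = real n" using ne by (simp add: field_simps)
  finally show ?thesis .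
qed

lemma weight_total: "(\<Sum>u<n. \<Sum>v<n. weight t (u, v)) \<le> real n * real n"
proof (induction t)
  case (Suc t)
  let ?W = "\<Sum>u<n. \<Sum>v<n. weight t (u, v)"
  have "(\<Sum>y<n. score (weight t) y) = (\<Sum>u<n. \<Sum>v<n. (\<Sum>y<n. factor y u v) * weight t (u, v))"
    unfolding score_def sum_distrib_right
    by (subst sum.swap, rule sum.cong[OF refl], rule sum.swap)
  also have "\<dots> = real n * ?W"
    unfolding sum_distrib_left by (intro sum.cong) (auto simp: sum_factor)
  finally have "(\<Sum>y<n. score (weight t) y) = real n * ?W" .
  moreover have "(\<Sum>y<n. score (weight t) (root t)) \<le> (\<Sum>y<n. score (weight t) y)"
    unfolding root_def by (intro sum_mono argmin_le) simp
  ultimately have "score (weight t) (root t) \<le> ?W" using n_pos by simp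
  also have "score (weight t) (root t) = (\<Sum>u<n. \<Sum>v<n. weight (Suc t) (u, v))"
    by (simp add: score_def root_def)
  finally show ?case using Suc by linarith
qed simp

lemma factor_pos: "u < n \<Longrightarrow> v < n \<Longrightarrow> factor y u v > 0"
  using hops_le_n[of u v] n_pos by (auto simp: factor_def)

lemma weight_pos: "u < n \<Longrightarrow> v < n \<Longrightarrow> weight t (u, v) > 0"
  by (induction t) (auto simp: factor_pos)

lemma weight_le: assumes "u < n" "v < n" shows "weight t (u, v) \<le> real n * real n"
proof -
  have "weight t (u, v) \<le> (\<Sum>v<n. weight t (u, v))"
    using assms weight_pos by (intro member_le_sum) (auto intro: less_imp_le)
  also have "\<dots> \<le> (\<Sum>u<n. \<Sum>v<n. weight t (u, v))"
    using assms by (intro member_le_sum[of u "{..<n}" "\<lambda>u. \<Sum>v<n. weight t (u, v)"] sum_nonneg)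
      (auto intro: less_imp_le weight_pos)
  finally show ?thesis using weight_total[of t] by linarith
qed

definition hits :: "nat \<Rightarrow> nat \<Rightarrow> nat \<Rightarrow> nat set" where
  "hits k u v = {t. t < k \<and> root t \<in> set (sp u v)}"

lemma hits_Suc: "hits (Suc k) u v = (if root k \<in> set (sp u v) then insert k (hits k u v) else hits k u v)"
  by (auto simp: hits_def less_Suc_eq)

lemma finite_hits [simp]: "finite (hits k u v)"
  by (simp add: hits_def)

lemma card_hits_Suc: "card (hits (Suc k) u v) = card (hits k u v) + (if root k \<in> set (sp u v) then 1 else 0)"
  unfolding hits_Suc by (simp add: card_insert_if) (simp add: hits_def)

lemma weight_eq:
  "weight t (u, v) = (1 / 2) ^ card (hits t u v) * (2 * real n / (2 * real n - real (hops u v))) ^ t"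
proof (induction t)
  case (Suc t)
  then show ?case by (simp add: card_hits_Suc factor_def flip: root_def)
qed (simp add: hits_def)

text \<open>No weight ever exceeds the initial total n^2. After 8 q rounds, the weight of a pair
  with h vertices and k hits is at least exp(-k) exp(8 q h / (2 n)), since exp(-1) <= 1/2; hence k
  >= 4 q h / n - 2 ln n. For h >= q^2, the choice of q yields ln n <= q h / n, and half of the main
  term survives. This is why there are 8 q rounds.\<close>

lemma card_hits_ge:
  assumes uv: "u < n" "v < n" and long: "q * q \<le> hops u v" and n2: "n \<ge> 2"
  shows "2 * real q * real (hops u v) / real n \<le> real (card (hits (8 * q) u v))"
proof -
  let ?k = "card (hits (8 * q) u v)" and ?h = "real (hops u v)"
  have n: "real n > 0" using n_pos by simp
  have h: "?h \<le> real n" using hops_le_n[OF uv] by simp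
  have r: "exp (?h / (2 * real n)) \<le> 2 * real n / (2 * real n - ?h)"
  proof -
    have "1 - ?h / (2 * real n) \<le> exp (- (?h / (2 * real n)))"
      using exp_ge_add_one_self[of "- (?h / (2 * real n))"] by simp
    moreover have "1 - ?h / (2 * real n) > 0" using h n by (simp add: field_simps)
    ultimately have "exp (?h / (2 * real n)) \<le> 1 / (1 - ?h / (2 * real n))"
      by (simp add: exp_minus field_simps)
    also have "\<dots> = 2 * real n / (2 * real n - ?h)" using n h by (simp add: field_simps)
    finally show ?thesis .
  qed
  have "exp (- (real ?k)) * exp (?h / (2 * real n)) ^ (8 * q) \<le>
      (1 / 2) ^ ?k * (2 * real n / (2 * real n - ?h)) ^ (8 * q)"
  proof (intro mult_mono power_mono r)
    have "exp (- 1) \<le> (1 / 2 :: real)"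
      using exp_ge_add_one_self[of 1] by (simp add: exp_minus field_simps)
    then have "exp (- 1) ^ ?k \<le> (1 / 2 :: real) ^ ?k" by (rule power_mono) simp
    then show "exp (- (real ?k)) \<le> (1 / 2 :: real) ^ ?k" by (simp flip: exp_of_nat_mult)
  qed auto
  also have "\<dots> \<le> real n * real n" using weight_le[OF uv, of "8 * q"] by (simp add: weight_eq)
  also have "\<dots> = exp (2 * ln (real n))" by (simp only: mult_2 exp_add exp_ln[OF n])
  finally have "exp (- (real ?k) + real (8 * q) * (?h / (2 * real n))) \<le> exp (2 * ln (real n))"
    by (simp only: exp_add exp_of_nat_mult)
  then have 1: "- real ?k + 8 * real q * (?h / (2 * real n)) \<le> 2 * ln (real n)"
    by (simp only: exp_le_cancel_iff of_nat_mult of_nat_numeral)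
  have "real n * ln (real n) \<le> real n * real (lg n)" using lg_ge_ln[OF n_pos] n by simp
  also have "\<dots> \<le> real q ^ 3" using rate_cube[OF n_pos] by (metis of_nat_le_iff of_nat_mult of_nat_power)
  also have "\<dots> = real q * real (q * q)" by (simp add: power3_eq_cube)
  also have "\<dots> \<le> real q * ?h" using long by (intro mult_left_mono of_nat_mono) auto
  finally have "ln (real n) \<le> real q * ?h / real n" using n by (simp add: field_simps)
  moreover have "8 * real q * (?h / (2 * real n)) = 4 * (real q * ?h / real n)" using n by (simp add: field_simps)
  ultimately show ?thesis using 1 by simp
qed

subsection \<open>Noisy queries and estimates\<close>

text \<open>The noisy value with index \<open>u * n + v\<close> is that of the edge from \<open>u\<close> to \<open>v\<close>, and the one with
  index \<open>n * n + t * n + z\<close> is that of the segment with lower end \<open>z\<close> in the \<open>t\<close>-th tree.\<close>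

definition edge_weight :: "attributes \<Rightarrow> nat \<Rightarrow> nat \<Rightarrow> real" where
  "edge_weight w u v = (if {u, v} \<in> edges G then w {u, v} else 0)"

definition segment_query :: "attributes \<Rightarrow> nat \<Rightarrow> nat \<Rightarrow> real" where
  "segment_query w t z =
    (if is_end (root t) q z then edge_sum w (root t) (segment (root t) q z) else 0)"

definition query :: "attributes \<Rightarrow> nat \<Rightarrow> real" where
  "query w j =
    (if j < n * n then edge_weight w (j div n) (j mod n)
     else segment_query w ((j - n * n) div n) ((j - n * n) mod n))"

text \<open>Each half of the privacy budget is spent on one kind of query. An edge occurs as two
  ordered pairs, so the edge queries have sensitivity 2, and 2 / (4 / \<open>\<epsilon>\<close>) =
  \<open>\<epsilon>\<close> / 2. The segments have sensitivity 1 in each of 8 q trees, and 8 q / (16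
  q / \<open>\<epsilon>\<close>) = \<open>\<epsilon>\<close> / 2.\<close>

definition scale :: "real \<Rightarrow> nat \<Rightarrow> real" where
  "scale \<epsilon> j = (if j < n * n then 4 / \<epsilon> else 16 * real q / \<epsilon>)"

definition noisy :: "real \<Rightarrow> attributes \<Rightarrow> (nat \<Rightarrow> real) \<Rightarrow> nat \<Rightarrow> real" where
  "noisy \<epsilon> w \<omega> j = query w j + scale \<epsilon> j * lapl (\<omega> j)"

text \<open>The estimate without the edges of the open run. It is kept separately because completing
  a segment replaces all noisy edges of the run by a single noisy value.\<close>

definition base :: "(nat \<Rightarrow> real) \<Rightarrow> nat \<Rightarrow> nat \<Rightarrow> nat \<Rightarrow> nat \<Rightarrow> real" where
  "base Y x \<mu> i z = (\<Sum>y\<in>raw x \<mu> z. Y (parent x y * n + y)) + (\<Sum>c\<in>ends x \<mu> z. Y (i + c))"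

definition est :: "(nat \<Rightarrow> real) \<Rightarrow> nat \<Rightarrow> nat \<Rightarrow> nat \<Rightarrow> nat \<Rightarrow> real" where
  "est Y x \<mu> i z = base Y x \<mu> i z + (\<Sum>y\<in>run x \<mu> z. Y (parent x y * n + y))"

definition tree_est :: "(nat \<Rightarrow> real) \<Rightarrow> nat \<Rightarrow> nat \<Rightarrow> real" where
  "tree_est Y t z = est Y (root t) q (n * n + t * n) z"

text \<open>With multiplier 0 there are no segments, so a short path gets the sum of its noisy
  edges. A long path is split at each root on it, and the tree estimates for its two ends are
  added.\<close>

definition estimate :: "(nat \<Rightarrow> real) \<Rightarrow> nat \<Rightarrow> nat \<Rightarrow> real" where
  "estimate Y u v =
    (if hops u v < q * q then est Y u 0 0 v
     else (\<Sum>t\<in>hits (8 * q) u v. tree_est Y t u + tree_est Y t v) / real (card (hits (8 * q) u v)))"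

definition release :: "(nat \<Rightarrow> real) \<Rightarrow> estimates" where
  "release Y = restrict (\<lambda>(u, v). estimate Y u v) (verts G \<times> verts G)"

definition indices :: "nat set" where
  "indices = {..<n * n + 8 * q * n}"

lemma index_less: "i < m \<Longrightarrow> l < k \<Longrightarrow> i * k + l < m * k" for i k l m :: nat
  using mult_le_mono1[of "Suc i" m k] by simp

lemma edge_index: "u < n \<Longrightarrow> v < n \<Longrightarrow> u * n + v < n * n"
  by (rule index_less)

lemma segment_index: "t < 8 * q \<Longrightarrow> z < n \<Longrightarrow> n * n + t * n + z < n * n + 8 * q * n"
  using index_less[of t "8 * q" z n] by simp

lemma noisy_edge: "u < n \<Longrightarrow> v < n \<Longrightarrow>
    noisy \<epsilon> w \<omega> (u * n + v) = edge_weight w u v + 4 / \<epsilon> * lapl (\<omega> (u * n + v))"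
  using edge_index[of u v] by (simp add: noisy_def query_def scale_def)

lemma noisy_segment: "z < n \<Longrightarrow> noisy \<epsilon> w \<omega> (n * n + t * n + z) =
    segment_query w t z + 16 * real q / \<epsilon> * lapl (\<omega> (n * n + t * n + z))"
  by (simp add: noisy_def query_def scale_def)

lemma est_cong:
  assumes "x < n" "z < n"
    and "\<And>u v. u < n \<Longrightarrow> v < n \<Longrightarrow> Y (u * n + v) = Y' (u * n + v)"
    and "\<And>c. c \<in> ends x \<mu> z \<Longrightarrow> Y (i + c) = Y' (i + c)"
  shows "est Y x \<mu> i z = est Y' x \<mu> i z"
proof -
  have "y < n \<and> y \<noteq> x" if "y \<in> raw x \<mu> z \<union> run x \<mu> z" for y
    using cut_subset[OF assms(1,2), of \<mu>] sp_subset[OF assms(1,2)] that by auto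
  then show ?thesis
    using parent(2)[OF assms(1)] assms unfolding est_def base_def
    by (intro arg_cong2[where f = plus] sum.cong refl) auto
qed

lemma release_cong:
  assumes "\<And>j. j \<in> indices \<Longrightarrow> Y j = Y' j"
  shows "release Y = release Y'"
proof -
  have e: "Y (u * n + v) = Y' (u * n + v)" if "u < n" "v < n" for u v
    using assms edge_index[OF that] by (simp add: indices_def)
  have "estimate Y u v = estimate Y' u v" if "u < n" "v < n" for u v
  proof -
    have "tree_est Y t z = tree_est Y' t z" if "t \<in> hits (8 * q) u v" "z < n" for t z
      unfolding tree_est_def
      using assms segment_index[of t] that ends_is_end(2)[OF root_less that(2)]
      by (intro est_cong root_less e) (auto simp: indices_def hits_def)
    then show ?thesis
      using that est_cong[of u v Y Y' 0 0, OF _ _ e] ends_mult_0[of u v]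
      by (simp add: estimate_def cong: sum.cong)
  qed
  then show ?thesis by (auto simp: release_def verts_def restrict_def fun_eq_iff)
qed

lemma release_measurable:
  "release \<in> Pi\<^sub>M indices (\<lambda>_. borel) \<rightarrow>\<^sub>M output_space G"
proof -
  have comp: "(\<lambda>Y. Y j) \<in> borel_measurable (Pi\<^sub>M indices (\<lambda>_. borel :: real measure))" if "j \<in> indices" for j
    by (rule measurable_component_singleton[OF that])
  have est: "(\<lambda>Y. est Y x \<mu> i z) \<in> borel_measurable (Pi\<^sub>M indices (\<lambda>_. borel))"
    if "x < n" "z < n" "\<And>c. c \<in> ends x \<mu> z \<Longrightarrow> i + c \<in> indices" for x \<mu> i z
  proof -
    have "parent x y * n + y \<in> indices" if "y \<in> raw x \<mu> z \<union> run x \<mu> z" for y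
    proof -
      have "y < n" "x \<noteq> y"
        using cut_subset[OF \<open>x < n\<close> \<open>z < n\<close>, of \<mu>] sp_subset[OF \<open>x < n\<close> \<open>z < n\<close>] that by auto
      then show ?thesis using edge_index[of "parent x y" y] parent(2)[OF \<open>x < n\<close>, of y]
        by (simp add: indices_def)
    qed
    then show ?thesis unfolding est_def base_def
      by (intro borel_measurable_add borel_measurable_sum comp that(3)) auto
  qed
  have "(\<lambda>Y. estimate Y u v) \<in> borel_measurable (Pi\<^sub>M indices (\<lambda>_. borel))" if "u < n" "v < n" for u v
  proof (cases "hops u v < q * q")
    case True
    then show ?thesis using est[OF that, of 0 0] ends_mult_0[OF that] by (simp add: estimate_def)
  next
    case False
    have "(\<lambda>Y. tree_est Y t z) \<in> borel_measurable (Pi\<^sub>M indices (\<lambda>_. borel))"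
      if "t \<in> hits (8 * q) u v" "z < n" for t z
      unfolding tree_est_def
      using segment_index[of t] that ends_is_end(2)[OF root_less that(2)]
      by (intro est root_less) (auto simp: indices_def hits_def)
    then have "(\<lambda>Y. (\<Sum>t\<in>hits (8 * q) u v. tree_est Y t u + tree_est Y t v) / real (card (hits (8 * q) u v)))
        \<in> borel_measurable (Pi\<^sub>M indices (\<lambda>_. borel))"
      using that by (intro borel_measurable_divide borel_measurable_sum borel_measurable_add) auto
    then show ?thesis using False by (simp add: estimate_def)
  qed
  then show ?thesis
    unfolding release_def output_space_def
    by (intro measurable_restrict) (auto simp: verts_def)
qed

definition mechanism :: "real \<Rightarrow> attributes \<Rightarrow> estimates measure" where
  "mechanism \<epsilon> w = distr random_tape (output_space G) (\<lambda>\<omega>. release (noisy \<epsilon> w \<omega>))"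

lemma release_noisy_restrict:
  "release (noisy \<epsilon> w \<omega>) = release (\<lambda>j\<in>indices. query w j + scale \<epsilon> j * lapl (\<omega> j))"
  by (rule release_cong) (simp add: noisy_def)

lemma noisy_measurable: "(\<lambda>\<omega>. \<lambda>j\<in>indices. query w j + scale \<epsilon> j * lapl (\<omega> j)) \<in>
    random_tape \<rightarrow>\<^sub>M Pi\<^sub>M indices (\<lambda>_. borel)"
  by (intro measurable_restrict) simp

lemma release_noisy_measurable:
  "(\<lambda>\<omega>. release (noisy \<epsilon> w \<omega>)) \<in> random_tape \<rightarrow>\<^sub>M output_space G"
  unfolding release_noisy_restrict by (rule measurable_compose[OF noisy_measurable release_measurable])

text \<open>The post-processing form: \<open>w\<close> affects only the centres of the independent
  Laplace variables, not the function \<open>release\<close>.\<close>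

lemma mechanism_eq:
  "mechanism \<epsilon> w = distr (Pi\<^sub>M indices (\<lambda>j. laplace (query w j) (scale \<epsilon> j))) (output_space G) release"
proof -
  have "mechanism \<epsilon> w = distr (distr random_tape (Pi\<^sub>M indices (\<lambda>_. borel))
      (\<lambda>\<omega>. \<lambda>j\<in>indices. query w j + scale \<epsilon> j * lapl (\<omega> j))) (output_space G) release"
    unfolding mechanism_def release_noisy_restrict
    by (subst distr_distr[OF release_measurable noisy_measurable]) (simp add: comp_def)
  then show ?thesis by (simp add: distr_random_tape indices_def)
qed

subsection \<open>Privacy\<close>

lemma sum_div_mod:
  fixes f :: "nat \<Rightarrow> nat \<Rightarrow> real"
  shows "(\<Sum>j<m * k. f (j div k) (j mod k)) = (\<Sum>i<m. \<Sum>l<k. f i l)"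
proof -
  have "(\<Sum>i<m. \<Sum>l<k. f i l) = (\<Sum>i<m. \<Sum>j\<in>{i * k..<i * k + k}. f (j div k) (j mod k))"
  proof (rule sum.cong[OF refl])
    fix i
    have "(\<Sum>j\<in>{i * k..<i * k + k}. f (j div k) (j mod k)) = (\<Sum>l<k. f ((l + i * k) div k) ((l + i * k) mod k))"
      using sum.shift_bounds_nat_ivl[of "\<lambda>j. f (j div k) (j mod k)" 0 "i * k" k]
      by (simp add: atLeast0LessThan add.commute)
    also have "\<dots> = (\<Sum>l<k. f i l)" by (intro sum.cong) auto
    finally show "(\<Sum>l<k. f i l) = (\<Sum>j\<in>{i * k..<i * k + k}. f (j div k) (j mod k))" by simp
  qed
  also have "\<dots> = (\<Sum>j<m * k. f (j div k) (j mod k))" by (rule sum.nat_group)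
  finally show ?thesis by simp
qed

lemma edge_sensitivity:
  assumes "neighboring G w w'"
  shows "(\<Sum>u<n. \<Sum>v<n. \<bar>edge_weight w u v - edge_weight w' u v\<bar>) \<le> 2"
proof -
  let ?g = "\<lambda>e. \<bar>w e - w' e\<bar>" and ?h = "\<lambda>(u, v). {u, v}"
  let ?P = "{p \<in> {..<n} \<times> {..<n}. ?h p \<in> edges G}"
  have "(\<Sum>u<n. \<Sum>v<n. \<bar>edge_weight w u v - edge_weight w' u v\<bar>) =
      (\<Sum>p\<in>{..<n} \<times> {..<n}. if ?h p \<in> edges G then ?g (?h p) else 0)"
    unfolding sum.cartesian_product by (intro sum.cong) (auto simp: edge_weight_def)
  also have "\<dots> = (\<Sum>p\<in>?P. ?g (?h p))" by (rule sum.inter_filter[symmetric]) simp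
  also have "\<dots> = (\<Sum>e\<in>edges G. \<Sum>p\<in>{p \<in> ?P. ?h p = e}. ?g (?h p))"
    by (rule sum.group[symmetric]) (auto simp: finite_edges)
  also have "\<dots> \<le> (\<Sum>e\<in>edges G. 2 * ?g e)"
  proof (rule sum_mono)
    fix e
    have "card {p \<in> ?P. ?h p = e} \<le> 2"
    proof (cases "\<exists>a b. e = {a, b}")
      case True
      then obtain a b where e: "e = {a, b}" by blast
      have "p \<in> {(a, b), (b, a)}" if "?h p = {a, b}" for p
        using that by (cases p) (simp add: doubleton_eq_iff)
      then have "{p \<in> ?P. ?h p = e} \<subseteq> {(a, b), (b, a)}"
        unfolding e by (intro subsetI) (simp only: mem_Collect_eq)
      then have "card {p \<in> ?P. ?h p = e} \<le> card {(a, b), (b, a)}"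
        by (rule card_mono[rotated]) simp
      also have "\<dots> \<le> 2" using card_length[of "[(a, b), (b, a)]"] by simp
      finally show ?thesis .
    next
      case False
      then have "?h p \<noteq> e" for p by (cases p) (simp, metis)
      then show ?thesis by simp
    qed
    moreover have "(\<Sum>p\<in>{p \<in> ?P. ?h p = e}. ?g (?h p)) = real (card {p \<in> ?P. ?h p = e}) * ?g e"
    proof -
      have "(\<Sum>p\<in>{p \<in> ?P. ?h p = e}. ?g (?h p)) = (\<Sum>p\<in>{p \<in> ?P. ?h p = e}. ?g e)"
        by (intro sum.cong refl) (simp only: mem_Collect_eq)
      then show ?thesis by simp
    qed
    ultimately show "(\<Sum>p\<in>{p \<in> ?P. ?h p = e}. ?g (?h p)) \<le> 2 * ?g e"
      by (simp add: mult_right_mono)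
  qed
  also have "\<dots> \<le> 2" using assms by (simp add: neighboring_def flip: sum_distrib_left)
  finally show ?thesis .
qed

text \<open>Segments of one tree are disjoint, and a tree edge is determined by its lower end, so
  every edge of the graph contributes at most once.\<close>

lemma segment_sensitivity:
  assumes "neighboring G w w'"
  shows "(\<Sum>z<n. \<bar>segment_query w t z - segment_query w' t z\<bar>) \<le> 1"
proof -
  let ?x = "root t" and ?g = "\<lambda>e. \<bar>w e - w' e\<bar>"
  let ?Z = "{z \<in> {..<n}. is_end ?x q z}"
  note x = root_less[of t]
  have "(\<Sum>z<n. \<bar>segment_query w t z - segment_query w' t z\<bar>) =
      (\<Sum>z<n. if is_end ?x q z then \<bar>segment_query w t z - segment_query w' t z\<bar> else 0)"
    by (intro sum.cong) (auto simp: segment_query_def)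
  also have "\<dots> = (\<Sum>z\<in>?Z. \<bar>segment_query w t z - segment_query w' t z\<bar>)"
    by (rule sum.inter_filter[symmetric]) simp
  also have "\<dots> \<le> (\<Sum>z\<in>?Z. \<Sum>y\<in>segment ?x q z. ?g {parent ?x y, y})"
    by (intro sum_mono) (auto simp: segment_query_def edge_sum_def simp flip: sum_subtractf)
  also have "\<dots> = (\<Sum>y\<in>(\<Union>z\<in>?Z. segment ?x q z). ?g {parent ?x y, y})"
    using segments_disjoint[OF x] segment_subset[OF x]
    by (intro sum.UNION_disjoint[symmetric] ballI impI finite_subset[OF segment_subset[OF x]]) auto
  also have "\<dots> \<le> (\<Sum>y\<in>{..<n} - {?x}. ?g {parent ?x y, y})"
    using segment_subset[OF x] by (intro sum_mono2) auto
  also have "\<dots> = (\<Sum>e\<in>(\<lambda>y. {parent ?x y, y}) ` ({..<n} - {?x}). ?g e)"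
  proof (rule sum.reindex[symmetric, unfolded comp_def])
    \<comment> \<open>Levels orient the tree edges: equal edges with different lower ends would make
      each of the two vertices the strictly higher one.\<close>
    have "hops ?x (parent ?x y) < hops ?x y" if "y \<in> {..<n} - {?x}" for y
      using parent(4)[OF x, of y] that by auto
    then show "inj_on (\<lambda>y. {parent ?x y, y}) ({..<n} - {?x})"
      by (intro inj_onI) (metis doubleton_eq_iff less_asym)
  qed
  also have "\<dots> \<le> (\<Sum>e\<in>edges G. ?g e)"
    using parent(3)[OF x] by (intro sum_mono2) (auto simp: finite_edges)
  finally show ?thesis using assms by (simp add: neighboring_def)
qed

lemma query_sensitivity:
  assumes "neighboring G w w'" "\<epsilon> > 0"
  shows "(\<Sum>j\<in>indices. \<bar>query w j - query w' j\<bar> / scale \<epsilon> j) \<le> \<epsilon>"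
proof -
  let ?f = "\<lambda>j. \<bar>query w j - query w' j\<bar> / scale \<epsilon> j"
  have q: "real q > 0" using rate_ge_1[OF n_pos] by simp
  have "sum ?f indices = sum ?f {..<n * n} + sum ?f {n * n..<n * n + 8 * q * n}"
    unfolding indices_def
    by (subst sum.union_disjoint[symmetric]) (auto intro!: sum.cong)
  also have "sum ?f {..<n * n} = (\<Sum>j<n * n. \<bar>edge_weight w (j div n) (j mod n) - edge_weight w' (j div n) (j mod n)\<bar>) * (\<epsilon> / 4)"
    unfolding sum_distrib_right by (intro sum.cong) (auto simp: query_def scale_def)
  also have "\<dots> = (\<Sum>u<n. \<Sum>v<n. \<bar>edge_weight w u v - edge_weight w' u v\<bar>) * (\<epsilon> / 4)"
    by (subst sum_div_mod) simp
  also have "\<dots> \<le> 2 * (\<epsilon> / 4)"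
    using edge_sensitivity[OF assms(1)] assms(2) by (intro mult_right_mono) auto
  also have "sum ?f {n * n..<n * n + 8 * q * n} = (\<Sum>j<8 * q * n. ?f (n * n + j))"
    using sum.shift_bounds_nat_ivl[of ?f 0 "n * n" "8 * q * n"] by (simp add: atLeast0LessThan add.commute)
  also have "\<dots> = (\<Sum>j<8 * q * n. \<bar>segment_query w (j div n) (j mod n) - segment_query w' (j div n) (j mod n)\<bar>) * (\<epsilon> / (16 * q))"
    unfolding sum_distrib_right by (intro sum.cong) (auto simp: query_def scale_def)
  also have "\<dots> = (\<Sum>t<8 * q. \<Sum>z<n. \<bar>segment_query w t z - segment_query w' t z\<bar>) * (\<epsilon> / (16 * q))"
    by (subst sum_div_mod) simp
  also have "\<dots> \<le> (\<Sum>t<8 * q. 1) * (\<epsilon> / (16 * q))"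
    using segment_sensitivity[OF assms(1)] assms(2) by (intro mult_right_mono sum_mono) auto
  finally show ?thesis using q by simp
qed

lemma mechanism_private:
  assumes "neighboring G w w'" "\<epsilon> > 0" "C \<in> sets (output_space G)"
  shows "measure (mechanism \<epsilon> w) C \<le> exp \<epsilon> * measure (mechanism \<epsilon> w') C"
proof -
  let ?M = "\<lambda>w. Pi\<^sub>M indices (\<lambda>j. laplace (query w j) (scale \<epsilon> j))"
  have sets: "sets (?M w) = sets (Pi\<^sub>M indices (\<lambda>_. borel))" for w
    by (intro sets_PiM_cong) simp_all
  have rel: "release \<in> ?M w \<rightarrow>\<^sub>M output_space G" for w
    using release_measurable by (simp add: measurable_cong_sets[OF sets refl])
  have prob: "prob_space (mechanism \<epsilon> w)" for w
    unfolding mechanism_def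
    by (intro prob_space.prob_space_distr prob_space_random_tape release_noisy_measurable)
  have em: "emeasure (mechanism \<epsilon> w) C = (\<integral>\<^sup>+Y. indicator C (release Y) \<partial>?M w)" for w
  proof -
    have "emeasure (mechanism \<epsilon> w) C = (\<integral>\<^sup>+f. indicator C f \<partial>mechanism \<epsilon> w)"
      using assms(3) by (simp add: mechanism_def)
    also have "\<dots> = (\<integral>\<^sup>+Y. indicator C (release Y) \<partial>?M w)"
      unfolding mechanism_eq by (rule nn_integral_distr[OF rel]) (use assms(3) in simp)
    finally show ?thesis .
  qed
  have "emeasure (mechanism \<epsilon> w) C \<le>
      ennreal (exp (\<Sum>j\<in>indices. \<bar>query w j - query w' j\<bar> / scale \<epsilon> j)) * emeasure (mechanism \<epsilon> w') C"
    unfolding em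
  proof (rule nn_integral_PiM_laplace_shift)
    show "finite indices" by (simp add: indices_def)
    show "scale \<epsilon> j > 0" for j using assms(2) rate_ge_1[OF n_pos] by (simp add: scale_def)
    show "(\<lambda>Y. indicator C (release Y)) \<in> borel_measurable (Pi\<^sub>M indices (\<lambda>_. borel))"
      by (rule measurable_compose[OF release_measurable]) (use assms(3) in simp)
  qed
  also have "\<dots> \<le> ennreal (exp \<epsilon>) * emeasure (mechanism \<epsilon> w') C"
    using query_sensitivity[OF assms(1,2)] by (intro mult_right_mono ennreal_leI) auto
  finally have "ennreal (measure (mechanism \<epsilon> w) C) \<le> ennreal (exp \<epsilon> * measure (mechanism \<epsilon> w') C)"
    using prob by (simp add: finite_measure.emeasure_eq_measure prob_space.finite_measure ennreal_mult)
  then show ?thesis by (simp add: measure_nonneg)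
qed

end

section \<open>Accuracy\<close>

lemma lg_le_ln: assumes "n \<ge> 2" shows "real (lg n) \<le> 4 * ln (real n)"
proof -
  have l2: "ln 2 \<ge> (1 / 2 :: real)" using exp_ge_add_one_self[of "- ln 2 :: real"] by (simp add: exp_minus)
  have ln: "ln 2 \<le> ln (real n)" using assms by simp
  have "2 ^ (lg n - 1) < n" using two_power_less_iff_lg[of "lg n - 1" n] lg_ge_1[OF assms] by simp
  then have "real (2 ^ (lg n - 1)) \<le> real n" by (intro of_nat_mono) simp
  then have "ln (real (2 ^ (lg n - 1))) \<le> ln (real n)" by (subst ln_le_cancel_iff) (use assms in auto)
  then have "real (lg n - 1) * ln 2 \<le> ln (real n)" by (simp add: ln_realpow)
  moreover have "real (lg n - 1) * (1 / 2) \<le> real (lg n - 1) * ln 2" using l2 by (intro mult_left_mono) auto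
  moreover have "real (lg n - 1) = real (lg n) - 1" using lg_ge_1[OF assms] by simp
  ultimately show ?thesis using l2 ln by simp
qed

text \<open>Minimality bounds (q - 1)^3 by n lg n, and q <= 2 (q - 1) unless q = 1.\<close>

lemma rate_cube_le: assumes "n \<ge> 2" shows "real (rate n) ^ 3 \<le> 8 * (real n * real (lg n))"
proof (cases "rate n = 1")
  case True
  have "1 * 1 \<le> real n * real (lg n)" using assms lg_ge_1[OF assms] by (intro mult_mono) auto
  then show ?thesis using True by simp
next
  case False
  then have r: "rate n \<ge> 2" using rate_ge_1[of n] assms by simp
  have "(rate n - 1) ^ 3 < n * lg n" using less_rate_iff[of n "rate n - 1"] r assms by simp
  then have "real ((rate n - 1) ^ 3) \<le> real (n * lg n)" by (intro of_nat_mono) simp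
  moreover have "(real (rate n) / 2) ^ 3 \<le> real (rate n - 1) ^ 3" using r by (intro power_mono) auto
  ultimately show ?thesis by (simp add: power_divide)
qed

text \<open>The exponent 5/6 is 1/3 + 1/2: a cube root from q and a square root from the tail bound.
  The constant 8 comes from q <= 2 (n lg n)^(1/3), lg n <= 4 ln n and 4^(5/6) <= 4.\<close>

lemma rate_sqrt_lg_le:
  assumes "n \<ge> 2"
  shows "real (rate n) * sqrt (real (lg n)) \<le> 8 * (real n powr (1/3) * ln (real n) powr (5/6))"
proof -
  let ?N = "real n" and ?l = "real (lg n)"
  have l: "?l \<ge> 1" using lg_ge_1[OF assms] by simp
  have pos: "real (rate n) > 0" using rate_ge_1[of n] assms by simp
  have "real (rate n) = (real (rate n) powr 3) powr (1/3)" using pos by (subst powr_powr) simp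
  also have "\<dots> \<le> (8 * (?N * ?l)) powr (1/3)"
    using rate_cube_le[OF assms] pos by (intro powr_mono2) (auto simp: powr_numeral)
  also have "\<dots> = (8 :: real) powr (1/3) * (?N powr (1/3) * ?l powr (1/3))"
    using l by (simp add: powr_mult)
  also have "(8 :: real) powr (1/3) = (2 powr 3) powr (1/3)" by simp
  also have "\<dots> = 2" by (subst powr_powr) simp
  finally have "real (rate n) * sqrt ?l \<le> 2 * (?N powr (1/3) * ?l powr (1/3)) * ?l powr (1/2)"
    using l by (simp add: powr_half_sqrt mult_right_mono)
  also have "\<dots> = 2 * ?N powr (1/3) * ?l powr (5/6)" using l by (simp add: mult.assoc flip: powr_add)
  also have "\<dots> \<le> 2 * ?N powr (1/3) * (4 * ln ?N) powr (5/6)"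
    using lg_le_ln[OF assms] by (intro mult_left_mono powr_mono2) auto
  also have "(4 * ln ?N) powr (5/6) = 4 powr (5/6) * ln ?N powr (5/6)"
    using assms by (simp add: powr_mult)
  also have "2 * ?N powr (1/3) * (4 powr (5/6) * ln ?N powr (5/6)) \<le>
      2 * ?N powr (1/3) * (4 powr 1 * ln ?N powr (5/6))"
    by (intro mult_left_mono mult_right_mono powr_mono) auto
  finally show ?thesis by simp
qed

context pgraph
begin

section \<open>Which samples enter an estimate\<close>

definition raw_indices :: "nat \<Rightarrow> nat \<Rightarrow> nat \<Rightarrow> nat set" where
  "raw_indices x \<mu> z = (\<lambda>y. parent x y * n + y) ` (raw x \<mu> z \<union> run x \<mu> z)"

text \<open>The samples of all trees whose root hits the path, pooled into one set. Rounds that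
  choose the same root again still have samples of their own.\<close>

definition segment_indices :: "nat \<Rightarrow> nat \<Rightarrow> nat \<Rightarrow> nat set" where
  "segment_indices u v z = (\<lambda>(t, c). n * n + t * n + c) ` (SIGMA t:hits (8 * q) u v. ends (root t) q z)"

lemma cut_members:
  assumes "x < n" "z < n" "y \<in> raw x \<mu> z \<union> run x \<mu> z"
  shows "y < n" "x \<noteq> y"
  using cut_subset[OF assms(1,2), of \<mu>] sp_subset[OF assms(1,2)] assms(3) by auto

lemma sum_raw_indices:
  assumes "x < n" "z < n"
  shows "(\<Sum>j\<in>raw_indices x \<mu> z. f j) = (\<Sum>y\<in>raw x \<mu> z \<union> run x \<mu> z. f (parent x y * n + y))"
  unfolding raw_indices_def
proof (rule sum.reindex[unfolded comp_def], rule inj_onI)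
  fix y y' assume "y \<in> raw x \<mu> z \<union> run x \<mu> z" "y' \<in> raw x \<mu> z \<union> run x \<mu> z"
    and eq: "parent x y * n + y = parent x y' * n + y'"
  then have "y < n" "y' < n" using cut_members[OF assms] by blast+
  then show "y = y'" using arg_cong[OF eq, of "\<lambda>j. j mod n"] by simp
qed

lemma sum_segment_indices:
  assumes "z < n"
  shows "(\<Sum>j\<in>segment_indices u v z. f j) =
    (\<Sum>t\<in>hits (8 * q) u v. \<Sum>c\<in>ends (root t) q z. f (n * n + t * n + c))"
proof -
  have "inj_on (\<lambda>(t, c). n * n + t * n + c) (SIGMA t:hits (8 * q) u v. ends (root t) q z)"
  proof (rule inj_onI, clarify)
    fix t c t' c'
    assume "c \<in> ends (root t) q z" "c' \<in> ends (root t') q z"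
      and eq: "n * n + t * n + c = n * n + t' * n + c'"
    then have c: "c < n" "c' < n" using ends_is_end(2)[OF root_less assms] by blast+
    have "t * n + c = t' * n + c'" using eq by simp
    then have "(t * n + c) mod n = (t' * n + c') mod n" "(t * n + c) div n = (t' * n + c') div n" by simp_all
    then show "t = t' \<and> c = c'" using c by simp
  qed
  then have "(\<Sum>j\<in>segment_indices u v z. f j) =
      (\<Sum>(t, c)\<in>(SIGMA t:hits (8 * q) u v. ends (root t) q z). f (n * n + t * n + c))"
    unfolding segment_indices_def by (subst sum.reindex) (auto simp: split_def)
  then show ?thesis
    by (subst sum.Sigma) (use cut_finite(3)[OF root_less assms] in auto)
qed

lemma est_noisy:
  assumes "x < n" "z < n"
    and "\<And>c. c \<in> ends x \<mu> z \<Longrightarrow> noisy \<epsilon> w \<omega> (i + c) = edge_sum w x (segment x \<mu> c) + b * lapl (\<omega> (i + c))"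
  shows "est (noisy \<epsilon> w \<omega>) x \<mu> i z = counting_query G w x z +
    4 / \<epsilon> * (\<Sum>j\<in>raw_indices x \<mu> z. lapl (\<omega> j)) + b * (\<Sum>c\<in>ends x \<mu> z. lapl (\<omega> (i + c)))"
proof -
  let ?R = "raw x \<mu> z \<union> run x \<mu> z" and ?Y = "noisy \<epsilon> w \<omega>"
  have "est ?Y x \<mu> i z = (\<Sum>y\<in>?R. ?Y (parent x y * n + y)) + (\<Sum>c\<in>ends x \<mu> z. ?Y (i + c))"
    unfolding est_def base_def using raw_run_disjoint[OF assms(1,2)] assms(1,2)
    by (subst sum.union_disjoint) auto
  also have "(\<Sum>y\<in>?R. ?Y (parent x y * n + y)) =
      (\<Sum>y\<in>?R. w {parent x y, y} + 4 / \<epsilon> * lapl (\<omega> (parent x y * n + y)))"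
    using cut_members[OF assms(1,2)] parent[OF assms(1)]
    by (intro sum.cong refl) (simp add: noisy_edge edge_weight_def)
  also have "(\<Sum>c\<in>ends x \<mu> z. ?Y (i + c)) =
      (\<Sum>c\<in>ends x \<mu> z. edge_sum w x (segment x \<mu> c) + b * lapl (\<omega> (i + c)))"
    by (intro sum.cong refl assms(3))
  finally show ?thesis
    using counting_query_cut[OF assms(1,2), of w \<mu>]
    by (simp add: sum.distrib edge_sum_def sum_raw_indices[OF assms(1,2)] sum_distrib_left sum_divide_distrib)
qed

lemma tree_est_noisy:
  assumes "z < n"
  shows "tree_est (noisy \<epsilon> w \<omega>) t z = counting_query G w (root t) z +
    4 / \<epsilon> * (\<Sum>j\<in>raw_indices (root t) q z. lapl (\<omega> j)) +
    16 * real q / \<epsilon> * (\<Sum>c\<in>ends (root t) q z. lapl (\<omega> (n * n + t * n + c)))"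
  unfolding tree_est_def
  by (rule est_noisy[OF root_less assms])
    (use ends_is_end[OF root_less assms] in \<open>simp add: noisy_segment segment_query_def\<close>)

section \<open>Noise sums and their probabilities\<close>

definition noise :: "(nat \<Rightarrow> real) \<Rightarrow> real \<times> nat set \<Rightarrow> real" where
  "noise \<omega> = (\<lambda>(c, J). c * (\<Sum>j\<in>J. lapl (\<omega> j)))"

definition bound :: "real \<Rightarrow> real" where
  "bound \<epsilon> = 144 * real q * sqrt (real (lg n)) / \<epsilon>"

text \<open>The sums that have to be small simultaneously. Left-over edges are listed tree by tree
  because different trees share their samples; segment noise is independent across trees, so it is
  pooled, with the 1 / k of the average in its coefficient.\<close>

definition noises :: "real \<Rightarrow> (real \<times> nat set) set" where
  "noises \<epsilon> =
    (\<lambda>(t, z). (4 / \<epsilon>, raw_indices (root t) q z)) ` ({..<8 * q} \<times> {..<n}) \<union>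
    (\<lambda>(u, v). (4 / \<epsilon>, raw_indices u 0 v)) ` {(u, v) \<in> {..<n} \<times> {..<n}. hops u v < q * q} \<union>
    (\<lambda>(u, v). (16 * real q / \<epsilon> / real (card (hits (8 * q) u v)), segment_indices u v u)) `
      {(u, v) \<in> {..<n} \<times> {..<n}. q * q \<le> hops u v} \<union>
    (\<lambda>(u, v). (16 * real q / \<epsilon> / real (card (hits (8 * q) u v)), segment_indices u v v)) `
      {(u, v) \<in> {..<n} \<times> {..<n}. q * q \<le> hops u v}"

text \<open>For a long path there are four terms: the averaged left-over edges towards
  \<open>u\<close> and \<open>v\<close>, bounded by their maxima over the trees, and the pooled
  segments towards \<open>u\<close> and \<open>v\<close>.\<close>

lemma estimate_error:
  assumes n2: "n \<ge> 2" and uv: "u < n" "v < n"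
    and good: "\<And>p. p \<in> noises \<epsilon> \<Longrightarrow> \<bar>noise \<omega> p\<bar> \<le> bound \<epsilon>"
    and b0: "bound \<epsilon> \<ge> 0"
  shows "\<bar>estimate (noisy \<epsilon> w \<omega>) u v - counting_query G w u v\<bar> \<le> 4 * bound \<epsilon>"
proof (cases "hops u v < q * q")
  case True
  have "estimate (noisy \<epsilon> w \<omega>) u v = counting_query G w u v + noise \<omega> (4 / \<epsilon>, raw_indices u 0 v)"
    using True est_noisy[OF uv, of 0 \<epsilon> w \<omega> 0 0] ends_mult_0[OF uv]
    by (simp add: estimate_def noise_def)
  moreover have "(4 / \<epsilon>, raw_indices u 0 v) \<in> noises \<epsilon>" using uv True by (auto simp: noises_def)
  from good[OF this] have "\<bar>noise \<omega> (4 / \<epsilon>, raw_indices u 0 v)\<bar> \<le> bound \<epsilon>" .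
  ultimately show ?thesis using b0 by simp
next
  case False
  let ?H = "hits (8 * q) u v" and ?b = "16 * real q / \<epsilon>"
  let ?k = "real (card ?H)"
  let ?R = "\<lambda>t z. noise \<omega> (4 / \<epsilon>, raw_indices (root t) q z)"
  let ?S = "\<lambda>z. noise \<omega> (?b / ?k, segment_indices u v z)"
  have h: "real (hops u v) > 0" using hops_ge_1[OF uv] by simp
  have k: "?k > 0"
  proof -
    have "0 < 2 * real q * real (hops u v) / real n"
      using rate_ge_1[OF n_pos] h n_pos by simp
    then show ?thesis using card_hits_ge[OF uv _ n2] False by linarith
  qed
  then have ne: "?H \<noteq> {}" by auto
  have "(\<Sum>t\<in>?H. tree_est (noisy \<epsilon> w \<omega>) t u + tree_est (noisy \<epsilon> w \<omega>) t v) =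
      (\<Sum>t\<in>?H. counting_query G w u v + (?R t u + ?R t v) +
        (?b * (\<Sum>c\<in>ends (root t) q u. lapl (\<omega> (n * n + t * n + c))) +
         ?b * (\<Sum>c\<in>ends (root t) q v. lapl (\<omega> (n * n + t * n + c)))))"
  proof (rule sum.cong[OF refl])
    fix t assume "t \<in> ?H"
    then show "tree_est (noisy \<epsilon> w \<omega>) t u + tree_est (noisy \<epsilon> w \<omega>) t v =
        counting_query G w u v + (?R t u + ?R t v) +
        (?b * (\<Sum>c\<in>ends (root t) q u. lapl (\<omega> (n * n + t * n + c))) +
         ?b * (\<Sum>c\<in>ends (root t) q v. lapl (\<omega> (n * n + t * n + c))))"
      using counting_query_split[OF uv, of "root t" w] uv
      by (simp add: tree_est_noisy hits_def noise_def)
  qed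
  also have "\<dots> = ?k * counting_query G w u v + (\<Sum>t\<in>?H. ?R t u + ?R t v) + ?k * (?S u + ?S v)"
  proof -
    have S: "?k * ?S z = ?b * (\<Sum>t\<in>?H. \<Sum>c\<in>ends (root t) q z. lapl (\<omega> (n * n + t * n + c)))"
      if "z < n" for z
      using k by (simp add: noise_def sum_segment_indices that)
    show ?thesis
      by (simp only: sum.distrib sum_constant sum_distrib_left[symmetric] distrib_left S[OF uv(1)] S[OF uv(2)])
  qed
  finally have "estimate (noisy \<epsilon> w \<omega>) u v =
      counting_query G w u v + (\<Sum>t\<in>?H. ?R t u + ?R t v) / ?k + (?S u + ?S v)"
    using False k ne by (simp add: estimate_def add_divide_distrib)
  moreover have "\<bar>(\<Sum>t\<in>?H. ?R t u + ?R t v) / ?k\<bar> \<le> 2 * bound \<epsilon>"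
  proof -
    have "\<bar>?R t z\<bar> \<le> bound \<epsilon>" if "t \<in> ?H" "z < n" for t z
      by (rule good) (use that in \<open>force simp: noises_def hits_def\<close>)
    from this[OF _ uv(1)] this[OF _ uv(2)] have "\<bar>?R t u + ?R t v\<bar> \<le> 2 * bound \<epsilon>" if "t \<in> ?H" for t
      using that abs_triangle_ineq[of "?R t u" "?R t v"] by fastforce
    then have "\<bar>\<Sum>t\<in>?H. ?R t u + ?R t v\<bar> \<le> (\<Sum>t\<in>?H. 2 * bound \<epsilon>)"
      by (intro order_trans[OF sum_abs] sum_mono)
    then show ?thesis using k by (simp add: abs_divide field_simps)
  qed
  moreover have "\<bar>?S u\<bar> \<le> bound \<epsilon>" "\<bar>?S v\<bar> \<le> bound \<epsilon>"
    by (rule good; use uv False in \<open>force simp: noises_def\<close>)+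
  ultimately show ?thesis by linarith
qed

lemma card_raw_indices: "x < n \<Longrightarrow> z < n \<Longrightarrow> card (raw_indices x \<mu> z) = card (raw x \<mu> z \<union> run x \<mu> z)"
  using sum_raw_indices[of x z "\<lambda>_. 1 :: nat" \<mu>] by simp

text \<open>At most lg n light edges and q <= n leave at most (2 n lg n + n) / q <= 3 n lg n / q
  edges, and n lg n <= q^3.\<close>

lemma card_raw_indices_tree:
  assumes "z < n" "x < n" "n \<ge> 2"
  shows "card (raw_indices x q z) \<le> 3 * q\<^sup>2"
proof -
  obtain l where l: "2 ^ l \<le> n" "card (raw_indices x q z) * q \<le> l * (n + q) + n"
    using raw_bound[OF assms(2,1), of q] by (auto simp: card_raw_indices assms)
  have "l \<le> lg n"
    using l(1) le_two_power_lg[of n] by (meson le_trans nat_power_less_imp_less not_le one_less_numeral_iff order.asym power_increasing_iff semiring_norm(76))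
  then have "l * (n + q) \<le> lg n * (2 * n)" using rate_le[OF n_pos] by (intro mult_le_mono) auto
  moreover have "n \<le> lg n * n" using lg_ge_1[OF assms(3)] by simp
  ultimately have "card (raw_indices x q z) * q \<le> lg n * (2 * n) + lg n * n" using l(2) by linarith
  also have "\<dots> = 3 * (n * lg n)" by simp
  also have "\<dots> \<le> 3 * q ^ 3" using rate_cube[OF n_pos] by simp
  finally have "card (raw_indices x q z) * q \<le> (3 * q\<^sup>2) * q" by (simp add: power2_eq_square power3_eq_cube)
  then show ?thesis using rate_ge_1[OF n_pos] by simp
qed

lemma card_raw_indices_short:
  assumes "u < n" "v < n" "hops u v < q * q"
  shows "card (raw_indices u 0 v) \<le> 3 * q\<^sup>2"
proof -
  have "card (raw u 0 v \<union> run u 0 v) \<le> card (set (sp u v))"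
    using cut_subset[OF assms(1,2), of 0] by (intro card_mono) auto
  also have "\<dots> \<le> hops u v" unfolding hops_def by (rule card_length)
  finally show ?thesis using assms by (simp add: card_raw_indices power2_eq_square)
qed

text \<open>A root on the path is joined to either end by a subpath, so by \<open>ends_bound\<close>
  each of its trees contributes at most q h / n segments, h being the number of vertices on the
  path.\<close>

lemma card_segment_indices:
  assumes "u < n" "v < n" "z \<in> {u, v}"
  shows "card (segment_indices u v z) * n \<le> card (hits (8 * q) u v) * (q * hops u v)"
proof -
  have z: "z < n" using assms by auto
  have "card (segment_indices u v z) = (\<Sum>t\<in>hits (8 * q) u v. card (ends (root t) q z))"
    using sum_segment_indices[OF z, of "\<lambda>_. 1 :: nat" u v] by simp
  then have "card (segment_indices u v z) * n = (\<Sum>t\<in>hits (8 * q) u v. card (ends (root t) q z) * n)"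
    by (simp add: sum_distrib_right)
  also have "\<dots> \<le> (\<Sum>t\<in>hits (8 * q) u v. q * hops u v)"
  proof (rule sum_mono)
    fix t assume "t \<in> hits (8 * q) u v"
    then have "root t \<in> set (sp u v)" by (simp add: hits_def)
    then have "hops u (root t) + hops (root t) v = hops u v + 1" using on_sp_iff assms root_less by blast
    moreover have "hops (root t) u = hops u (root t)" using hops_commute assms root_less by blast
    moreover have "hops (root t) v \<ge> 1" "hops u (root t) \<ge> 1" using hops_ge_1 assms root_less by blast+
    ultimately have "hops (root t) z - 1 \<le> hops u v" using assms(3) by auto
    then have "(hops (root t) z - 1) * q \<le> hops u v * q" by (rule mult_le_mono1)
    then show "card (ends (root t) q z) * n \<le> q * hops u v"
      using ends_bound[OF root_less[of t] z, of q] unfolding mult.commute[of q] by linarith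
  qed
  finally show ?thesis by simp
qed

text \<open>The parameter \<open>s\<close> is chosen such that \<open>s * bound \<epsilon>\<close>
  is 9 lg n, whence 144 = 9 * 16, while the moment term 2 (s c)^2 |J| stays below lg n for both
  kinds of noise. This leaves the exponent -8 lg n.\<close>

lemma noise_tail:
  assumes n2: "n \<ge> 2" and \<epsilon>: "\<epsilon> > 0" and p: "p \<in> noises \<epsilon>"
  shows "measure random_tape {\<omega> \<in> space random_tape. bound \<epsilon> < \<bar>noise \<omega> p\<bar>} \<le> 2 * exp (- 8 * real (lg n))"
proof -
  let ?l = "real (lg n)" and ?q = "real q" and ?N = "real n"
  define s where "s = \<epsilon> * sqrt ?l / (16 * ?q)"
  obtain c J where cJ: "p = (c, J)" by (cases p)
  have l: "?l \<ge> 1" using lg_ge_1[OF n2] by simp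
  have q: "?q \<ge> 1" using rate_ge_1[OF n_pos] by simp
  have N: "?N > 0" using n2 by simp
  have s: "s > 0" using l q \<epsilon> by (simp add: s_def)
  have cube: "?N * ?l \<le> ?q ^ 3" using rate_cube[OF n_pos] by (metis of_nat_le_iff of_nat_mult of_nat_power)
  have sq: "sqrt ?l \<le> ?l" using l by (simp add: sqrt_le_D real_le_lsqrt power2_eq_square)
  have conds: "finite J \<and> c > 0 \<and> s * c \<le> 1 / 2 \<and> 2 * (s * c)\<^sup>2 * real (card J) \<le> ?l"
  proof -
    \<comment> \<open>Here s c = sqrt(lg n) / (4 q), so the moment term is at most 2 (lg n / (16
      q^2)) 3 q^2 = 3/8 lg n.\<close>
    have raw: "?thesis" if "c = 4 / \<epsilon>" "card J \<le> 3 * q\<^sup>2" "finite J"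
    proof -
      have sc: "s * c = sqrt ?l / (4 * ?q)" unfolding that(1) s_def using \<epsilon> by simp
      have "?N * ?l \<le> ?N * ?q\<^sup>2"
      proof -
        have "?q ^ 3 = ?q * ?q\<^sup>2" by (simp add: power3_eq_cube power2_eq_square)
        also have "\<dots> \<le> ?N * ?q\<^sup>2" using rate_le[OF n_pos] by (intro mult_right_mono) auto
        finally have "?q ^ 3 \<le> ?N * ?q\<^sup>2" .
        then show ?thesis using cube by linarith
      qed
      then have "?l \<le> ?q\<^sup>2" using N by simp
      then have "sqrt ?l \<le> ?q" using q by (intro real_le_lsqrt) auto
      then have 1: "s * c \<le> 1 / 2" unfolding sc using q by (simp add: field_simps)
      have "real (card J) \<le> 3 * ?q\<^sup>2" using that(2) by (metis of_nat_le_iff of_nat_mult of_nat_numeral of_nat_power)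
      then have "2 * (s * c)\<^sup>2 * real (card J) \<le> 2 * (s * c)\<^sup>2 * (3 * ?q\<^sup>2)" by (intro mult_left_mono) auto
      also have "\<dots> \<le> ?l" unfolding sc using q l by (simp add: power_divide power_mult_distrib)
      finally show ?thesis using 1 that \<epsilon> by simp
    qed
    \<comment> \<open>Here s c = sqrt(lg n) / k, and k trees provide at most k q h / n <= k^2 / 2
      samples: the path length h cancels. The bound k >= 2 lg n keeps s c in the range where the
      moment bound holds.\<close>
    have seg: "?thesis" if uv: "u < n" "v < n" "z \<in> {u, v}" and long: "q * q \<le> hops u v"
      and c: "c = 16 * ?q / \<epsilon> / real (card (hits (8 * q) u v))" and J: "J = segment_indices u v z" for u v z
    proof -
      let ?k = "real (card (hits (8 * q) u v))" and ?h = "real (hops u v)"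
      have k: "2 * ?q * ?h / ?N \<le> ?k" by (rule card_hits_ge[OF uv(1,2) long n2])
      have "2 * ?l \<le> 2 * ?q ^ 3 / ?N" using cube N by (simp add: field_simps)
      also have "\<dots> = 2 * ?q * real (q * q) / ?N" by (simp add: power3_eq_cube)
      also have "\<dots> \<le> 2 * ?q * ?h / ?N"
        using long by (intro divide_right_mono mult_left_mono of_nat_mono) auto
      finally have lk: "2 * ?l \<le> ?k" using k by linarith
      then have kpos: "?k > 0" using l by linarith
      then have "hits (8 * q) u v \<noteq> {}" by auto
      have sc: "s * c = sqrt ?l / ?k" using \<epsilon> q kpos c by (simp add: s_def field_simps)
      have 1: "s * c \<le> 1 / 2" unfolding sc using lk sq kpos by (simp add: field_simps)
      have "real (card J * n) \<le> real (card (hits (8 * q) u v) * (q * hops u v))"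
        unfolding J by (intro of_nat_mono card_segment_indices uv)
      then have "real (card J) * ?N \<le> ?k * (?q * ?h)" by simp
      then have "2 * real (card J) \<le> ?k * (2 * ?q * ?h / ?N)" using N by (simp add: field_simps)
      also have "\<dots> \<le> ?k * ?k" using k by (intro mult_left_mono) auto
      finally have "(s * c)\<^sup>2 * (2 * real (card J)) \<le> (s * c)\<^sup>2 * (?k * ?k)" by (intro mult_left_mono) auto
      also have "\<dots> = ?l" unfolding sc using kpos \<open>hits (8 * q) u v \<noteq> {}\<close> l
        by (simp add: power_divide power2_eq_square)
      finally have 2: "2 * (s * c)\<^sup>2 * real (card J) \<le> ?l" by simp
      have "finite J"
      proof -
        have "finite (SIGMA t:hits (8 * q) u v. ends (root t) q z)"
          using cut_finite(3)[OF root_less] uv by (intro finite_SigmaI) auto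
        then show ?thesis unfolding J segment_indices_def by (rule finite_imageI)
      qed
      moreover have "c > 0" unfolding c using q \<epsilon> kpos by (intro divide_pos_pos) auto
      ultimately show ?thesis using 1 2 by blast
    qed
    have fin: "finite (raw_indices x \<mu> z)" if "x < n" "z < n" for x \<mu> z
      using that by (simp add: raw_indices_def)
    from p[unfolded noises_def cJ Un_iff] show ?thesis
    proof (elim disjE)
      assume "(c, J) \<in> (\<lambda>(t, z). (4 / \<epsilon>, raw_indices (root t) q z)) ` ({..<8 * q} \<times> {..<n})"
      then obtain t z where a: "z < n" "c = 4 / \<epsilon>" "J = raw_indices (root t) q z" by auto
      show ?thesis
        using card_raw_indices_tree[OF a(1) root_less n2, of t] fin[OF root_less a(1), of t q]
        by (intro raw) (simp_all add: a)
    next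
      assume "(c, J) \<in> (\<lambda>(u, v). (4 / \<epsilon>, raw_indices u 0 v)) `
        {(u, v) \<in> {..<n} \<times> {..<n}. hops u v < q * q}"
      then obtain u v where b: "u < n" "v < n" "hops u v < q * q" "c = 4 / \<epsilon>" "J = raw_indices u 0 v" by auto
      show ?thesis
        using card_raw_indices_short[OF b(1-3)] fin[OF b(1,2), of 0]
        by (intro raw) (simp_all add: b)
    next
      assume "(c, J) \<in> (\<lambda>(u, v). (16 * real q / \<epsilon> / real (card (hits (8 * q) u v)), segment_indices u v u)) `
        {(u, v) \<in> {..<n} \<times> {..<n}. q * q \<le> hops u v}"
      then obtain u v where d: "u < n" "v < n" "q * q \<le> hops u v"
        "c = 16 * real q / \<epsilon> / real (card (hits (8 * q) u v))" "J = segment_indices u v u" by auto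
      show ?thesis by (rule seg[OF d(1,2) _ d(3,4,5)]) simp
    next
      assume "(c, J) \<in> (\<lambda>(u, v). (16 * real q / \<epsilon> / real (card (hits (8 * q) u v)), segment_indices u v v)) `
        {(u, v) \<in> {..<n} \<times> {..<n}. q * q \<le> hops u v}"
      then obtain u v where d: "u < n" "v < n" "q * q \<le> hops u v"
        "c = 16 * real q / \<epsilon> / real (card (hits (8 * q) u v))" "J = segment_indices u v v" by auto
      show ?thesis by (rule seg[OF d(1,2) _ d(3,4,5)]) simp
    qed
  qed
  have "measure random_tape {\<omega> \<in> space random_tape. bound \<epsilon> < \<bar>noise \<omega> p\<bar>} \<le>
      2 * exp (2 * (s * c)\<^sup>2 * real (card J) - s * bound \<epsilon>)"
    unfolding cJ noise_def prod.case using conds s by (intro lapl_sum_tail) auto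
  also have "s * bound \<epsilon> = 9 * (sqrt ?l * sqrt ?l)" using \<epsilon> q by (simp add: s_def bound_def)
  also have "\<dots> = 9 * ?l" by simp
  also have "2 * exp (2 * (s * c)\<^sup>2 * real (card J) - 9 * ?l) \<le> 2 * exp (- 8 * ?l)" using conds by simp
  finally show ?thesis .
qed

lemma card_noises: "finite (noises \<epsilon>)" "card (noises \<epsilon>) \<le> 11 * (n * n)"
proof -
  have image: "finite (f ` {(u, v) \<in> {..<n} \<times> {..<n}. P u v}) \<and>
      card (f ` {(u, v) \<in> {..<n} \<times> {..<n}. P u v}) \<le> n * n"
    for f :: "nat \<times> nat \<Rightarrow> real \<times> nat set" and P
  proof -
    let ?S = "{(u, v) \<in> {..<n} \<times> {..<n}. P u v}"
    have "?S \<subseteq> {..<n} \<times> {..<n}" by auto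
    then have fin: "finite ?S" and "card ?S \<le> card ({..<n} \<times> {..<n})"
      by (rule finite_subset, simp) (rule card_mono, simp, fact)
    then have "card ?S \<le> n * n" by (simp only: card_cartesian_product card_lessThan)
    then show ?thesis using card_image_le[OF fin, of f] finite_imageI[OF fin, of f] by linarith
  qed
  let ?f = "\<lambda>(t, z). (4 / \<epsilon>, raw_indices (root t) q z)"
  have tree: "finite (?f ` ({..<8 * q} \<times> {..<n}))" "card (?f ` ({..<8 * q} \<times> {..<n})) \<le> 8 * (n * n)"
    using rate_le[OF n_pos] by (simp, intro order_trans[OF card_image_le]) auto
  show "finite (noises \<epsilon>)"
    unfolding noises_def by (intro finite_UnI conjunct1[OF image] tree)
  have "card (noises \<epsilon>) \<le> 8 * (n * n) + n * n + n * n + n * n"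
    unfolding noises_def
    by (intro order_trans[OF card_Un_le] add_mono conjunct2[OF image] tree)
  then show "card (noises \<epsilon>) \<le> 11 * (n * n)" by simp
qed

text \<open>A union bound over at most 11 n^2 sums, each with failure probability at most 2 / n^8;
  finally 22 <= 2^5 <= n^5.\<close>

lemma mechanism_accurate:
  assumes n2: "n \<ge> 2" and \<epsilon>: "\<epsilon> > 0" and B: "4 * bound \<epsilon> \<le> B"
  shows "measure (mechanism \<epsilon> w) {f \<in> space (mechanism \<epsilon> w). max_error G w f \<le> B} \<ge> 1 - 1 / real n"
proof -
  interpret prob_space random_tape by (rule prob_space_random_tape)
  let ?V = "verts G \<times> verts G"
  let ?A = "\<lambda>p. {\<omega> \<in> space random_tape. bound \<epsilon> < \<bar>noise \<omega> p\<bar>}"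
  have V: "finite ?V" "?V \<noteq> {}" using n2 by (auto simp: verts_def lessThan_empty_iff)
  have max_le: "max_error G w f \<le> B \<longleftrightarrow> (\<forall>p\<in>?V. \<bar>f p - counting_query G w (fst p) (snd p)\<bar> \<le> B)" for f
    unfolding max_error_def using V by (subst Max_le_iff) auto
  have ev: "{f \<in> space (output_space G). max_error G w f \<le> B} \<in> sets (output_space G)"
  proof -
    have "(\<lambda>f. \<bar>f p - counting_query G w (fst p) (snd p)\<bar>) \<in> borel_measurable (output_space G)" if "p \<in> ?V" for p
      unfolding output_space_def using measurable_component_singleton[OF that, of "\<lambda>_. borel :: real measure"] by simp
    then show ?thesis unfolding max_le
      by (intro sets.sets_Collect_finite_All borel_measurable_le V borel_measurable_const) auto
  qed
  have ms: "?A p \<in> events" for p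
    unfolding noise_def by (cases p) (simp, measurable)
  have b0: "bound \<epsilon> \<ge> 0" using \<epsilon> by (simp add: bound_def)
  let ?E = "{\<omega> \<in> space random_tape. max_error G w (release (noisy \<epsilon> w \<omega>)) \<le> B}"
  have "prob (\<Union>p\<in>noises \<epsilon>. ?A p) \<le> (\<Sum>p\<in>noises \<epsilon>. prob (?A p))"
    using ms card_noises(1) by (intro finite_measure_subadditive_finite) auto
  also have "\<dots> \<le> (\<Sum>p\<in>noises \<epsilon>. 2 * exp (- 8 * real (lg n)))"
    by (intro sum_mono noise_tail n2 \<epsilon>)
  also have "\<dots> = real (card (noises \<epsilon>)) * (2 * exp (- 8 * real (lg n)))" by simp
  also have "\<dots> \<le> (11 * (real n * real n)) * (2 * (1 / real n ^ 8))"
  proof (rule mult_mono)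
    show "real (card (noises \<epsilon>)) \<le> 11 * (real n * real n)"
      using card_noises(2) by (metis of_nat_le_iff of_nat_mult of_nat_numeral)
    have "exp (- 8 * real (lg n)) \<le> exp (- 8 * ln (real n))" using lg_ge_ln[OF n_pos] by simp
    also have "\<dots> = inverse (exp (real 8 * ln (real n)))" by (simp flip: exp_minus)
    also have "\<dots> = 1 / real n ^ 8" using n2 by (simp only: exp_of_nat_mult) (simp add: inverse_eq_divide)
    finally show "2 * exp (- 8 * real (lg n)) \<le> 2 * (1 / real n ^ 8)" by simp
  qed auto
  also have "\<dots> \<le> 1 / real n"
  proof -
    have "(2 :: real) ^ 5 \<le> real n ^ 5" using n2 by (intro power_mono) auto
    then have "22 * real n ^ 3 \<le> real n ^ 5 * real n ^ 3" by (intro mult_right_mono) auto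
    then have "22 * real n ^ 3 \<le> real n ^ 8" by (simp flip: power_add)
    then show ?thesis using n2 by (simp add: field_simps eval_nat_numeral)
  qed
  finally have bad: "prob (\<Union>p\<in>noises \<epsilon>. ?A p) \<le> 1 / real n" .
  have E_eq: "?E = (\<lambda>\<omega>. release (noisy \<epsilon> w \<omega>)) -` {f \<in> space (output_space G). max_error G w f \<le> B} \<inter> space random_tape"
    using measurable_space[OF release_noisy_measurable[of \<epsilon> w]] by auto
  have "space random_tape - (\<Union>p\<in>noises \<epsilon>. ?A p) \<subseteq> ?E"
  proof
    fix \<omega> assume *: "\<omega> \<in> space random_tape - (\<Union>p\<in>noises \<epsilon>. ?A p)"
    then have "\<bar>noise \<omega> p\<bar> \<le> bound \<epsilon>" if "p \<in> noises \<epsilon>" for p using that by fastforce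
    from estimate_error[OF n2 _ _ this b0]
    have "\<bar>estimate (noisy \<epsilon> w \<omega>) u v - counting_query G w u v\<bar> \<le> B" if "u < n" "v < n" for u v
      using that B order_trans by blast
    then show "\<omega> \<in> ?E" using * unfolding max_le by (auto simp: release_def verts_def)
  qed
  then have "prob (space random_tape - (\<Union>p\<in>noises \<epsilon>. ?A p)) \<le> prob ?E"
    by (intro finite_measure_mono) (use measurable_sets[OF release_noisy_measurable ev] E_eq in auto)
  moreover have "prob (space random_tape - (\<Union>p\<in>noises \<epsilon>. ?A p)) = 1 - prob (\<Union>p\<in>noises \<epsilon>. ?A p)"
    using ms card_noises(1) by (intro prob_compl sets.finite_UN) auto
  moreover have "measure (mechanism \<epsilon> w) {f \<in> space (mechanism \<epsilon> w). max_error G w f \<le> B} = prob ?E"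
    unfolding mechanism_def space_distr
    by (subst measure_distr[OF release_noisy_measurable ev]) (simp only: E_eq)
  ultimately show ?thesis using bad by linarith
qed

end

section \<open>Verifying programs\<close>

lemma put_simps [simp]:
  "nmem (nput a p x s) = (nmem s)(a := (nmem s a)(p := x))"
  "rmem (nput a p x s) = rmem s" "used (nput a p x s) = used s"
  "rmem (rput a p y s) = (rmem s)(a := (rmem s a)(p := y))"
  "nmem (rput a p y s) = nmem s" "used (rput a p y s) = used s"
  by (simp_all add: nput_def rput_def)

primrec nwrites :: "com \<Rightarrow> nat set" where
  "nwrites Skip = {}"
| "nwrites (NPut a i j x) = {a}"
| "nwrites (RPut a i j x) = {}"
| "nwrites (Sample a i j) = {}"
| "nwrites (Seq c d) = nwrites c \<union> nwrites d"
| "nwrites (Cond b c d) = nwrites c \<union> nwrites d"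
| "nwrites (While b c) = nwrites c"

primrec rwrites :: "com \<Rightarrow> nat set" where
  "rwrites Skip = {}"
| "rwrites (NPut a i j x) = {}"
| "rwrites (RPut a i j x) = {a}"
| "rwrites (Sample a i j) = {a}"
| "rwrites (Seq c d) = rwrites c \<union> rwrites d"
| "rwrites (Cond b c d) = rwrites c \<union> rwrites d"
| "rwrites (While b c) = rwrites c"

primrec draws :: "com \<Rightarrow> bool" where
  "draws Skip = False"
| "draws (NPut a i j x) = False"
| "draws (RPut a i j x) = False"
| "draws (Sample a i j) = True"
| "draws (Seq c d) = (draws c \<or> draws d)"
| "draws (Cond b c d) = (draws c \<or> draws d)"
| "draws (While b c) = draws c"

text \<open>A syntactic frame condition. The rules \<open>runs_mono\<close> and
  \<open>runs_For\<close> supply it, so invariants need to describe only what a loop body really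
  writes.\<close>

definition unchanged :: "com \<Rightarrow> state \<Rightarrow> state \<Rightarrow> bool" where
  "unchanged c s s' \<longleftrightarrow> (\<forall>a. a \<notin> nwrites c \<longrightarrow> nmem s' a = nmem s a) \<and>
     (\<forall>a. a \<notin> rwrites c \<longrightarrow> rmem s' a = rmem s a) \<and> (\<not> draws c \<longrightarrow> used s' = used s)"

lemma unchanged_nmem: "unchanged c s s' \<Longrightarrow> a \<notin> nwrites c \<Longrightarrow> nmem s' a = nmem s a"
  and unchanged_rmem: "unchanged c s s' \<Longrightarrow> a \<notin> rwrites c \<Longrightarrow> rmem s' a = rmem s a"
  and unchanged_used: "unchanged c s s' \<Longrightarrow> \<not> draws c \<Longrightarrow> used s' = used s"
  by (auto simp: unchanged_def)

lemma exec_unchanged: "exec \<omega> c s t s' \<Longrightarrow> unchanged c s s'"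
  by (induction rule: exec.induct) (auto simp: unchanged_def)

text \<open>An upper bound for the running time when every loop makes at most \<open>M\<close> iterations.\<close>

primrec cost :: "nat \<Rightarrow> com \<Rightarrow> nat" where
  "cost M Skip = 1"
| "cost M (NPut a i j x) = 1"
| "cost M (RPut a i j x) = 1"
| "cost M (Sample a i j) = 1"
| "cost M (Seq c d) = cost M c + cost M d"
| "cost M (Cond b c d) = cost M c + cost M d + 1"
| "cost M (While b c) = M * (cost M c + 1) + 1"

lemma cost_poly: "\<exists>p :: nat poly. \<forall>k. cost (m * k) c \<le> poly p k"
proof (induction c)
  case (Seq c d)
  then obtain p r where "\<forall>k. cost (m * k) c \<le> poly p k" "\<forall>k. cost (m * k) d \<le> poly r k" by blast
  then show ?case by (intro exI[of _ "p + r"]) (simp add: add_mono)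
next
  case (Cond b c d)
  then obtain p r where "\<forall>k. cost (m * k) c \<le> poly p k" "\<forall>k. cost (m * k) d \<le> poly r k" by blast
  then show ?case by (intro exI[of _ "p + r + 1"]) (simp add: add_mono)
next
  case (While b c)
  then obtain p where "\<forall>k. cost (m * k) c \<le> poly p k" by blast
  have "cost (m * k) (While b c) \<le> poly ([:0, m:] * (p + 1) + 1) k" for k
  proof -
    have "m * k * (cost (m * k) c + 1) + 1 \<le> m * k * (poly p k + 1) + 1"
      using \<open>\<forall>k. cost (m * k) c \<le> poly p k\<close> by (intro add_mono mult_le_mono) auto
    also have "\<dots> = poly ([:0, m:] * (p + 1) + 1) k" by (simp add: algebra_simps)
    finally show ?thesis by (simp only: cost.simps)
  qed
  then show ?case by blast
qed (rule exI[of _ 1], simp)+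

text \<open>Total correctness with a time bound. As \<open>cost\<close> depends only on the syntax
  and on \<open>M\<close>, no invariant has to speak about time.\<close>

definition runs :: "(nat \<Rightarrow> real) \<Rightarrow> nat \<Rightarrow> com \<Rightarrow> state \<Rightarrow> (state \<Rightarrow> bool) \<Rightarrow> bool" where
  "runs \<omega> M c s Q \<longleftrightarrow> (\<exists>t s'. exec \<omega> c s t s' \<and> t \<le> cost M c \<and> Q s')"

lemma runs_mono:
  "runs \<omega> M c s P \<Longrightarrow> (\<And>s'. unchanged c s s' \<Longrightarrow> P s' \<Longrightarrow> Q s') \<Longrightarrow> runs \<omega> M c s Q"
  unfolding runs_def using exec_unchanged by blast

lemma runs_Seq: "runs \<omega> M c s (\<lambda>s'. runs \<omega> M d s' Q) \<Longrightarrow> runs \<omega> M (Seq c d) s Q"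
  unfolding runs_def by (force intro: exec.Seq add_mono)

lemma runs_Seq_mono:
  assumes "runs \<omega> M c s P" "\<And>s'. unchanged c s s' \<Longrightarrow> P s' \<Longrightarrow> runs \<omega> M d s' Q"
  shows "runs \<omega> M (Seq c d) s Q"
  by (rule runs_Seq, rule runs_mono[OF assms])

lemma runs_Cond:
  assumes "bval s b \<Longrightarrow> runs \<omega> M c s Q" "\<not> bval s b \<Longrightarrow> runs \<omega> M d s Q"
  shows "runs \<omega> M (Cond b c d) s Q"
proof (cases "bval s b")
  case True
  then obtain t s' where "exec \<omega> c s t s'" "t \<le> cost M c" "Q s'" using assms(1) by (auto simp: runs_def)
  then show ?thesis unfolding runs_def using exec.CondTrue[OF True, of \<omega> c t s' d]
    by (intro exI[of _ "t + 1"] exI[of _ s']) auto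
next
  case False
  then obtain t s' where "exec \<omega> d s t s'" "t \<le> cost M d" "Q s'" using assms(2) by (auto simp: runs_def)
  then show ?thesis unfolding runs_def using exec.CondFalse[OF False, of \<omega> d t s' c]
    by (intro exI[of _ "t + 1"] exI[of _ s']) auto
qed

text \<open>Meant for loop-free commands: \<open>False\<close> for loops keeps
  \<open>wp_runs\<close> sound, and loops are left to \<open>runs_For\<close>.\<close>

primrec wp :: "(nat \<Rightarrow> real) \<Rightarrow> com \<Rightarrow> (state \<Rightarrow> bool) \<Rightarrow> state \<Rightarrow> bool" where
  "wp \<omega> Skip Q s = Q s"
| "wp \<omega> (NPut a i j x) Q s = Q (nput a (nval s i, nval s j) (nval s x) s)"
| "wp \<omega> (RPut a i j x) Q s = Q (rput a (nval s i, nval s j) (rval s x) s)"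
| "wp \<omega> (Sample a i j) Q s =
    Q ((rput a (nval s i, nval s j) (\<omega> (used s)) s)\<lparr>used := used s + 1\<rparr>)"
| "wp \<omega> (Seq c d) Q s = wp \<omega> c (wp \<omega> d Q) s"
| "wp \<omega> (Cond b c d) Q s = (if bval s b then wp \<omega> c Q s else wp \<omega> d Q s)"
| "wp \<omega> (While b c) Q s = False"

lemma wp_runs: "wp \<omega> c Q s \<Longrightarrow> runs \<omega> M c s Q"
proof (induction c arbitrary: Q s)
  case (Seq c d)
  have "runs \<omega> M c s (wp \<omega> d Q)" using Seq by simp
  then show ?case by (rule runs_Seq_mono) (use Seq in simp)
next
  case (Cond b c d)
  then show ?case by (intro runs_Cond) (simp_all split: if_splits)
next
  case Skip
  then show ?case using exec.Skip[of \<omega> s] unfolding runs_def by (intro exI[of _ 1] exI conjI) auto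
next
  case (NPut a i j x)
  then show ?case using exec.NPut[of \<omega> a i j x s] unfolding runs_def by (intro exI[of _ 1] exI conjI) auto
next
  case (RPut a i j x)
  then show ?case using exec.RPut[of \<omega> a i j x s] unfolding runs_def by (intro exI[of _ 1] exI conjI) auto
next
  case (Sample a i j)
  then show ?case using exec.Sample[of \<omega> a i j s] unfolding runs_def by (intro exI[of _ 1] exI conjI) auto
qed simp

abbreviation var :: "nat \<Rightarrow> nexp" where
  "var a \<equiv> NGet a (NConst 0) (NConst 0)"

abbreviation assign :: "nat \<Rightarrow> nexp \<Rightarrow> com" where
  "assign a x \<equiv> NPut a (NConst 0) (NConst 0) x"

definition For :: "nat \<Rightarrow> nexp \<Rightarrow> com \<Rightarrow> com" where
  "For i k c = Seq (assign i (NConst 0))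
     (While (NLess (var i) k) (Seq c (assign i (NPlus (var i) (NConst 1)))))"

lemma writes_For [simp]:
  "nwrites (For i k c) = insert i (nwrites c)" "rwrites (For i k c) = rwrites c"
  "draws (For i k c) = draws c"
  by (auto simp: For_def)

lemma unchanged_trans: "unchanged c s s' \<Longrightarrow> unchanged c s' s'' \<Longrightarrow> unchanged c s s''"
  by (simp add: unchanged_def)

text \<open>The invariant is required after the counter has been increased. The loop limit is an
  expression, so its value must be stable under everything that the loop may write.\<close>

lemma runs_For:
  assumes "K \<le> M" and i: "i \<notin> nwrites c"
    and k: "\<And>s'. unchanged (For i k c) s s' \<Longrightarrow> nval s' k = K"
    and init: "Inv 0 (nput i (0, 0) 0 s)"
    and body: "\<And>j s'. j < K \<Longrightarrow> unchanged (For i k c) s s' \<Longrightarrow> nmem s' i (0, 0) = j \<Longrightarrow> Inv j s' \<Longrightarrow>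
      runs \<omega> M c s' (\<lambda>s''. Inv (Suc j) (nput i (0, 0) (Suc j) s''))"
    and post: "\<And>s'. unchanged (For i k c) s s' \<Longrightarrow> Inv K s' \<Longrightarrow> Q s'"
  shows "runs \<omega> M (For i k c) s Q"
proof -
  let ?inc = "assign i (NPlus (var i) (NConst 1))"
  let ?W = "While (NLess (var i) k) (Seq c ?inc)"
  have loop: "\<exists>t s''. exec \<omega> ?W s' t s'' \<and> t \<le> (K - j) * (cost M (Seq c ?inc) + 1) + 1 \<and>
      unchanged (For i k c) s s'' \<and> Inv K s''"
    if "j \<le> K" "unchanged (For i k c) s s'" "nmem s' i (0, 0) = j" "Inv j s'" for j s'
    using that
  proof (induction "K - j" arbitrary: j s')
    case 0
    then have "exec \<omega> ?W s' 1 s'" using k by (intro exec.WhileFalse) auto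
    then show ?case using 0 by fastforce
  next
    case (Suc d)
    then have j: "j < K" by simp
    obtain t s1 where e1: "exec \<omega> c s' t s1" "t \<le> cost M c" and inv: "Inv (Suc j) (nput i (0, 0) (Suc j) s1)"
      using body[OF j Suc.prems(2-4)] by (auto simp: runs_def)
    have u1: "unchanged c s' s1" by (rule exec_unchanged[OF e1(1)])
    then have i1: "nmem s1 i (0, 0) = j" using i Suc.prems(3) by (simp add: unchanged_def)
    let ?s2 = "nput i (0, 0) (Suc j) s1"
    have e2: "exec \<omega> (Seq c ?inc) s' (t + 1) ?s2"
      using exec.Seq[OF e1(1) exec.NPut[of \<omega> i "NConst 0" "NConst 0" "NPlus (var i) (NConst 1)" s1]] i1 by simp
    have "unchanged (For i k c) s' ?s2" using u1 by (auto simp: unchanged_def)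
    then have u2: "unchanged (For i k c) s ?s2" by (rule unchanged_trans[OF Suc.prems(2)])
    have A: "d = K - Suc j" "Suc j \<le> K" "nmem ?s2 i (0, 0) = Suc j" using Suc.hyps(2) j by simp_all
    obtain t' s3 where e3: "exec \<omega> ?W ?s2 t' s3" "t' \<le> (K - Suc j) * (cost M (Seq c ?inc) + 1) + 1"
      "unchanged (For i k c) s s3" "Inv K s3"
      using Suc.hyps(1)[OF A(1,2) u2 A(3) inv] by blast
    have "exec \<omega> ?W s' (t + 1 + t' + 1) s3"
      using exec.WhileTrue[OF _ e2 e3(1)] k[OF Suc.prems(2)] Suc.prems(3) j by simp
    moreover have "K - j = Suc (K - Suc j)" using j by simp
    then have "t + 1 + t' + 1 \<le> (K - j) * (cost M (Seq c ?inc) + 1) + 1" using e1(2) e3(2) by simp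
    ultimately show ?case using e3 by blast
  qed
  let ?s0 = "nput i (0, 0) 0 s"
  have "unchanged (For i k c) s ?s0" by (auto simp: unchanged_def)
  then obtain t s' where e: "exec \<omega> ?W ?s0 t s'" "t \<le> K * (cost M (Seq c ?inc) + 1) + 1"
    "unchanged (For i k c) s s'" "Inv K s'"
    using loop[of 0 ?s0] init by auto
  have "exec \<omega> (For i k c) s (1 + t) s'"
    unfolding For_def using exec.Seq[OF exec.NPut[of \<omega> i "NConst 0" "NConst 0" "NConst 0" s] _] e(1) by simp
  moreover have "1 + t \<le> cost M (For i k c)"
    using e(2) mult_le_mono1[OF assms(1), of "cost M (Seq c ?inc) + 1"] by (simp add: For_def)
  ultimately show ?thesis using post[OF e(3,4)] unfolding runs_def by blast
qed

section \<open>The program\<close>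

text \<open>Arrays of natural numbers: 2 to 4 hold \<open>lg n\<close>, a power of 2, and \<open>q\<close>; 5 the numbers of
  vertices on shortest paths (0 when no path is known yet); 6 the numbers of descendants; 7 the
  sizes of the current runs; 8 the numbers of hits; 9 the multiplier \<open>\<mu>\<close>; 11 to 33 are loop
  counters, where 20 is also the root of the current tree; 34 is the best candidate for the root.
  Arrays of reals: 4 holds the distances; 5 the noisy edge weights; 6 a sample; 7 and 8 the
  estimates and their bases; 9 the weights of the current runs; 10 the estimates for short paths;
  11 the sums of the tree estimates; 12 the weights of the greedy choice; 13 and 14 the current and
  the best score; 15 the noise of the segments.\<close>

abbreviation real_var :: "nat \<Rightarrow> rexp" where
  "real_var a \<equiv> RGet a (NConst 0) (NConst 0)"

definition nat_eq :: "nexp \<Rightarrow> nexp \<Rightarrow> bexp" where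
  "nat_eq x y = BAnd (BNot (NLess x y)) (BNot (NLess y x))"

definition real_eq :: "rexp \<Rightarrow> rexp \<Rightarrow> bexp" where
  "real_eq x y = BAnd (BNot (RLess x y)) (BNot (RLess y x))"

lemma bval_eq [simp]:
  "bval s (nat_eq x y) \<longleftrightarrow> nval s x = nval s y"
  "bval s (real_eq x' y') \<longleftrightarrow> rval s x' = rval s y'"
  by (auto simp: nat_eq_def real_eq_def)

definition on_path :: "nexp \<Rightarrow> nexp \<Rightarrow> nexp \<Rightarrow> bexp" where
  "on_path u y v =
    BAnd (nat_eq (NPlus (NGet 5 u y) (NGet 5 y v)) (NPlus (NGet 5 u v) (NConst 1)))
      (real_eq (RPlus (RGet 4 u y) (RGet 4 y v)) (RGet 4 u v))"

subsection \<open>Parameters\<close>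

text \<open>A guarded loop of n passes replaces an unbounded search, so that \<open>cost\<close>
  applies; n passes suffice since \<open>lg n \<le> n\<close>. The guard also stops the doubling at
  the first power of 2 that reaches n.\<close>

definition compute_lg :: com where
  "compute_lg = For 11 (var 0) (Cond (NLess (var 3) (var 0))
     (Seq (assign 3 (NPlus (var 3) (var 3))) (assign 2 (NPlus (var 2) (NConst 1)))) Skip)"

text \<open>The cubes are compared as reals because natural numbers have no multiplication
  here.\<close>

definition compute_rate :: com where
  "compute_rate = For 11 (var 0)
     (Cond (RLess (RTimes (RTimes (OfNat (var 4)) (OfNat (var 4))) (OfNat (var 4)))
         (RTimes (OfNat (var 0)) (OfNat (var 2))))
       (assign 4 (NPlus (var 4) (NConst 1))) Skip)"

definition compute_params :: com where
  "compute_params = Seq (Seq (assign 2 (NConst 0)) (assign 3 (NConst 1)))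
     (Seq compute_lg (Seq (assign 4 (NConst 1)) compute_rate))"

lemma writes_params [simp]:
  "nwrites compute_params = {2, 3, 4, 11}" "rwrites compute_params = {}" "\<not> draws compute_params"
  by (auto simp: compute_params_def compute_lg_def compute_rate_def)

lemma runs_compute_lg:
  assumes "k \<le> M" "nmem s 0 (0, 0) = k" "nmem s 2 (0, 0) = 0" "nmem s 3 (0, 0) = 1"
  shows "runs \<omega> M compute_lg s (\<lambda>s'. nmem s' 2 (0, 0) = lg k)"
  unfolding compute_lg_def
proof (rule runs_For[where K = k and Inv = "\<lambda>j s'. nmem s' 2 (0, 0) = min j (lg k) \<and>
    nmem s' 3 (0, 0) = 2 ^ min j (lg k)"], goal_cases)
  case (5 j s')
  have 0: "nmem s' 0 = nmem s 0" using 5(2) by (rule unchanged_nmem) simp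
  have "2 ^ min j (lg k) < k \<longleftrightarrow> j < lg k" by (simp add: two_power_less_iff_lg min_less_iff_disj)
  then show ?case using 5 assms by (intro wp_runs) (auto simp: 0 min_def)
qed (use assms lg_le[of k] in \<open>auto dest: unchanged_nmem[of _ _ _ 0]\<close>)

lemma runs_compute_rate:
  assumes "k \<le> M" "k \<ge> 1" "nmem s 0 (0, 0) = k" "nmem s 2 (0, 0) = lg k" "nmem s 4 (0, 0) = 1"
  shows "runs \<omega> M compute_rate s (\<lambda>s'. nmem s' 4 (0, 0) = rate k)"
  unfolding compute_rate_def
proof (rule runs_For[where K = k and Inv = "\<lambda>j s'. nmem s' 4 (0, 0) = min (j + 1) (rate k)"], goal_cases)
  case (5 j s')
  have 0: "nmem s' 0 = nmem s 0" "nmem s' 2 = nmem s 2" by (rule unchanged_nmem[OF 5(2)], simp)+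
  let ?m = "min (j + 1) (rate k)"
  have "real ?m * real ?m * real ?m < real k * real (lg k) \<longleftrightarrow> real (?m ^ 3) < real (k * lg k)"
    by (simp add: power3_eq_cube)
  also have "\<dots> \<longleftrightarrow> ?m ^ 3 < k * lg k" by (rule of_nat_less_iff)
  also have "\<dots> \<longleftrightarrow> ?m < rate k" using assms(2) rate_ge_1[of k] by (intro less_rate_iff) auto
  finally show ?case using 5 assms by (intro wp_runs) (auto simp: 0 min_def)
qed (use assms rate_le[of k] rate_ge_1[of k] in \<open>auto dest: unchanged_nmem[of _ _ _ 0]\<close>)

lemma runs_compute_params:
  assumes "k \<le> M" "k \<ge> 1" "nmem s 0 (0, 0) = k"
  shows "runs \<omega> M compute_params s (\<lambda>s'. nmem s' 4 (0, 0) = rate k)"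
  unfolding compute_params_def
proof (rule runs_Seq, rule wp_runs, simp, rule runs_Seq_mono, rule runs_compute_lg[OF assms(1)], goal_cases)
  case (4 s')
  have "nmem s' 0 (0, 0) = k" using 4(1) assms(3) by (auto simp: compute_lg_def dest: unchanged_nmem[of _ _ _ 0])
  then show ?case using 4 assms
    by (intro runs_Seq) (rule wp_runs, simp, rule runs_compute_rate, auto)
qed (use assms in auto)

subsection \<open>Shortest paths\<close>

text \<open>Lexicographic relaxation: a new path must be shorter, or equally long with fewer
  vertices. Disjunctions are written as negated conjunctions, and the vertex count 0 marks a pair
  without a known path.\<close>

definition relax :: com where
  "relax = (let x = var 13; y = var 14; z = var 15;
      d = RPlus (RGet 4 x y) (RGet 1 y z); h = NPlus (NGet 5 x y) (NConst 1);
      better = BNot (BAnd (BNot (RLess d (RGet 4 x z)))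
        (BNot (BAnd (BNot (RLess (RGet 4 x z) d)) (NLess h (NGet 5 x z)))))
    in Cond (BAnd (NLess (NConst 0) (NGet 1 y z)) (BAnd (NLess (NConst 0) (NGet 5 x y))
        (BNot (BAnd (NLess (NConst 0) (NGet 5 x z)) (BNot better)))))
      (Seq (RPut 4 x z d) (NPut 5 x z h)) Skip)"

definition init_paths :: com where
  "init_paths = For 13 (var 0) (NPut 5 (var 13) (var 13) (NConst 1))"

definition bellman_ford :: com where
  "bellman_ford = For 12 (var 0) (For 13 (var 0) (For 14 (var 0) (For 15 (var 0) relax)))"

lemma writes_relax [simp]: "nwrites relax = {5}" "rwrites relax = {4}" "\<not> draws relax"
  by (auto simp: relax_def Let_def)

lemma writes_bellman_ford [simp]:
  "nwrites bellman_ford = {5, 12, 13, 14, 15}" "rwrites bellman_ford = {4}" "\<not> draws bellman_ford"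
  "nwrites init_paths = {5, 13}" "rwrites init_paths = {}" "\<not> draws init_paths"
  by (auto simp: bellman_ford_def init_paths_def)

section \<open>Correctness of the shortest-path tables\<close>

context pgraph
begin

text \<open>Recorded pairs never fall lexicographically below the true ones. More cannot be said
  about unsettled entries, since updates in place may run ahead of the current round.\<close>

definition sound :: "(nat \<times> nat \<Rightarrow> nat) \<Rightarrow> (nat \<times> nat \<Rightarrow> real) \<Rightarrow> bool" where
  "sound H D \<longleftrightarrow> (\<forall>x<n. \<forall>z<n. 0 < H (x, z) \<longrightarrow>
     dist x z < D (x, z) \<or> dist x z = D (x, z) \<and> hops x z \<le> H (x, z))"

definition exact :: "(nat \<times> nat) set \<Rightarrow> state \<Rightarrow> bool" where
  "exact S s \<longleftrightarrow> sound (nmem s 5) (rmem s 4) \<and>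
     (\<forall>(x, z)\<in>S. nmem s 5 (x, z) = hops x z \<and> rmem s 4 (x, z) = dist x z)"

definition input_graph :: "state \<Rightarrow> bool" where
  "input_graph s \<longleftrightarrow> nmem s 0 (0, 0) = n \<and>
     (\<forall>u v. nmem s 1 (u, v) = (if {u, v} \<in> edges G then 1 else 0)) \<and>
     (\<forall>u v. {u, v} \<in> edges G \<longrightarrow> rmem s 1 (u, v) = elen G {u, v})"

lemma input_graph_unchanged:
  "unchanged c s s' \<Longrightarrow> input_graph s \<Longrightarrow> 0 \<notin> nwrites c \<Longrightarrow> 1 \<notin> nwrites c \<Longrightarrow> 1 \<notin> rwrites c \<Longrightarrow> input_graph s'"
  by (simp add: input_graph_def unchanged_def)

lemma exact_subset: "exact S s \<Longrightarrow> S' \<subseteq> S \<Longrightarrow> exact S' s"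
  by (auto simp: exact_def)

lemma walk_snoc:
  assumes "x < n" "{y, z} \<in> edges G"
  shows "dist x z < dist x y + elen G {y, z} \<or>
    dist x z = dist x y + elen G {y, z} \<and> hops x z \<le> hops x y + 1"
proof -
  have yz: "y < n" "z < n" using edge_bounds[OF assms(2)] by auto
  note ne = sp_nonempty[OF assms(1) yz(1)]
  have pe: "path_edges (sp x y @ [z]) = path_edges (sp x y) @ [{y, z}]"
    using path_edges_snoc[OF ne] sp_last[OF assms(1) yz(1)] by simp
  have w: "walk x z (sp x y @ [z])"
    using sp_walk[OF assms(1) yz(1)] assms(2) yz pe by (simp add: walk_def)
  have l: "path_length G (sp x y @ [z]) = dist x y + elen G {y, z}"
    by (simp add: path_length_def pe dist_def)
  show ?thesis
    using dist_le_walk[OF w] hops_le_walk[OF w] l by (auto simp: hops_def)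
qed

text \<open>If \<open>(x, y)\<close> is settled and \<open>y\<close> is the parent of
  \<open>z\<close>, then relaxing the edge offers the true pair for \<open>(x, z)\<close>, which
  soundness makes unbeatable. For the same reason settled entries are never overwritten.\<close>

lemma runs_relax:
  assumes "exact S s" "input_graph s" and c: "nmem s 13 (0, 0) = x" "nmem s 14 (0, 0) = y" "nmem s 15 (0, 0) = z"
    and x: "x < n" and S: "S \<subseteq> {..<n} \<times> {..<n}"
    and T: "T \<subseteq> S \<union> {(x, z) | z'. z' = z \<and> (x, y) \<in> S \<and> z < n \<and> x \<noteq> z \<and> y = parent x z}"
  shows "runs \<omega> M relax s (exact T)"
proof -
  let ?H = "nmem s 5" and ?D = "rmem s 4"
  let ?d = "?D (x, y) + rmem s 1 (y, z)" and ?h = "?H (x, y) + 1"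
  have snd: "sound ?H ?D" and ex: "\<And>x z. (x, z) \<in> S \<Longrightarrow> ?H (x, z) = hops x z \<and> ?D (x, z) = dist x z"
    using assms(1) by (auto simp: exact_def)
  have lower: "dist x z < ?d \<or> dist x z = ?d \<and> hops x z \<le> ?h" if "{y, z} \<in> edges G" "0 < ?H (x, y)"
  proof -
    have "y < n" using edge_bounds[OF that(1)] by blast
    then have "dist x y < ?D (x, y) \<or> dist x y = ?D (x, y) \<and> hops x y \<le> ?H (x, y)"
      using snd that(2) x by (auto simp: sound_def)
    moreover have "rmem s 1 (y, z) = elen G {y, z}" using assms(2) that(1) by (simp add: input_graph_def)
    ultimately show ?thesis using walk_snoc[OF x that(1)] by auto
  qed
  have tree: "{y, z} \<in> edges G \<and> 0 < ?H (x, y) \<and> dist x z = ?d \<and> hops x z = ?h"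
    if "(x, y) \<in> S" "z < n" "x \<noteq> z" "y = parent x z"
  proof -
    have "y < n" using S that(1) by auto
    note p = parent[OF x that(2,3), folded that(4)]
    have "rmem s 1 (y, z) = elen G {y, z}" using assms(2) p(3) by (simp add: input_graph_def)
    then show ?thesis using p(3-5) ex[OF that(1)] hops_ge_1[OF x \<open>y < n\<close>] by simp
  qed
  have ge: "hops x z \<ge> 1" if "(x, z) \<in> S" using hops_ge_1 S that by auto
  show ?thesis
  proof (rule wp_runs, cases "{y, z} \<in> edges G \<and> 0 < ?H (x, y) \<and>
      (?H (x, z) = 0 \<or> ?d < ?D (x, z) \<or> ?d = ?D (x, z) \<and> ?h < ?H (x, z))")
    case True
    have z: "z < n" using True edge_bounds by blast
    have "(x, z) \<notin> S"
    proof
      assume xz: "(x, z) \<in> S"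
      have "{y, z} \<in> edges G" "0 < ?H (x, y)" using True by auto
      from lower[OF this] have "dist x z < ?d \<or> dist x z = ?d \<and> hops x z \<le> ?h" .
      then show False using True ex[OF xz] ge[OF xz] by linarith
    qed
    let ?s = "nput 5 (x, z) ?h (rput 4 (x, z) ?d s)"
    have "exact T ?s"
      unfolding exact_def
    proof (intro conjI ballI, goal_cases)
      case 1
      show ?case using snd lower True by (auto simp: sound_def)
    next
      case (2 p)
      then have "p \<in> S \<and> p \<noteq> (x, z) \<or> p = (x, z) \<and> (x, y) \<in> S \<and> z < n \<and> x \<noteq> z \<and> y = parent x z"
        using T \<open>(x, z) \<notin> S\<close> by auto
      then show ?case using ex tree by (cases p) auto
    qed
    moreover have "wp \<omega> relax (exact T) s = exact T ?s"
      using True assms(2) c by (auto simp: relax_def Let_def input_graph_def)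
    ultimately show "wp \<omega> relax (exact T) s" by simp
  next
    case False
    have "exact T s"
      unfolding exact_def
    proof (intro conjI ballI, goal_cases)
      case (2 p)
      then have "p \<in> S \<or> p = (x, z) \<and> (x, y) \<in> S \<and> z < n \<and> x \<noteq> z \<and> y = parent x z"
        using T by auto
      then show ?case
      proof
        assume p: "p = (x, z) \<and> (x, y) \<in> S \<and> z < n \<and> x \<noteq> z \<and> y = parent x z"
        then have t: "{y, z} \<in> edges G" "0 < ?H (x, y)" "dist x z = ?d" "hops x z = ?h"
          using tree by auto
        then have "0 < ?H (x, z)" using False by auto
        then have "dist x z < ?D (x, z) \<or> dist x z = ?D (x, z) \<and> hops x z \<le> ?H (x, z)"
          using snd x p unfolding sound_def by blast
        then show ?thesis using False t p by auto
      qed (use ex in auto)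
    qed (rule snd)
    moreover have "wp \<omega> relax (exact T) s = exact T s"
      using False assms(2) c by (auto simp: relax_def Let_def input_graph_def)
    ultimately show "wp \<omega> relax (exact T) s" by simp
  qed
qed

definition near :: "nat \<Rightarrow> (nat \<times> nat) set" where
  "near k = {(x, z). x < n \<and> z < n \<and> hops x z \<le> k}"

text \<open>Round \<open>k\<close> starts with all paths of at most k + 1 vertices settled and adds
  those with k + 2. The sets \<open>?S1\<close>, \<open>?S2\<close> and \<open>?S3\<close> record
  its progress through sources, parents and children.\<close>

lemma runs_bellman_ford:
  assumes "n \<le> M" "exact (near 1) s" "input_graph s"
  shows "runs \<omega> M bellman_ford s (exact (near (n + 1)))"
  unfolding bellman_ford_def
proof (rule runs_For[where K = n and Inv = "\<lambda>k s. exact (near (k + 1)) s"], goal_cases)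
  case (3 s')
  have "nmem s' 0 = nmem s 0" by (rule unchanged_nmem[OF 3]) auto
  then show ?case using assms(3) by (simp add: input_graph_def)
next
  case (5 k s1)
  note u1 = 5(2)
  have g1: "input_graph s1" by (rule input_graph_unchanged[OF u1 assms(3)]) auto
  let ?S1 = "\<lambda>a. near (k + 1) \<union> {(x, z). x < a \<and> x < n \<and> z < n \<and> hops x z = k + 2}"
  show ?case
  proof (rule runs_For[where K = n and Inv = "\<lambda>a s. exact (?S1 a) s"], goal_cases)
    case (3 s')
    have "nmem s' 0 = nmem s1 0" by (rule unchanged_nmem[OF 3]) auto
    then show ?case using g1 by (simp add: input_graph_def)
  next
    case (4)
    show ?case using 5(4) by (simp add: exact_def)
  next
    case (5 x s2)
    note u2 = 5(2) and x = 5(1)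
    have g2: "input_graph s2" by (rule input_graph_unchanged[OF u2 g1]) auto
    let ?S2 = "\<lambda>b. ?S1 x \<union> {(x', z). x' = x \<and> z < n \<and> hops x z = k + 2 \<and> parent x z < b}"
    show ?case
    proof (rule runs_For[where K = n and Inv = "\<lambda>b s. exact (?S2 b) s \<and> nmem s 13 (0, 0) = x"], goal_cases)
      case (3 s')
      have "nmem s' 0 = nmem s2 0" by (rule unchanged_nmem[OF 3]) auto
      then show ?case using g2 by (simp add: input_graph_def)
    next
      case 4
      show ?case using 5(3,4) by (simp add: exact_def)
    next
      case (5 y s3)
      note u3 = 5(2) and y = 5(1)
      have g3: "input_graph s3" by (rule input_graph_unchanged[OF u3 g2]) auto
      let ?S3 = "\<lambda>c. ?S2 y \<union> {(x', z). x' = x \<and> z < c \<and> z < n \<and> hops x z = k + 2 \<and> parent x z = y}"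
      show ?case
      proof (rule runs_For[where K = n and Inv = "\<lambda>c s. exact (?S3 c) s \<and> nmem s 13 (0, 0) = x \<and> nmem s 14 (0, 0) = y"], goal_cases)
        case (3 s')
        have "nmem s' 0 = nmem s3 0" by (rule unchanged_nmem[OF 3]) auto
        then show ?case using g3 by (simp add: input_graph_def)
      next
        case 4
        show ?case using 5(3,4) by (simp add: exact_def)
      next
        case (5 z s4)
        note u4 = 5(2) and z = 5(1)
        have g4: "input_graph s4" by (rule input_graph_unchanged[OF u4 g3]) auto
        have "runs \<omega> M relax s4 (exact (?S3 (Suc z)))"
        proof (rule runs_relax[where S = "?S3 z" and x = x and y = y and z = z])
          show "?S3 z \<subseteq> {..<n} \<times> {..<n}" using x by (auto simp: near_def)
          have new: "(x, y) \<in> ?S3 z \<and> x \<noteq> z" if "hops x z = k + 2" "parent x z = y"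
          proof -
            have ne: "x \<noteq> z" using that(1) hops_self[OF z] by auto
            then show ?thesis using parent[OF x z ne] that y x by (simp add: near_def)
          qed
          then show "?S3 (Suc z) \<subseteq> ?S3 z \<union> {(x, z) | z'. z' = z \<and> (x, y) \<in> ?S3 z \<and> z < n \<and> x \<noteq> z \<and> y = parent x z}"
            using z by (auto simp: less_Suc_eq)
        qed (use 5 g4 x in auto)
        then show ?case
        proof (rule runs_mono, goal_cases)
          case (1 s')
          have "nmem s' 13 = nmem s4 13" "nmem s' 14 = nmem s4 14"
            by (rule unchanged_nmem[OF 1(1)], simp)+
          then show ?case using 1(2) 5(4) by (simp add: exact_def)
        qed
      next
        case (6 s')
        have "?S2 (Suc y) \<subseteq> ?S3 n" by (auto simp: less_Suc_eq)
        then have "exact (?S2 (Suc y)) s'" using 6 exact_subset by blast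
        then show ?case using 6 by (simp add: exact_def)
      qed (use assms(1) in auto)
    next
      case (6 s')
      have "?S1 (Suc x) \<subseteq> ?S2 n"
      proof -
        have "parent x z < n" if "z < n" "hops x z = k + 2" for z
          using parent(2)[OF x that(1)] that hops_self[OF x] by fastforce
        then show ?thesis by (auto simp: less_Suc_eq)
      qed
      then have "exact (?S1 (Suc x)) s'" using 6 exact_subset by blast
      then show ?case by (simp add: exact_def)
    qed (use assms(1) in auto)
  next
    case (6 s')
    have "near (Suc k + 1) \<subseteq> ?S1 n" by (auto simp: near_def)
    then have "exact (near (Suc k + 1)) s'" using 6 exact_subset by blast
    then show ?case by (simp add: exact_def)
  qed (use assms(1) in auto)
qed (use assms in \<open>auto simp: exact_def\<close>)

lemma runs_init_paths:
  assumes "n \<le> M" "nmem s 0 (0, 0) = n" "nmem s 5 = (\<lambda>_. 0)" "rmem s 4 = (\<lambda>_. 0)"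
  shows "runs \<omega> M init_paths s (exact (near 1))"
  unfolding init_paths_def
proof (rule runs_For[where K = n and Inv = "\<lambda>j s'. nmem s' 5 = (\<lambda>(x, z). if x = z \<and> x < j then 1 else 0)"], goal_cases)
  case (5 j s')
  then show ?case by (intro wp_runs) (auto simp: fun_eq_iff)
next
  case (6 s')
  have "rmem s' 4 = (\<lambda>_. 0)" using assms(4) unchanged_rmem[OF 6(1), of 4] by simp
  moreover have "x < n \<and> x = z" if "(x, z) \<in> near 1" for x z
    using that hops_eq_1_iff[of x z] hops_ge_1[of x z] by (auto simp: near_def)
  ultimately show ?case using 6(2) by (auto simp: exact_def sound_def split: if_splits)
qed (use assms in \<open>auto dest: unchanged_nmem[of _ _ _ 0]\<close>)

end

subsection \<open>One tree\<close>

definition compute_sizes :: com where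
  "compute_sizes = For 21 (var 0) (Seq (NPut 6 (var 21) (NConst 0) (NConst 0))
     (For 22 (var 0) (Cond (on_path (var 20) (var 21) (var 22))
       (NPut 6 (var 21) (NConst 0) (NPlus (NGet 6 (var 21) (NConst 0)) (NConst 1))) Skip)))"

definition init_root :: com where
  "init_root = Seq (NPut 7 (var 20) (NConst 0) (NConst 0))
     (Seq (RPut 7 (var 20) (NConst 0) (OfNat (NConst 0)))
       (Seq (RPut 8 (var 20) (NConst 0) (OfNat (NConst 0)))
         (RPut 9 (var 20) (NConst 0) (OfNat (NConst 0)))))"

text \<open>The three branches are those of \<open>cut\<close>: a light edge, a heavy edge inside a
  segment, and a completed segment. \<open>close\<close> makes the new estimate the base and starts
  an empty run. The exact weights of a run enter an estimate only together with the noise of the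
  segment.\<close>

definition update :: com where
  "update = (let p = var 24; z = var 25; o' = NConst 0;
      edge = Seq (RPut 7 z o' (RPlus (RGet 7 p o') (RGet 5 p z)));
      close = Seq (RPut 8 z o' (RGet 7 z o')) (Seq (NPut 7 z o' o') (RPut 9 z o' (OfNat o')))
    in Cond (NLess (NPlus (NGet 6 z o') (NGet 6 z o')) (NGet 6 p o'))
      (edge close)
      (Cond (RLess (RTimes (OfNat (NPlus (NGet 7 p o') (NConst 1))) (OfNat (var 9))) (OfNat (var 0)))
        (edge (Seq (RPut 8 z o' (RGet 8 p o'))
          (Seq (NPut 7 z o' (NPlus (NGet 7 p o') (NConst 1)))
            (RPut 9 z o' (RPlus (RGet 9 p o') (RGet 2 p z))))))
        (Seq (RPut 7 z o' (RPlus (RGet 8 p o') (RPlus (RPlus (RGet 9 p o') (RGet 2 p z))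
            (RTimes (RDivide (RTimes (OfNat (NConst 16)) (OfNat (var 4))) (real_var 0)) (RGet 15 z o')))))
          close)))"

text \<open>The root has level 1, so pass \<open>k\<close> of the outer loop treats the vertices of
  level k + 2.\<close>

definition update_child :: com where
  "update_child = Cond (BAnd (nat_eq (NGet 5 (var 20) (var 25)) (NPlus (var 23) (NConst 2)))
     (BAnd (nat_eq (NGet 5 (var 24) (var 25)) (NConst 2)) (on_path (var 20) (var 24) (var 25))))
     update Skip"

definition tree :: com where
  "tree = Seq compute_sizes (Seq init_root
     (For 23 (var 0) (For 24 (var 0) (For 25 (var 0) update_child))))"

lemma writes_tree [simp]:
  "nwrites compute_sizes = {6, 21, 22}" "rwrites compute_sizes = {}" "\<not> draws compute_sizes"
  "nwrites init_root = {7}" "rwrites init_root = {7, 8, 9}" "\<not> draws init_root"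
  "nwrites update_child = {7}" "rwrites update_child = {7, 8, 9}" "\<not> draws update_child"
  "nwrites tree = {6, 7, 21, 22, 23, 24, 25}" "rwrites tree = {7, 8, 9}" "\<not> draws tree"
  by (auto simp: compute_sizes_def init_root_def update_child_def update_def Let_def tree_def)

section \<open>Correctness of the computation for one tree\<close>

context pgraph
begin

definition core :: "real \<Rightarrow> attributes \<Rightarrow> state \<Rightarrow> bool" where
  "core \<epsilon> w s \<longleftrightarrow> nmem s 0 (0, 0) = n \<and> nmem s 4 (0, 0) = q \<and> rmem s 0 (0, 0) = \<epsilon> \<and>
     (\<forall>u<n. \<forall>v<n. nmem s 5 (u, v) = hops u v \<and> rmem s 4 (u, v) = dist u v \<and>
       rmem s 2 (u, v) = edge_weight w u v)"

lemma core_unchanged: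
  assumes "unchanged c s s'" "core \<epsilon> w s" "nwrites c \<inter> {0, 4, 5} = {}" "rwrites c \<inter> {0, 2, 4} = {}"
  shows "core \<epsilon> w s'"
proof -
  have "nmem s' 0 = nmem s 0" "nmem s' 4 = nmem s 4" "nmem s' 5 = nmem s 5"
    "rmem s' 0 = rmem s 0" "rmem s' 2 = rmem s 2" "rmem s' 4 = rmem s 4"
    using assms by (auto simp: unchanged_def)
  then show ?thesis using assms(2) by (simp add: core_def)
qed

lemma core_n: "core \<epsilon> w s \<Longrightarrow> nmem s 0 (0, 0) = n"
  by (simp add: core_def)

lemma bval_on_path:
  assumes "core \<epsilon> w s" "nval s x < n" "nval s y < n" "nval s z < n"
  shows "bval s (on_path x y z) \<longleftrightarrow> nval s y \<in> set (sp (nval s x) (nval s z))"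
  using assms by (simp add: on_path_def core_def on_sp_iff)

lemma runs_compute_sizes:
  assumes "n \<le> M" "core \<epsilon> w s" "nmem s 20 (0, 0) = x" "x < n"
  shows "runs \<omega> M compute_sizes s (\<lambda>s'. \<forall>z<n. nmem s' 6 (z, 0) = card (desc x z))"
  unfolding compute_sizes_def
proof (rule runs_For[where K = n and Inv = "\<lambda>j s'. \<forall>z<j. nmem s' 6 (z, 0) = card (desc x z)"], goal_cases)
  case (3 s')
  show ?case using core_n[OF core_unchanged[OF 3 assms(2)]] by simp
next
  case (5 z s1)
  have c1: "core \<epsilon> w s1" by (rule core_unchanged[OF 5(2) assms(2)]) auto
  have x1: "nmem s1 20 (0, 0) = x" using assms(3) unchanged_nmem[OF 5(2), of 20] by simp
  let ?s = "nput 6 (z, 0) 0 s1"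
  let ?D = "\<lambda>i. {v. v < i \<and> z \<in> set (sp x v)}"
  have Suc: "?D (Suc i) = (if z \<in> set (sp x i) then insert i (?D i) else ?D i)" for i
    by (auto simp: less_Suc_eq)
  have c: "core \<epsilon> w ?s" using c1 by (simp add: core_def)
  have "runs \<omega> M (For 22 (var 0) (Cond (on_path (var 20) (var 21) (var 22))
       (NPut 6 (var 21) (NConst 0) (NPlus (NGet 6 (var 21) (NConst 0)) (NConst 1))) Skip)) ?s
      (\<lambda>s'. \<forall>z'<Suc z. nmem s' 6 (z', 0) = card (desc x z'))"
  proof (rule runs_For[where K = n and Inv = "\<lambda>i s'. nmem s' 6 (z, 0) = card (?D i) \<and>
      (\<forall>z'<z. nmem s' 6 (z', 0) = card (desc x z')) \<and> nmem s' 21 (0, 0) = z"], goal_cases)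
    case (3 s')
    show ?case using core_n[OF core_unchanged[OF 3 c]] by (simp add: on_path_def)
  next
    case (4)
    show ?case using 5(3,4) by simp
  next
    case inner: (5 i s2)
    have c2: "core \<epsilon> w s2" by (rule core_unchanged[OF inner(2) c]) auto
    have "nmem s2 20 (0, 0) = x" using x1 unchanged_nmem[OF inner(2), of 20] by simp
    then have "bval s2 (on_path (var 20) (var 21) (var 22)) \<longleftrightarrow> z \<in> set (sp x i)"
      using bval_on_path[OF c2, of "var 20" "var 21" "var 22"] inner 5(1) assms(4) by simp
    then show ?case using inner(3,4) by (intro wp_runs) (auto simp: Suc)
  next
    case (6 s')
    then show ?case by (auto simp: desc_def less_Suc_eq)
  qed (use assms(1) in auto)
  then have "runs \<omega> M (For 22 (var 0) (Cond (on_path (var 20) (var 21) (var 22))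
       (NPut 6 (var 21) (NConst 0) (NPlus (NGet 6 (var 21) (NConst 0)) (NConst 1))) Skip)) ?s
      (\<lambda>s'. \<forall>z'<Suc z. nmem (nput 21 (0, 0) (Suc z) s') 6 (z', 0) = card (desc x z'))"
    by (rule runs_mono) simp
  then show ?case using 5(3) by (intro runs_Seq) (rule wp_runs, simp)
qed (use assms in auto)

definition correct :: "(nat \<Rightarrow> real) \<Rightarrow> attributes \<Rightarrow> nat \<Rightarrow> nat \<Rightarrow> nat \<Rightarrow> nat set \<Rightarrow> state \<Rightarrow> bool" where
  "correct Y w x \<mu> i S s \<longleftrightarrow> (\<forall>z\<in>S. nmem s 7 (z, 0) = card (run x \<mu> z) \<and> rmem s 7 (z, 0) = est Y x \<mu> i z \<and>
     rmem s 8 (z, 0) = base Y x \<mu> i z \<and> rmem s 9 (z, 0) = edge_sum w x (run x \<mu> z))"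

lemma correct_subset: "correct Y w x \<mu> i S s \<Longrightarrow> S' \<subseteq> S \<Longrightarrow> correct Y w x \<mu> i S' s"
  by (auto simp: correct_def)

lemma est_light:
  assumes "x < n" "z < n" "x \<noteq> z" "\<not> heavy x z"
  shows "est Y x \<mu> i z = est Y x \<mu> i (parent x z) + Y (parent x z * n + z)" "base Y x \<mu> i z = est Y x \<mu> i z"
proof -
  note p = parent(2)[OF assms(1-3)]
  have "finite (raw x \<mu> (parent x z))" "finite (run x \<mu> (parent x z))" using assms(1) p by simp_all
  then show "est Y x \<mu> i z = est Y x \<mu> i (parent x z) + Y (parent x z * n + z)"
    using raw_run_disjoint[OF assms(1) p, of \<mu>] cut_notin_parent[OF assms(1-3), of \<mu>]
    by (simp add: est_def base_def cut_light[OF assms] sum.union_disjoint)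
  show "base Y x \<mu> i z = est Y x \<mu> i z" by (simp add: est_def cut_light[OF assms])
qed

lemma est_heavy:
  assumes "x < n" "z < n" "x \<noteq> z" "heavy x z" "\<not> is_end x \<mu> z"
  shows "est Y x \<mu> i z = est Y x \<mu> i (parent x z) + Y (parent x z * n + z)"
    "base Y x \<mu> i z = base Y x \<mu> i (parent x z)"
    "card (run x \<mu> z) = card (run x \<mu> (parent x z)) + 1"
    "edge_sum w x (run x \<mu> z) = edge_sum w x (run x \<mu> (parent x z)) + w {parent x z, z}"
  using cut_notin_parent[OF assms(1-3), of \<mu>] parent(2)[OF assms(1-3)] assms(1)
  by (simp_all add: est_def base_def edge_sum_def cut_heavy[OF assms])

lemma est_end:
  assumes "x < n" "z < n" "is_end x \<mu> z"
  shows "est Y x \<mu> i z = base Y x \<mu> i (parent x z) + Y (i + z)" "base Y x \<mu> i z = est Y x \<mu> i z"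
    "edge_sum w x (segment x \<mu> z) = edge_sum w x (run x \<mu> (parent x z)) + w {parent x z, z}"
proof -
  have "x \<noteq> z" using assms(3) by (simp add: is_end_def)
  note p = parent(2)[OF assms(1,2) this] cut_notin_parent[OF assms(1,2) this, of \<mu>]
  show "est Y x \<mu> i z = base Y x \<mu> i (parent x z) + Y (i + z)" "base Y x \<mu> i z = est Y x \<mu> i z"
    "edge_sum w x (segment x \<mu> z) = edge_sum w x (run x \<mu> (parent x z)) + w {parent x z, z}"
    using p assms(1) by (simp_all add: est_def base_def edge_sum_def segment_def cut_end[OF assms])
qed

text \<open>Noisy edges are already in memory, whereas the noisy value of a segment is assembled
  during the traversal from exact weights and a stored sample. Keeping \<open>Y\<close>,
  \<open>\<mu>\<close> and the offset abstract lets one proof serve short paths and all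
  trees.\<close>

definition tree_input :: "(nat \<Rightarrow> real) \<Rightarrow> real \<Rightarrow> attributes \<Rightarrow> nat \<Rightarrow> nat \<Rightarrow> nat \<Rightarrow> state \<Rightarrow> bool" where
  "tree_input Y \<epsilon> w x \<mu> i s \<longleftrightarrow> core \<epsilon> w s \<and> x < n \<and> nmem s 20 (0, 0) = x \<and> nmem s 9 (0, 0) = \<mu> \<and>
     (\<forall>u<n. \<forall>v<n. rmem s 5 (u, v) = Y (u * n + v)) \<and>
     (\<forall>z<n. is_end x \<mu> z \<longrightarrow>
       Y (i + z) = edge_sum w x (segment x \<mu> z) + 16 * real q / \<epsilon> * rmem s 15 (z, 0))"

lemma tree_input_unchanged:
  assumes "unchanged c s s'" "tree_input Y \<epsilon> w x \<mu> i s" "nwrites c \<inter> {0, 4, 5, 9, 20} = {}"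
    "rwrites c \<inter> {0, 2, 4, 5, 15} = {}"
  shows "tree_input Y \<epsilon> w x \<mu> i s'"
proof -
  have "core \<epsilon> w s'" using core_unchanged[OF assms(1), of \<epsilon> w] assms by (auto simp: tree_input_def)
  moreover have "nmem s' 9 = nmem s 9" "nmem s' 20 = nmem s 20" "rmem s' 5 = rmem s 5" "rmem s' 15 = rmem s 15"
    using assms by (auto simp: unchanged_def)
  ultimately show ?thesis using assms(2) by (simp add: tree_input_def)
qed

lemma runs_update_child:
  assumes ti: "tree_input Y \<epsilon> w x \<mu> i s" and sz: "\<forall>z<n. nmem s 6 (z, 0) = card (desc x z)"
    and ok: "correct Y w x \<mu> i S s"
    and c: "nmem s 23 (0, 0) = k" "nmem s 24 (0, 0) = p" "nmem s 25 (0, 0) = z" "p < n" "z < n"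
    and S: "\<And>z. z < n \<Longrightarrow> hops x z \<le> k + 1 \<Longrightarrow> z \<in> S"
    and T: "T \<subseteq> S \<union> {z' . z' = z \<and> hops x z = k + 2 \<and> parent x z = p}"
  shows "runs \<omega> M update_child s (correct Y w x \<mu> i T)"
proof -
  have core: "core \<epsilon> w s" and x: "x < n" and sx: "nmem s 20 (0, 0) = x" and s\<mu>: "nmem s 9 (0, 0) = \<mu>"
    and Y5: "\<And>u v. u < n \<Longrightarrow> v < n \<Longrightarrow> rmem s 5 (u, v) = Y (u * n + v)"
    and Y15: "\<And>z. z < n \<Longrightarrow> is_end x \<mu> z \<Longrightarrow>
       Y (i + z) = edge_sum w x (segment x \<mu> z) + 16 * real q / \<epsilon> * rmem s 15 (z, 0)"
    using ti by (auto simp: tree_input_def)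
  have co: "nmem s 0 (0, 0) = n" "nmem s 4 (0, 0) = q" "rmem s 0 (0, 0) = \<epsilon>"
    "\<And>u v. u < n \<Longrightarrow> v < n \<Longrightarrow> nmem s 5 (u, v) = hops u v"
    "\<And>u v. u < n \<Longrightarrow> v < n \<Longrightarrow> rmem s 2 (u, v) = edge_weight w u v"
    using core by (auto simp: core_def)
  have on: "bval s (on_path (var 20) (var 24) (var 25)) \<longleftrightarrow> p \<in> set (sp x z)"
    using bval_on_path[OF core, of "var 20" "var 24" "var 25"] c x sx by simp
  let ?c = "hops x z = k + 2 \<and> x \<noteq> z \<and> p = parent x z"
  have cond: "hops x z = k + 2 \<and> hops p z = 2 \<and> p \<in> set (sp x z) \<longleftrightarrow> ?c"
    using parent_iff[OF x c(5,4)] by blast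
  show ?thesis
  proof (rule wp_runs, cases ?c)
    case False
    have "x \<noteq> z" if "hops x z = k + 2" using that hops_self[OF x] by auto
    then have "T \<subseteq> S" using False T by auto
    then have "correct Y w x \<mu> i T s" by (rule correct_subset[OF ok])
    moreover have "wp \<omega> update_child (correct Y w x \<mu> i T) s = correct Y w x \<mu> i T s"
      using False cond by (auto simp: update_child_def on co c x sx)
    ultimately show "wp \<omega> update_child (correct Y w x \<mu> i T) s" by simp
  next
    case True
    then have xz: "x \<noteq> z" and p: "p = parent x z" by auto
    note par = parent[OF x c(5) xz, folded p]
    have pS: "p \<in> S" using S[OF c(4)] par(4) True by simp
    have ne: "p \<noteq> z" using par(4) by auto
    have P: "nmem s 7 (p, 0) = card (run x \<mu> p)" "rmem s 7 (p, 0) = est Y x \<mu> i p"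
      "rmem s 8 (p, 0) = base Y x \<mu> i p" "rmem s 9 (p, 0) = edge_sum w x (run x \<mu> p)"
      using ok pS by (auto simp: correct_def)
    have new: "correct Y w x \<mu> i T s'"
      if "nmem s' 7 = (nmem s 7)((z, 0) := card (run x \<mu> z))"
        "rmem s' 7 = (rmem s 7)((z, 0) := est Y x \<mu> i z)"
        "rmem s' 8 = (rmem s 8)((z, 0) := base Y x \<mu> i z)"
        "rmem s' 9 = (rmem s 9)((z, 0) := edge_sum w x (run x \<mu> z))" for s'
      using ok T that by (auto simp: correct_def)
    have e: "edge_weight w p z = w {p, z}" using par(3) by (simp add: edge_weight_def)
    have wp: "wp \<omega> update_child Q s = wp \<omega> update Q s" for Q
      using True cond co(4)[OF c(4,5)] co(4)[OF x c(5)] by (simp add: update_child_def on c sx)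
    have hv: "nmem s 6 (z, 0) + nmem s 6 (z, 0) < nmem s 6 (p, 0) \<longleftrightarrow> \<not> heavy x z"
      using sz c by (auto simp: heavy_def p)
    have nd: "real (card (run x \<mu> p) + 1) * real \<mu> < real n \<longleftrightarrow> \<not> n \<le> (card (run x \<mu> p) + 1) * \<mu>"
      by (simp only: of_nat_mult[symmetric] of_nat_less_iff not_le)
    show "wp \<omega> update_child (correct Y w x \<mu> i T) s"
    proof (cases "heavy x z")
      case False
      note E = est_light[OF x c(5) xz False, of Y \<mu> i] cut_light(2)[OF x c(5) xz False, of \<mu>]
      show ?thesis unfolding wp update_def Let_def wp.simps bval.simps nval.simps c hv
        using False E P Y5[OF c(4,5)] ne
        by (simp add: c hv) (rule new, simp_all add: p edge_sum_def)
    next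
      case heavy: True
      show ?thesis
      proof (cases "is_end x \<mu> z")
        case False
        note E = est_heavy[OF x c(5) xz heavy False]
        have "\<not> n \<le> (card (run x \<mu> p) + 1) * \<mu>" using False xz heavy by (simp add: is_end_def p)
        then show ?thesis unfolding wp update_def Let_def
          using heavy E P Y5[OF c(4,5)] ne nd e co(5)[OF c(4,5)] hv
          by (simp add: c co s\<mu>) (rule new, simp_all add: p)
      next
        case True
        note E = est_end[OF x c(5) True] cut_end(2)[OF x c(5) True] Y15[OF c(5) True]
        have "n \<le> (card (run x \<mu> p) + 1) * \<mu>" using True by (simp add: is_end_def p)
        then show ?thesis unfolding wp update_def Let_def
          using heavy E P Y5[OF c(4,5)] ne nd e co(5)[OF c(4,5)] hv
          by (simp add: c co s\<mu>) (rule new, simp_all add: p edge_sum_def)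
      qed
    qed
  qed
qed

text \<open>Vertices are treated level by level, so the entries of a parent are final before its
  children read them.\<close>

lemma runs_tree_levels:
  assumes M: "n \<le> M" and ti: "tree_input Y \<epsilon> w x \<mu> i s" and sz: "\<forall>z<n. nmem s 6 (z, 0) = card (desc x z)"
    and ok: "correct Y w x \<mu> i {x} s"
  shows "runs \<omega> M (For 23 (var 0) (For 24 (var 0) (For 25 (var 0) update_child))) s (correct Y w x \<mu> i {..<n})"
proof (rule runs_For[where K = n and Inv = "\<lambda>k s. correct Y w x \<mu> i {z. z < n \<and> hops x z \<le> k + 1} s"], goal_cases)
  case (3 s')
  then show ?case using tree_input_unchanged[OF 3 ti] by (simp add: tree_input_def core_def)
next
  case 4
  have x: "x < n" using ti by (simp add: tree_input_def)
  have "{z. z < n \<and> hops x z \<le> 0 + 1} \<subseteq> {x}"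
    using hops_eq_1_iff[OF x] hops_ge_1[OF x] by (force simp: le_Suc_eq)
  then have "correct Y w x \<mu> i {z. z < n \<and> hops x z \<le> 0 + 1} s" by (rule correct_subset[OF ok])
  then show ?case by (simp add: correct_def)
next
  case (5 k s1)
  have t1: "tree_input Y \<epsilon> w x \<mu> i s1" by (rule tree_input_unchanged[OF 5(2) ti]) auto
  have z1: "\<forall>z<n. nmem s1 6 (z, 0) = card (desc x z)" using sz unchanged_nmem[OF 5(2), of 6] by simp
  have x: "x < n" using ti by (simp add: tree_input_def)
  let ?S1 = "\<lambda>b. {z. z < n \<and> (hops x z \<le> k + 1 \<or> hops x z = k + 2 \<and> parent x z < b)}"
  show ?case
  proof (rule runs_For[where K = n and Inv = "\<lambda>b s. correct Y w x \<mu> i (?S1 b) s \<and> nmem s 23 (0, 0) = k"], goal_cases)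
    case (3 s')
    then show ?case using tree_input_unchanged[OF 3 t1] by (simp add: tree_input_def core_def)
  next
    case 4
    show ?case using 5(3,4) by (simp add: correct_def)
  next
    case (5 p s2)
    note p = 5(1)
    have t2: "tree_input Y \<epsilon> w x \<mu> i s2" by (rule tree_input_unchanged[OF 5(2) t1]) auto
    have z2: "\<forall>z<n. nmem s2 6 (z, 0) = card (desc x z)" using z1 unchanged_nmem[OF 5(2), of 6] by simp
    let ?S2 = "\<lambda>c. ?S1 p \<union> {z. z < n \<and> z < c \<and> hops x z = k + 2 \<and> parent x z = p}"
    show ?case
    proof (rule runs_For[where K = n and Inv = "\<lambda>c s. correct Y w x \<mu> i (?S2 c) s \<and>
        nmem s 23 (0, 0) = k \<and> nmem s 24 (0, 0) = p"], goal_cases)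
      case (3 s')
      then show ?case using tree_input_unchanged[OF 3 t2] by (simp add: tree_input_def core_def)
    next
      case 4
      show ?case using 5(3,4) by (simp add: correct_def)
    next
      case (5 z s3)
      have t3: "tree_input Y \<epsilon> w x \<mu> i s3" by (rule tree_input_unchanged[OF 5(2) t2]) auto
      have z3: "\<forall>z<n. nmem s3 6 (z, 0) = card (desc x z)" using z2 unchanged_nmem[OF 5(2), of 6] by simp
      have "runs \<omega> M update_child s3 (correct Y w x \<mu> i (?S2 (Suc z)))"
        by (rule runs_update_child[OF t3 z3, where S = "?S2 z" and k = k and p = p and z = z])
          (use 5 p in \<open>auto simp: less_Suc_eq\<close>)
      then show ?case
      proof (rule runs_mono, goal_cases)
        case (1 s')
        have "nmem s' 23 = nmem s3 23" "nmem s' 24 = nmem s3 24"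
          by (rule unchanged_nmem[OF 1(1)], simp)+
        then show ?case using 1(2) 5(4) by (simp add: correct_def)
      qed
    next
      case (6 s')
      have "?S1 (Suc p) \<subseteq> ?S2 n" by (auto simp: less_Suc_eq)
      then have "correct Y w x \<mu> i (?S1 (Suc p)) s'" using 6 correct_subset by blast
      then show ?case using 6 by (simp add: correct_def)
    qed (use M in auto)
  next
    case (6 s')
    have "{z. z < n \<and> hops x z \<le> Suc k + 1} \<subseteq> ?S1 n"
    proof -
      have "parent x z < n" if "z < n" "hops x z = k + 2" for z
        using parent(2)[OF x that(1)] that hops_self[OF x] by fastforce
      then show ?thesis by (auto simp: le_Suc_eq)
    qed
    then have "correct Y w x \<mu> i {z. z < n \<and> hops x z \<le> Suc k + 1} s'" using 6 correct_subset by blast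
    then show ?case by (simp add: correct_def)
  qed (use M in auto)
next
  case (6 s')
  have x: "x < n" using ti by (simp add: tree_input_def)
  have "{..<n} \<subseteq> {z. z < n \<and> hops x z \<le> n + 1}" using hops_le_n[OF x] by (auto intro: le_SucI)
  then show ?case using 6 correct_subset by blast
qed (use M in auto)

lemma runs_tree:
  assumes M: "n \<le> M" and ti: "tree_input Y \<epsilon> w x \<mu> i s"
  shows "runs \<omega> M tree s (\<lambda>s'. \<forall>z<n. rmem s' 7 (z, 0) = est Y x \<mu> i z)"
  unfolding tree_def
proof (rule runs_Seq_mono, rule runs_compute_sizes[OF M])
  show "core \<epsilon> w s" "nmem s 20 (0, 0) = x" "x < n" using ti by (auto simp: tree_input_def)
  fix s1 assume u: "unchanged compute_sizes s s1" and sz: "\<forall>z<n. nmem s1 6 (z, 0) = card (desc x z)"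
  have t1: "tree_input Y \<epsilon> w x \<mu> i s1" by (rule tree_input_unchanged[OF u ti]) auto
  then have x1: "nmem s1 20 (0, 0) = x" by (simp add: tree_input_def)
  let ?s = "rput 9 (x, 0) 0 (rput 8 (x, 0) 0 (rput 7 (x, 0) 0 (nput 7 (x, 0) 0 s1)))"
  have t: "tree_input Y \<epsilon> w x \<mu> i ?s" using t1 by (simp add: tree_input_def core_def)
  have ok: "correct Y w x \<mu> i {x} ?s" by (simp add: correct_def est_def base_def edge_sum_def)
  have "runs \<omega> M (For 23 (var 0) (For 24 (var 0) (For 25 (var 0) update_child))) ?s (correct Y w x \<mu> i {..<n})"
    by (rule runs_tree_levels[OF M t _ ok]) (use sz in simp)
  then have "runs \<omega> M (For 23 (var 0) (For 24 (var 0) (For 25 (var 0) update_child))) ?s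
      (\<lambda>s'. \<forall>z<n. rmem s' 7 (z, 0) = est Y x \<mu> i z)"
    by (rule runs_mono) (simp add: correct_def)
  then show "runs \<omega> M (Seq init_root (For 23 (var 0) (For 24 (var 0) (For 25 (var 0) update_child)))) s1
      (\<lambda>s'. \<forall>z<n. rmem s' 7 (z, 0) = est Y x \<mu> i z)"
    by (intro runs_Seq wp_runs) (simp add: init_root_def x1)
qed

end

subsection \<open>The complete program\<close>

definition sample_laplace :: com where
  "sample_laplace = (let u = real_var 6; one = OfNat (NConst 1); two = OfNat (NConst 2);
      put = RPut 6 (NConst 0) (NConst 0)
    in Seq (Sample 6 (NConst 0) (NConst 0)) (Cond (RLess u (RDivide one two))
      (put (RLn (RTimes two u)))
      (put (RMinus (OfNat (NConst 0)) (RLn (RTimes two (RMinus one u)))))))"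

abbreviation For2 :: "com \<Rightarrow> com" where
  "For2 c \<equiv> For 32 (var 0) (For 33 (var 0) c)"

definition noisy_edges :: com where
  "noisy_edges = For2 (Seq sample_laplace (RPut 5 (var 32) (var 33)
     (RPlus (RGet 2 (var 32) (var 33)) (RTimes (RDivide (OfNat (NConst 4)) (real_var 0)) (real_var 6)))))"

definition short_paths :: com where
  "short_paths = For 20 (var 0) (Seq tree
     (For 21 (var 0) (RPut 10 (var 20) (var 21) (RGet 7 (var 21) (NConst 0)))))"

definition factor_exp :: "nat \<Rightarrow> rexp" where
  "factor_exp k = RTimes (RDivide (OfNat (NConst 1)) (OfNat (NConst k)))
     (RDivide (RTimes (OfNat (NConst 2)) (OfNat (var 0)))
       (RMinus (RTimes (OfNat (NConst 2)) (OfNat (var 0))) (OfNat (NGet 5 (var 32) (var 33)))))"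

definition init_weights :: com where
  "init_weights = For2 (RPut 12 (var 32) (var 33) (OfNat (NConst 1)))"

definition compute_score :: com where
  "compute_score = (let add = (\<lambda>k. RPut 13 (NConst 0) (NConst 0)
      (RPlus (real_var 13) (RTimes (factor_exp k) (RGet 12 (var 32) (var 33)))))
    in For2 (Cond (on_path (var 32) (var 31) (var 33)) (add 2) (add 1)))"

text \<open>The first candidate is accepted unconditionally because the cell of the best score may
  still hold the value of the previous round.\<close>

definition select_root :: com where
  "select_root = For 31 (var 0) (Seq (RPut 13 (NConst 0) (NConst 0) (OfNat (NConst 0))) (Seq compute_score
     (Cond (BNot (BAnd (BNot (NLess (var 31) (NConst 1))) (BNot (RLess (real_var 13) (real_var 14)))))
       (Seq (RPut 14 (NConst 0) (NConst 0) (real_var 13)) (assign 34 (var 31))) Skip)))"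

definition segment_noise :: com where
  "segment_noise = For 21 (var 0) (Seq sample_laplace (RPut 15 (var 21) (NConst 0) (real_var 6)))"

definition accumulate :: com where
  "accumulate = For2 (Cond (on_path (var 32) (var 20) (var 33))
     (Seq (RPut 11 (var 32) (var 33) (RPlus (RGet 11 (var 32) (var 33))
         (RPlus (RGet 7 (var 32) (NConst 0)) (RGet 7 (var 33) (NConst 0)))))
       (NPut 8 (var 32) (var 33) (NPlus (NGet 8 (var 32) (var 33)) (NConst 1)))) Skip)"

definition update_weights :: com where
  "update_weights = (let put = (\<lambda>k. RPut 12 (var 32) (var 33) (RTimes (factor_exp k) (RGet 12 (var 32) (var 33))))
    in For2 (Cond (on_path (var 32) (var 20) (var 33)) (put 2) (put 1)))"

definition long_paths :: com where
  "long_paths = For 30 (let double = (\<lambda>x. NPlus x x) in double (double (double (var 4))))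
     (Seq select_root (Seq (assign 20 (var 34)) (Seq segment_noise (Seq tree (Seq accumulate update_weights)))))"

definition write_output :: com where
  "write_output = For2 (Cond (RLess (OfNat (NGet 5 (var 32) (var 33))) (RTimes (OfNat (var 4)) (OfNat (var 4))))
     (RPut 3 (var 32) (var 33) (RGet 10 (var 32) (var 33)))
     (RPut 3 (var 32) (var 33) (RDivide (RGet 11 (var 32) (var 33)) (OfNat (NGet 8 (var 32) (var 33))))))"

definition program :: com where
  "program = Seq compute_params (Seq init_paths (Seq bellman_ford (Seq noisy_edges
     (Seq short_paths (Seq (assign 9 (var 4)) (Seq init_weights (Seq long_paths write_output)))))))"

lemma writes_sample [simp]:
  "nwrites sample_laplace = {}" "rwrites sample_laplace = {6}" "draws sample_laplace"
  by (simp_all add: sample_laplace_def Let_def)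

lemma writes_phases [simp]:
  "nwrites noisy_edges = {32, 33}" "rwrites noisy_edges = {5, 6}"
  "nwrites short_paths = {6, 7, 20, 21, 22, 23, 24, 25}" "rwrites short_paths = {7, 8, 9, 10}" "\<not> draws short_paths"
  "nwrites init_weights = {32, 33}" "rwrites init_weights = {12}" "\<not> draws init_weights"
  "nwrites compute_score = {32, 33}" "rwrites compute_score = {13}" "\<not> draws compute_score"
  "nwrites select_root = {31, 32, 33, 34}" "rwrites select_root = {13, 14}" "\<not> draws select_root"
  "nwrites segment_noise = {21}" "rwrites segment_noise = {6, 15}"
  "nwrites accumulate = {8, 32, 33}" "rwrites accumulate = {11}" "\<not> draws accumulate"
  "nwrites update_weights = {32, 33}" "rwrites update_weights = {12}" "\<not> draws update_weights"
  "nwrites long_paths = {6, 7, 8, 20, 21, 22, 23, 24, 25, 30, 31, 32, 33, 34}"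
  "rwrites long_paths = {6, 7, 8, 9, 11, 12, 13, 14, 15}"
proof -
  show sc: "nwrites compute_score = {32, 33}" "rwrites compute_score = {13}" "\<not> draws compute_score"
    by (auto simp: compute_score_def Let_def)
  show sel: "nwrites select_root = {31, 32, 33, 34}" "rwrites select_root = {13, 14}" "\<not> draws select_root"
    by (auto simp: select_root_def sc)
  show ph: "nwrites segment_noise = {21}" "rwrites segment_noise = {6, 15}"
    "nwrites accumulate = {8, 32, 33}" "rwrites accumulate = {11}" "\<not> draws accumulate"
    "nwrites update_weights = {32, 33}" "rwrites update_weights = {12}" "\<not> draws update_weights"
    by (auto simp: segment_noise_def accumulate_def update_weights_def Let_def)
  show "nwrites long_paths = {6, 7, 8, 20, 21, 22, 23, 24, 25, 30, 31, 32, 33, 34}"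
    "rwrites long_paths = {6, 7, 8, 9, 11, 12, 13, 14, 15}"
    by (auto simp: long_paths_def sel ph)
qed (auto simp: noisy_edges_def short_paths_def init_weights_def)

section \<open>Correctness of the phases and of the whole program\<close>

lemma rput_rput: "rput a p y ((rput a p x s)\<lparr>used := k\<rparr>) = (rput a p y s)\<lparr>used := k\<rparr>"
  by (simp add: rput_def)

lemma wp_sample_laplace:
  "wp \<omega> sample_laplace Q s = Q ((rput 6 (0, 0) (lapl (\<omega> (used s))) s)\<lparr>used := used s + 1\<rparr>)"
  by (simp add: sample_laplace_def Let_def lapl_def rput_rput)

text \<open>The premise \<open>row\<close> identifies the end of a row with the beginning of the
  next one, so one invariant indexed by the current position serves both loops.\<close>

lemma runs_For2:
  assumes M: "K \<le> M" and K: "nmem s 0 (0, 0) = K" and c: "0 \<notin> nwrites c" "32 \<notin> nwrites c" "33 \<notin> nwrites c"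
    and init: "Inv 0 0 s"
    and stable: "\<And>i a b s x. i = 32 \<or> i = 33 \<Longrightarrow> Inv a b s \<Longrightarrow> Inv a b (nput i (0, 0) x s)"
    and body: "\<And>a b s'. a < K \<Longrightarrow> b < K \<Longrightarrow> unchanged (For2 c) s s' \<Longrightarrow> nmem s' 32 (0, 0) = a \<Longrightarrow>
      nmem s' 33 (0, 0) = b \<Longrightarrow> Inv a b s' \<Longrightarrow> runs \<omega> M c s' (Inv a (Suc b))"
    and row: "\<And>a s'. a < K \<Longrightarrow> Inv a K s' \<Longrightarrow> Inv (Suc a) 0 s'"
    and post: "\<And>s'. unchanged (For2 c) s s' \<Longrightarrow> Inv K 0 s' \<Longrightarrow> Q s'"
  shows "runs \<omega> M (For2 c) s Q"
proof (rule runs_For[where K = K and Inv = "\<lambda>a s. Inv a 0 s"], goal_cases)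
  case (3 s')
  then show ?case using c K unchanged_nmem[OF 3, of 0] by simp
next
  case (5 a s1)
  have s1: "nmem s1 0 = nmem s 0" using c unchanged_nmem[OF 5(2), of 0] by simp
  show ?case
  proof (rule runs_For[where K = K and Inv = "\<lambda>b s. Inv a b s \<and> nmem s 32 (0, 0) = a"], goal_cases)
    case (3 s')
    then show ?case using c K unchanged_nmem[OF 3, of 0] s1 by simp
  next
    case 4
    then show ?case using stable 5 by simp
  next
    case inner: (5 b s2)
    have "unchanged (For2 c) s1 s2" using inner(2) by (auto simp: unchanged_def)
    then have "unchanged (For2 c) s s2" by (rule unchanged_trans[OF 5(2)])
    then have "runs \<omega> M c s2 (Inv a (Suc b))" using body 5 inner by simp
    then show ?case
    proof (rule runs_mono, goal_cases)
      case (1 s3)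
      then show ?case using stable inner(4) c unchanged_nmem[OF 1(1), of 32] by simp
    qed
  next
    case (6 s')
    then show ?case using stable row 5(1) by blast
  qed (use M c in auto)
qed (use M c init stable post in auto)

context pgraph
begin

definition visited :: "nat \<Rightarrow> nat \<Rightarrow> (nat \<times> nat) set" where
  "visited a b = {(u, v). u < a \<and> v < n \<or> u = a \<and> v < b}"

lemma visited_simps:
  "visited 0 0 = {}" "visited a (Suc b) = insert (a, b) (visited a b)" "visited a n = visited (Suc a) 0"
  "visited n 0 = {..<n} \<times> {..<n}" "(a, b) \<notin> visited a b"
  by (auto simp: visited_def less_Suc_eq)

lemma finite_visited: "finite (visited a b)"
  by (rule finite_subset[of _ "{..a} \<times> {..<n + b}"]) (auto simp: visited_def)

text \<open>Sampling proceeds row by row, so the number of samples used so far is the index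
  \<open>u * n + v\<close> of the value being formed.\<close>

lemma runs_noisy_edges:
  assumes M: "n \<le> M" and core: "core \<epsilon> w s" and used: "used s = 0"
  shows "runs \<omega> M noisy_edges s (\<lambda>s'. used s' = n * n \<and>
    (\<forall>u<n. \<forall>v<n. rmem s' 5 (u, v) = noisy \<epsilon> w \<omega> (u * n + v)))"
  unfolding noisy_edges_def
proof (rule runs_For2[OF M core_n[OF core], where Inv = "\<lambda>a b s'. used s' = a * n + b \<and>
    (\<forall>(u, v)\<in>visited a b. rmem s' 5 (u, v) = noisy \<epsilon> w \<omega> (u * n + v))"], goal_cases)
  case (6 a b s')
  have c: "core \<epsilon> w s'" by (rule core_unchanged[OF 6(3) core]) auto
  show ?case using c 6 noisy_edge[of a b \<epsilon> w \<omega>]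
    by (intro wp_runs) (auto simp: wp_sample_laplace core_def visited_simps)
qed (use used in \<open>auto simp: visited_simps\<close>)

lemma runs_short_paths:
  assumes M: "n \<le> M" and core: "core \<epsilon> w s" and \<mu>: "nmem s 9 (0, 0) = 0"
    and Y: "\<And>u v. u < n \<Longrightarrow> v < n \<Longrightarrow> rmem s 5 (u, v) = Y (u * n + v)"
  shows "runs \<omega> M short_paths s (\<lambda>s'. \<forall>u<n. \<forall>v<n. rmem s' 10 (u, v) = est Y u 0 0 v)"
  unfolding short_paths_def
proof (rule runs_For[where K = n and Inv = "\<lambda>a s'. \<forall>u<a. \<forall>v<n. rmem s' 10 (u, v) = est Y u 0 0 v"], goal_cases)
  case (3 s')
  show ?case using core_n[OF core_unchanged[OF 3 core]] by simp
next
  case (5 x s1)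
  have c1: "core \<epsilon> w s1" by (rule core_unchanged[OF 5(2) core]) auto
  \<comment> \<open>With multiplier 0 no vertex ends a segment, so the condition on the segment
    samples holds vacuously.\<close>
  have ti: "tree_input Y \<epsilon> w x 0 0 s1"
    using c1 5(1,3) \<mu> Y unchanged_nmem[OF 5(2), of 9] unchanged_rmem[OF 5(2), of 5] n_pos
    by (simp add: tree_input_def is_end_def)
  show ?case
  proof (rule runs_Seq_mono[OF runs_tree[OF M ti]], goal_cases)
    case (1 s2)
    have c2: "core \<epsilon> w s2" by (rule core_unchanged[OF 1(1) c1]) auto
    have s2: "nmem s2 20 (0, 0) = x" "rmem s2 10 = rmem s1 10"
      using 5(3) unchanged_nmem[OF 1(1), of 20] unchanged_rmem[OF 1(1), of 10] by auto
    show ?case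
    proof (rule runs_For[where K = n and Inv = "\<lambda>b s'. (\<forall>u<x. \<forall>v<n. rmem s' 10 (u, v) = est Y u 0 0 v) \<and>
        (\<forall>v<b. rmem s' 10 (x, v) = est Y x 0 0 v)"], goal_cases)
      case (3 s')
      show ?case using core_n[OF core_unchanged[OF 3 c2]] by simp
    next
      case 4
      then show ?case using s2 5(4) by simp
    next
      case inner: (5 b s3)
      have "nmem s3 20 = nmem s2 20" "rmem s3 7 = rmem s2 7"
        using unchanged_nmem[OF inner(2), of 20] unchanged_rmem[OF inner(2), of 7] by auto
      then show ?case using inner s2 1(2) by (intro wp_runs) (auto simp: less_Suc_eq)
    next
      case (6 s')
      then show ?case by (auto simp: less_Suc_eq)
    qed (use M in auto)
  qed
qed (use M in auto)

lemma rval_factor: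
  assumes "core \<epsilon> w s" "nmem s 32 (0, 0) = u" "nmem s 33 (0, 0) = v" "u < n" "v < n"
  shows "rval s (factor_exp (if y \<in> set (sp u v) then 2 else 1)) = factor y u v"
proof -
  have "2 * real n - real (hops u v) > 0" using hops_le_n[OF assms(4,5)] n_pos by simp
  then show ?thesis using assms by (simp add: factor_exp_def factor_def core_def field_simps)
qed

lemma runs_init_weights:
  assumes M: "n \<le> M" and core: "core \<epsilon> w s"
  shows "runs \<omega> M init_weights s (\<lambda>s'. \<forall>u<n. \<forall>v<n. rmem s' 12 (u, v) = 1)"
  unfolding init_weights_def
proof (rule runs_For2[OF M core_n[OF core], where Inv = "\<lambda>a b s'. \<forall>(u, v)\<in>visited a b. rmem s' 12 (u, v) = 1"], goal_cases)
  case (6 a b s')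
  then show ?case by (intro wp_runs) (auto simp: visited_simps)
qed (auto simp: visited_simps)

lemma runs_compute_score:
  assumes M: "n \<le> M" and core: "core \<epsilon> w s" and y: "nmem s 31 (0, 0) = y" "y < n"
    and W: "\<And>u v. u < n \<Longrightarrow> v < n \<Longrightarrow> rmem s 12 (u, v) = W (u, v)" and 0: "rmem s 13 (0, 0) = 0"
  shows "runs \<omega> M compute_score s (\<lambda>s'. rmem s' 13 (0, 0) = score W y)"
  unfolding compute_score_def Let_def
proof (rule runs_For2[OF M core_n[OF core], where Inv = "\<lambda>a b s'.
    rmem s' 13 (0, 0) = (\<Sum>(u, v)\<in>visited a b. factor y u v * W (u, v))"], goal_cases)
  case (6 a b s')
  have c: "core \<epsilon> w s'" by (rule core_unchanged[OF 6(3) core]) auto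
  have s': "nmem s' 31 (0, 0) = y" "rmem s' 12 (a, b) = W (a, b)"
    using 6 y W unchanged_nmem[OF 6(3), of 31] unchanged_rmem[OF 6(3), of 12] by auto
  have on: "bval s' (on_path (var 32) (var 31) (var 33)) \<longleftrightarrow> y \<in> set (sp a b)"
    using bval_on_path[OF c, of "var 32" "var 31" "var 33"] 6 s' y by simp
  show ?case using 6 s' on rval_factor[OF c 6(4,5,1,2), of y]
    by (intro wp_runs) (simp add: visited_simps finite_visited split: if_splits)
next
  case (8 s')
  then show ?case by (simp add: score_def visited_simps sum.cartesian_product)
qed (use 0 in \<open>auto simp: visited_simps\<close>)

lemma runs_select_root:
  assumes M: "n \<le> M" and core: "core \<epsilon> w s"
    and W: "\<And>u v. u < n \<Longrightarrow> v < n \<Longrightarrow> rmem s 12 (u, v) = W (u, v)"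
  shows "runs \<omega> M select_root s (\<lambda>s'. nmem s' 34 (0, 0) = argmin (score W) n)"
  unfolding select_root_def
proof (rule runs_For[where K = n and Inv = "\<lambda>k s'. 0 < k \<longrightarrow>
    nmem s' 34 (0, 0) = argmin (score W) k \<and> rmem s' 14 (0, 0) = score W (argmin (score W) k)"], goal_cases)
  case (3 s')
  show ?case using core_n[OF core_unchanged[OF 3 core]] by simp
next
  case (5 y s1)
  let ?s = "rput 13 (0, 0) 0 s1"
  have c1: "core \<epsilon> w s1" by (rule core_unchanged[OF 5(2) core]) auto
  then have c: "core \<epsilon> w ?s" by (simp add: core_def)
  have W1: "rmem ?s 12 (u, v) = W (u, v)" if "u < n" "v < n" for u v
    using W[OF that] unchanged_rmem[OF 5(2), of 12] by simp
  let ?better = "Cond (BNot (BAnd (BNot (NLess (var 31) (NConst 1))) (BNot (RLess (real_var 13) (real_var 14)))))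
    (Seq (RPut 14 (NConst 0) (NConst 0) (real_var 13)) (assign 34 (var 31))) Skip"
  have "runs \<omega> M (Seq compute_score ?better) ?s (\<lambda>s'.
      nmem s' 34 (0, 0) = argmin (score W) (Suc y) \<and> rmem s' 14 (0, 0) = score W (argmin (score W) (Suc y)))"
  proof (rule runs_Seq_mono[OF runs_compute_score[OF M c _ 5(1) W1]], goal_cases)
    case sc: (5 s2)
    have s2: "nmem s2 31 (0, 0) = y" "nmem s2 34 = nmem s1 34" "rmem s2 14 = rmem s1 14"
      using 5(3) unchanged_nmem[OF sc(1), of 31] unchanged_nmem[OF sc(1), of 34] unchanged_rmem[OF sc(1), of 14] by auto
    have "0 < y \<Longrightarrow> argmin (score W) y = nmem s2 34 (0, 0) \<and> rmem s2 14 (0, 0) = score W (nmem s2 34 (0, 0))"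
      using 5(4) s2 by auto
    then show ?case using s2 sc(2) by (intro wp_runs) (cases "y = 0"; auto)
  qed (use 5 in auto)
  then have "runs \<omega> M (Seq compute_score ?better) ?s (\<lambda>s'. 0 < Suc y \<longrightarrow>
      nmem (nput 31 (0, 0) (Suc y) s') 34 (0, 0) = argmin (score W) (Suc y) \<and>
      rmem (nput 31 (0, 0) (Suc y) s') 14 (0, 0) = score W (argmin (score W) (Suc y)))"
    by (rule runs_mono) simp
  then show ?case by (intro runs_Seq[of \<omega> M "RPut 13 _ _ _"] wp_runs[of \<omega> "RPut 13 _ _ _"]) simp
next
  case (6 s')
  then show ?case using n_pos by simp
qed (use M in auto)

lemma runs_segment_noise:
  assumes M: "n \<le> M" and core: "core \<epsilon> w s"
  shows "runs \<omega> M segment_noise s (\<lambda>s'. used s' = used s + n \<and>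
    (\<forall>z<n. rmem s' 15 (z, 0) = lapl (\<omega> (used s + z))))"
  unfolding segment_noise_def
proof (rule runs_For[where K = n and Inv = "\<lambda>k s'. used s' = used s + k \<and>
    (\<forall>z<k. rmem s' 15 (z, 0) = lapl (\<omega> (used s + z)))"], goal_cases)
  case (3 s')
  show ?case using core_n[OF core_unchanged[OF 3 core]] by simp
next
  case (5 z s')
  then show ?case by (intro wp_runs) (auto simp: wp_sample_laplace less_Suc_eq)
qed (use M in auto)

lemma runs_accumulate:
  assumes M: "n \<le> M" and core: "core \<epsilon> w s" and x: "nmem s 20 (0, 0) = root t"
    and e: "\<And>z. z < n \<Longrightarrow> rmem s 7 (z, 0) = tree_est Y t z"
    and acc: "\<And>u v. u < n \<Longrightarrow> v < n \<Longrightarrow> rmem s 11 (u, v) = (\<Sum>t\<in>hits t u v. tree_est Y t u + tree_est Y t v)"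
    and cnt: "\<And>u v. u < n \<Longrightarrow> v < n \<Longrightarrow> nmem s 8 (u, v) = card (hits t u v)"
  shows "runs \<omega> M accumulate s (\<lambda>s'. \<forall>u<n. \<forall>v<n.
    rmem s' 11 (u, v) = (\<Sum>t\<in>hits (Suc t) u v. tree_est Y t u + tree_est Y t v) \<and>
    nmem s' 8 (u, v) = card (hits (Suc t) u v))"
  unfolding accumulate_def
proof (rule runs_For2[OF M core_n[OF core], where Inv = "\<lambda>a b s'. \<forall>u<n. \<forall>v<n.
    let k = (if (u, v) \<in> visited a b then Suc t else t) in
    rmem s' 11 (u, v) = (\<Sum>t\<in>hits k u v. tree_est Y t u + tree_est Y t v) \<and>
    nmem s' 8 (u, v) = card (hits k u v)"], goal_cases)
  case (6 a b s')
  have c: "core \<epsilon> w s'" by (rule core_unchanged[OF 6(3) core]) auto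
  have s': "nmem s' 20 (0, 0) = root t" "rmem s' 7 = rmem s 7"
    using x unchanged_nmem[OF 6(3), of 20] unchanged_rmem[OF 6(3), of 7] by auto
  have on: "bval s' (on_path (var 32) (var 20) (var 33)) \<longleftrightarrow> root t \<in> set (sp a b)"
    using bval_on_path[OF c, of "var 32" "var 20" "var 33"] 6 s' root_less[of t] by simp
  have new: "t \<notin> hits t a b" by (simp add: hits_def)
  have ab: "rmem s' 11 (a, b) = (\<Sum>t\<in>hits t a b. tree_est Y t a + tree_est Y t b)"
    "nmem s' 8 (a, b) = card (hits t a b)"
    using 6(1,2,6) visited_simps(5)[of a b] by (auto simp: Let_def)
  show ?case using 6 s' on ab new e
    by (intro wp_runs) (auto simp: Let_def visited_simps hits_Suc split: if_splits)
qed (use acc cnt in \<open>auto simp: visited_simps Let_def\<close>)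

lemma runs_update_weights:
  assumes M: "n \<le> M" and core: "core \<epsilon> w s" and x: "nmem s 20 (0, 0) = root t"
    and W: "\<And>u v. u < n \<Longrightarrow> v < n \<Longrightarrow> rmem s 12 (u, v) = weight t (u, v)"
  shows "runs \<omega> M update_weights s (\<lambda>s'. \<forall>u<n. \<forall>v<n. rmem s' 12 (u, v) = weight (Suc t) (u, v))"
  unfolding update_weights_def Let_def
proof (rule runs_For2[OF M core_n[OF core], where Inv = "\<lambda>a b s'. \<forall>u<n. \<forall>v<n.
    rmem s' 12 (u, v) = weight (if (u, v) \<in> visited a b then Suc t else t) (u, v)"], goal_cases)
  case (6 a b s')
  have c: "core \<epsilon> w s'" by (rule core_unchanged[OF 6(3) core]) auto
  have s': "nmem s' 20 (0, 0) = root t"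
    using x unchanged_nmem[OF 6(3), of 20] by auto
  have on: "bval s' (on_path (var 32) (var 20) (var 33)) \<longleftrightarrow> root t \<in> set (sp a b)"
    using bval_on_path[OF c, of "var 32" "var 20" "var 33"] 6 s' root_less[of t] by simp
  have ab: "rmem s' 12 (a, b) = weight t (a, b)"
    using 6(1,2,6) visited_simps(5)[of a b] by auto
  have "weight (Suc t) (a, b) = factor (root t) a b * weight t (a, b)" by (simp add: root_def)
  then show ?case using 6 s' on ab rval_factor[OF c 6(4,5,1,2), of "root t"]
    by (intro wp_runs) (auto simp: visited_simps split: if_splits simp del: weight.simps)
qed (use W in \<open>auto simp: visited_simps simp del: weight.simps\<close>)

text \<open>The value of \<open>used\<close> ties the samples drawn in round \<open>t\<close> to the
  indices \<open>n * n + t * n + z\<close> of its segments.\<close>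

definition main_inv :: "(nat \<Rightarrow> real) \<Rightarrow> nat \<Rightarrow> state \<Rightarrow> bool" where
  "main_inv Y t s \<longleftrightarrow> used s = n * n + t * n \<and> (\<forall>u<n. \<forall>v<n. rmem s 12 (u, v) = weight t (u, v) \<and>
     rmem s 11 (u, v) = (\<Sum>t\<in>hits t u v. tree_est Y t u + tree_est Y t v) \<and>
     nmem s 8 (u, v) = card (hits t u v))"

lemma runs_long_paths:
  assumes M: "8 * n \<le> M" and core: "core \<epsilon> w s" and \<mu>: "nmem s 9 (0, 0) = q"
    and Y5: "\<And>u v. u < n \<Longrightarrow> v < n \<Longrightarrow> rmem s 5 (u, v) = noisy \<epsilon> w \<omega> (u * n + v)"
    and init: "main_inv (noisy \<epsilon> w \<omega>) 0 s"
  shows "runs \<omega> M long_paths s (main_inv (noisy \<epsilon> w \<omega>) (8 * q))"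
  unfolding long_paths_def
proof (rule runs_For[where K = "8 * q" and Inv = "main_inv (noisy \<epsilon> w \<omega>)"], goal_cases)
  case (3 s')
  have "core \<epsilon> w s'" by (rule core_unchanged[OF 3 core]) auto
  then show ?case by (simp add: core_def Let_def)
next
  case 4
  then show ?case using init by (simp add: main_inv_def)
next
  case (5 t s1)
  let ?Y = "noisy \<epsilon> w \<omega>"
  note M' = order_trans[OF _ M, of n, simplified]
  have c1: "core \<epsilon> w s1" by (rule core_unchanged[OF 5(2) core]) auto
  have keep1: "nmem s1 9 (0, 0) = q" "rmem s1 5 = rmem s 5"
    using \<mu> unchanged_nmem[OF 5(2), of 9] unchanged_rmem[OF 5(2), of 5] by auto
  have m1: "used s1 = n * n + t * n" "\<And>u v. u < n \<Longrightarrow> v < n \<Longrightarrow> rmem s1 12 (u, v) = weight t (u, v)"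
    "\<And>u v. u < n \<Longrightarrow> v < n \<Longrightarrow> rmem s1 11 (u, v) = (\<Sum>t\<in>hits t u v. tree_est ?Y t u + tree_est ?Y t v)"
    "\<And>u v. u < n \<Longrightarrow> v < n \<Longrightarrow> nmem s1 8 (u, v) = card (hits t u v)"
    using 5(4) by (auto simp: main_inv_def)
  show ?case
  proof (rule runs_Seq_mono[OF runs_select_root[OF M' c1 m1(2)]], assumption, assumption, goal_cases)
    case (1 s2)
    let ?s3 = "nput 20 (0, 0) (root t) s2"
    have c3: "core \<epsilon> w ?s3"
      using core_unchanged[OF 1(1) c1] by (simp add: core_def)
    have keep3: "nmem ?s3 9 = nmem s1 9" "rmem ?s3 5 = rmem s1 5" "used ?s3 = used s1" "rmem ?s3 12 = rmem s1 12"
      "rmem ?s3 11 = rmem s1 11" "nmem ?s3 8 = nmem s1 8"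
      using unchanged_nmem[OF 1(1), of 9] unchanged_rmem[OF 1(1), of 5] unchanged_used[OF 1(1)]
        unchanged_rmem[OF 1(1), of 12] unchanged_rmem[OF 1(1), of 11] unchanged_nmem[OF 1(1), of 8] by auto
    have root: "nmem s2 34 (0, 0) = root t" using 1(2) by (simp add: root_def)
    have "runs \<omega> M (Seq segment_noise (Seq tree (Seq accumulate update_weights))) ?s3
        (\<lambda>s''. main_inv ?Y (Suc t) (nput 30 (0, 0) (Suc t) s''))"
    proof (rule runs_Seq_mono[OF runs_segment_noise[OF M' c3]], goal_cases)
      case (1 s4)
      have c4: "core \<epsilon> w s4" by (rule core_unchanged[OF 1(1) c3]) auto
      have keep4: "nmem s4 9 = nmem s1 9" "nmem s4 20 (0, 0) = root t" "rmem s4 5 = rmem s1 5" "rmem s4 12 = rmem s1 12"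
        "rmem s4 11 = rmem s1 11" "nmem s4 8 = nmem s1 8"
        using keep3 unchanged_nmem[OF 1(1), of 9] unchanged_nmem[OF 1(1), of 20] unchanged_rmem[OF 1(1), of 5]
          unchanged_rmem[OF 1(1), of 12] unchanged_rmem[OF 1(1), of 11] unchanged_nmem[OF 1(1), of 8] by auto
      have ti: "tree_input ?Y \<epsilon> w (root t) q (n * n + t * n) s4"
        using c4 keep4 keep1 Y5 root_less[of t] 1(2) keep3(3) m1(1)
        by (simp add: tree_input_def noisy_segment segment_query_def)
      show ?case
      proof (rule runs_Seq_mono[OF runs_tree[OF M' ti]], goal_cases)
        case trees: (1 s5)
        have c5: "core \<epsilon> w s5" by (rule core_unchanged[OF trees(1) c4]) auto
        have keep5: "nmem s5 20 (0, 0) = root t" "rmem s5 12 = rmem s1 12"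
          "rmem s5 11 = rmem s1 11" "nmem s5 8 = nmem s1 8"
          using keep4 unchanged_nmem[OF trees(1), of 20]
            unchanged_rmem[OF trees(1), of 12] unchanged_rmem[OF trees(1), of 11] unchanged_nmem[OF trees(1), of 8] by auto
        have used5: "used s5 = n * n + Suc t * n"
          using unchanged_used[OF trees(1)] 1(2) keep3(3) m1(1) by simp
        show ?case
        proof (rule runs_Seq_mono[OF runs_accumulate[OF M' c5 keep5(1), of ?Y]], goal_cases)
          case accs: (4 s6)
          have c6: "core \<epsilon> w s6" by (rule core_unchanged[OF accs(1) c5]) auto
          have keep6: "nmem s6 20 (0, 0) = root t" "rmem s6 12 = rmem s1 12" "used s6 = used s5"
            using keep5 unchanged_nmem[OF accs(1), of 20] unchanged_rmem[OF accs(1), of 12]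
              unchanged_used[OF accs(1)] by auto
          show ?case
          proof (rule runs_mono[OF runs_update_weights[OF M' c6 keep6(1)]], goal_cases)
            case (2 s7)
            have "rmem s7 11 = rmem s6 11" "nmem s7 8 = nmem s6 8" "used s7 = used s6"
              using unchanged_rmem[OF 2(1), of 11] unchanged_nmem[OF 2(1), of 8] unchanged_used[OF 2(1)] by auto
            then show ?case
              using 2(2) accs(2) used5 keep6(3) by (simp add: main_inv_def del: weight.simps)
          qed (use keep6 m1 in auto)
        qed (use keep5 m1 trees(2) in \<open>auto simp: tree_est_def\<close>)
      qed
    qed
    then show ?case
      by (intro runs_Seq[of \<omega> M "assign 20 (var 34)"] wp_runs[of \<omega> "assign 20 (var 34)"]) (simp add: root)
  qed
qed (use M rate_le[OF n_pos] in auto)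

lemma runs_write_output:
  assumes M: "n \<le> M" and core: "core \<epsilon> w s"
    and short: "\<And>u v. u < n \<Longrightarrow> v < n \<Longrightarrow> rmem s 10 (u, v) = est Y u 0 0 v"
    and long: "main_inv Y (8 * q) s"
  shows "runs \<omega> M write_output s (\<lambda>s'. output_of G s' = release Y)"
  unfolding write_output_def
proof (rule runs_For2[OF M core_n[OF core], where Inv = "\<lambda>a b s'. \<forall>(u, v)\<in>visited a b. rmem s' 3 (u, v) = estimate Y u v"], goal_cases)
  case (6 a b s')
  have c: "core \<epsilon> w s'" by (rule core_unchanged[OF 6(3) core]) auto
  have s': "nmem s' 8 = nmem s 8" "rmem s' 10 = rmem s 10" "rmem s' 11 = rmem s 11"
    using unchanged_nmem[OF 6(3), of 8] unchanged_rmem[OF 6(3), of 10] unchanged_rmem[OF 6(3), of 11] by auto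
  have less: "real (hops a b) < real q * real q \<longleftrightarrow> hops a b < q * q"
    by (simp only: of_nat_mult[symmetric] of_nat_less_iff)
  have l: "rmem s 11 (a, b) = (\<Sum>t\<in>hits (8 * q) a b. tree_est Y t a + tree_est Y t b)"
    "nmem s 8 (a, b) = card (hits (8 * q) a b)"
    using long 6(1,2) by (auto simp: main_inv_def)
  show ?case using 6 s' c less short l
    by (intro wp_runs) (auto simp: core_def visited_simps estimate_def)
next
  case (8 s')
  then show ?case by (auto simp: output_of_def release_def verts_def restrict_def fun_eq_iff visited_simps)
qed (auto simp: visited_simps)

text \<open>The output agrees with \<open>release\<close> for each tape and not merely in
  distribution, as \<open>polynomial_time\<close> demands. The loop bound is 8 n because of the 8 q
  rounds and q <= n.\<close>

lemma runs_program:
  "runs \<omega> (8 * n) program (input_state \<epsilon> G w) (\<lambda>s'. output_of G s' = release (noisy \<epsilon> w \<omega>))"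
  unfolding program_def
proof (rule runs_Seq_mono[OF runs_compute_params[OF _ n_pos]], goal_cases)
  case (3 s1)
  let ?s = "input_state \<epsilon> G w" and ?Y = "noisy \<epsilon> w \<omega>"
  have M: "n \<le> 8 * n" by simp
  have "nmem s1 0 = nmem ?s 0" "nmem s1 1 = nmem ?s 1" "nmem s1 5 = nmem ?s 5" "nmem s1 8 = nmem ?s 8" "nmem s1 9 = nmem ?s 9"
    "rmem s1 = rmem ?s" "used s1 = used ?s"
    using unchanged_nmem[OF 3(1)] unchanged_rmem[OF 3(1)] unchanged_used[OF 3(1)] by auto
  note keep1 = this[unfolded input_state_def, simplified]
  have i1: "nmem s1 0 (0, 0) = n" "nmem s1 5 = (\<lambda>_. 0)" "rmem s1 4 = (\<lambda>_. 0)" "nmem s1 8 = (\<lambda>_. 0)"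
    "nmem s1 9 = (\<lambda>_. 0)" "rmem s1 11 = (\<lambda>_. 0)" "used s1 = 0" "rmem s1 0 (0, 0) = \<epsilon>"
    "\<And>u v. rmem s1 2 (u, v) = edge_weight w u v"
    by (auto simp: keep1 edge_weight_def fun_eq_iff)
  have g1: "input_graph s1" by (auto simp: input_graph_def keep1)
  show ?case
  proof (rule runs_Seq_mono[OF runs_init_paths[OF M i1(1-3)]], goal_cases)
    case init: (1 s2)
    have g2: "input_graph s2" by (rule input_graph_unchanged[OF init(1) g1]) auto
    show ?case
    proof (rule runs_Seq_mono[OF runs_bellman_ford[OF M init(2) g2]], goal_cases)
      case bf: (1 s3)
      have u3: "nmem s3 a = nmem s1 a" if "a \<notin> {5, 12, 13, 14, 15}" for a
        using unchanged_nmem[OF bf(1), of a] unchanged_nmem[OF init(1), of a] that by auto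
      have v3: "rmem s3 a = rmem s1 a" if "a \<noteq> 4" for a
        using unchanged_rmem[OF bf(1), of a] unchanged_rmem[OF init(1), of a] that by auto
      have used3: "used s3 = 0"
        using unchanged_used[OF bf(1)] unchanged_used[OF init(1)] i1(7) by simp
      have "nmem s3 5 (u, v) = hops u v \<and> rmem s3 4 (u, v) = dist u v" if "u < n" "v < n" for u v
      proof -
        have "(u, v) \<in> near (n + 1)" using that hops_le_n[OF that] by (simp add: near_def)
        then show ?thesis using bf(2) by (auto simp: exact_def)
      qed
      then have c3: "core \<epsilon> w s3"
        using u3 v3 i1 3(2) by (simp add: core_def)
      show ?case
      proof (rule runs_Seq_mono[OF runs_noisy_edges[OF M c3 used3, where \<omega> = \<omega>]], goal_cases)
        case noise: (1 s4)
        have c4: "core \<epsilon> w s4" by (rule core_unchanged[OF noise(1) c3]) auto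
        have keep4: "nmem s4 9 (0, 0) = 0" "nmem s4 8 = (\<lambda>_. 0)" "rmem s4 11 = (\<lambda>_. 0)"
          using unchanged_nmem[OF noise(1)] unchanged_rmem[OF noise(1)] u3 v3 i1 by auto
        show ?case
        proof (rule runs_Seq_mono[OF runs_short_paths[OF M c4 keep4(1), where Y = ?Y]], goal_cases)
          case short: (2 s5)
          let ?s6 = "nput 9 (0, 0) (nmem s5 4 (0, 0)) s5"
          have "core \<epsilon> w s5" by (rule core_unchanged[OF short(1) c4]) auto
          then have c6: "core \<epsilon> w ?s6" and 9: "nmem ?s6 9 (0, 0) = q" by (auto simp: core_def)
          have keep6: "nmem ?s6 8 = (\<lambda>_. 0)" "rmem ?s6 11 = (\<lambda>_. 0)" "rmem ?s6 5 = rmem s4 5" "used ?s6 = n * n"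
            using unchanged_nmem[OF short(1)] unchanged_rmem[OF short(1)] unchanged_used[OF short(1)] keep4 noise(2) by auto
          have "runs \<omega> (8 * n) (Seq init_weights (Seq long_paths write_output)) ?s6 (\<lambda>s'. output_of G s' = release ?Y)"
          proof (rule runs_Seq_mono[OF runs_init_weights[OF M c6]], goal_cases)
            case weights: (1 s7)
            have c7: "core \<epsilon> w s7" by (rule core_unchanged[OF weights(1) c6]) auto
            have keep7: "nmem s7 9 (0, 0) = q" "nmem s7 8 = (\<lambda>_. 0)" "rmem s7 11 = (\<lambda>_. 0)" "rmem s7 5 = rmem s4 5"
              "used s7 = n * n" "rmem s7 10 = rmem s5 10"
              using 9 keep6 unchanged_nmem[OF weights(1), of 8] unchanged_nmem[OF weights(1), of 9]
                unchanged_rmem[OF weights(1), of 11] unchanged_rmem[OF weights(1), of 5]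
                unchanged_rmem[OF weights(1), of 10] unchanged_used[OF weights(1)] by auto
            have inv: "main_inv ?Y 0 s7" using weights(2) keep7 by (simp add: main_inv_def hits_def)
            show ?case
            proof (rule runs_Seq_mono[OF runs_long_paths[OF order_refl c7 keep7(1) _ inv]], goal_cases)
              case long: (2 s8)
              have c8: "core \<epsilon> w s8" by (rule core_unchanged[OF long(1) c7]) auto
              show ?case
                by (rule runs_write_output[OF M c8 _ long(2)])
                  (use short(2) keep7(6) unchanged_rmem[OF long(1), of 10] in auto)
            qed (use keep7 noise(2) in auto)
          qed
          then show ?case
            by (intro runs_Seq[of \<omega> _ "assign 9 (var 4)"] wp_runs[of \<omega> "assign 9 (var 4)"]) simp
        qed (use noise(2) in auto)
      qed
    qed
  qed
qed (auto simp: input_state_def)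

end

section \<open>Efficiency, privacy and accuracy combined\<close>

theorem theorem3p1:
  "\<exists>K::real > 0. \<forall>\<epsilon>::real > 0. \<exists>A :: algorithm.
     polynomial_time \<epsilon> A \<and>
     pure_differentially_private \<epsilon> A \<and>
     (\<forall>G w. public_graph G \<and> is_attribute G w \<longrightarrow>
        measure (A G w) {f \<in> space (A G w). max_error G w f
            \<le> K * (real (nverts G) powr (1/3) * ln (real (nverts G)) powr (5/6) / \<epsilon>)}
          \<ge> 1 - 1 / real (nverts G))"
proof (intro exI[of _ 4608] conjI allI impI)
  fix \<epsilon> :: real assume \<epsilon>: "\<epsilon> > 0"
  let ?A = "\<lambda>G. pgraph.mechanism G \<epsilon>"
  have "polynomial_time \<epsilon> ?A"
  proof -
    obtain p where p: "\<And>k. cost (8 * k) program \<le> poly p k" using cost_poly[of 8 program] by blast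
    show ?thesis
      unfolding polynomial_time_def
    proof (rule exI[of _ program], rule exI[of _ p], intro allI impI)
      fix G w assume "public_graph G \<and> is_attribute G w"
      then interpret pgraph G by unfold_locales simp
      show "\<exists>F\<in>random_tape \<rightarrow>\<^sub>M output_space G. mechanism \<epsilon> w = distr random_tape (output_space G) F \<and>
          (\<forall>\<omega>\<in>space random_tape. \<exists>t s. exec \<omega> program (input_state \<epsilon> G w) t s \<and>
            t \<le> poly p (nverts G) \<and> output_of G s = F \<omega>)"
        using runs_program[of _ \<epsilon> w] order_trans[OF _ p[of n]]
        by (intro bexI[OF _ release_noisy_measurable[of \<epsilon> w]] conjI ballI)
          (auto simp: mechanism_def runs_def, blast)
    qed
  qed
  moreover have "pure_differentially_private \<epsilon> ?A"
    unfolding differentially_private_def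
  proof (intro allI impI ballI)
    fix G w w' C
    assume "public_graph G \<and> is_attribute G w \<and> is_attribute G w' \<and> neighboring G w w'"
      and C: "C \<in> sets (output_space G)"
    then interpret pgraph G by unfold_locales simp
    show "measure (mechanism \<epsilon> w) C \<le> exp \<epsilon> * measure (mechanism \<epsilon> w') C + 0"
      using mechanism_private \<open>public_graph G \<and> _\<close> \<epsilon> C by simp
  qed
  moreover have "1 - 1 / real (nverts G) \<le> measure (?A G w) {f \<in> space (?A G w). max_error G w f
      \<le> 4608 * (real (nverts G) powr (1/3) * ln (real (nverts G)) powr (5/6) / \<epsilon>)}"
    if "public_graph G \<and> is_attribute G w" for G w
  proof -
    interpret pgraph G by unfold_locales (use that in simp)
    show ?thesis
    proof (cases "n \<ge> 2")
      case True
      \<comment> \<open>The final constant is 4608 = 4 * 144 * 8: the noise terms of an estimate,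
        the constant in \<open>bound\<close>, and that of \<open>rate_sqrt_lg_le\<close>.\<close>
      have "4 * bound \<epsilon> = 576 * (real q * sqrt (real (lg n))) / \<epsilon>" by (simp add: bound_def)
      also have "\<dots> \<le> 576 * (8 * (real n powr (1/3) * ln (real n) powr (5/6))) / \<epsilon>"
        using rate_sqrt_lg_le[OF True] \<epsilon> by (intro divide_right_mono mult_left_mono) auto
      finally show ?thesis by (intro mechanism_accurate[OF True \<epsilon>]) simp
    next
      case False
      \<comment> \<open>For a single vertex the required probability is 0.\<close>
      then have "real n = 1" using n_pos by simp
      then show ?thesis by (simp add: measure_nonneg)
    qed
  qed
  ultimately show "\<exists>A :: algorithm. polynomial_time \<epsilon> A \<and> pure_differentially_private \<epsilon> A \<and>
     (\<forall>G w. public_graph G \<and> is_attribute G w \<longrightarrow>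
        measure (A G w) {f \<in> space (A G w). max_error G w f
            \<le> 4608 * (real (nverts G) powr (1/3) * ln (real (nverts G)) powr (5/6) / \<epsilon>)}
          \<ge> 1 - 1 / real (nverts G))"
    by (intro exI[of _ ?A]) blast
qed simp

end
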